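(* Let $\mathcal{C}$ be a nilpotent fusion category over $k$ with commutative Grothendieck ring, and let $\mathcal{C} = \oplus_{g \in U(\mathcal{C})} \mathcal{C}_g$ be its universal grading. Suppose $\mathcal{D}$ is a fusion subcategory of $\mathcal{C}$ such that $\mathcal{D} \cap \mathcal{C}_g \neq 0$ for all $g \in U(\mathcal{C})$. Then $\mathcal{D} = \mathcal{C}$.
   Context: $k$ is an algebraically closed field of characteristic zero. A fusion category over $k$ is a $k$-linear semisimple rigid tensor category with finitely many isomorphism classes of simple objects, finite-dimensional Hom spaces and simple unit object $\mathbf{1}$. A fusion subcategory is a full tensor subcategory stable under direct sums and subobjects. The adjoint subcategory $\mathcal{C}_{\mathrm{ad}}$ is the fusion subcategory generated by $X \otimes X^*$, $X$ running over the simple objects of $\mathcal{C}$. Set $\mathcal{C}^{(0)} = \mathcal{C}$ and $\mathcal{C}^{(n)} = (\mathcal{C}^{(n-1)})_{\mathrm{ad}}$ for $n \geq 1$; $\mathcal{C}$ is nilpotent if $\mathcal{C}^{(n)} = \mathrm{Vec}_k$ for some $n \ge 0$. A grading of $\mathcal{C}$ by a group $G$ is a decomposition $\mathcal{C} = \oplus_{g\in G}\mathcal{C}_g$ into full abelian subcategories with $\mathcal{C}_g^* = \mathcal{C}_{g^{-1}}$ and $\otimes$ mapping $\mathcal{C}_g\times \mathcal{C}_h$ to $\mathcal{C}_{gh}$; it is faithful if all $\mathcal{C}_g \neq 0$. Every fusion category has a canonical faithful grading, the universal grading, by a group $U(\mathcal{C})$ (the universal grading group), whose trivial component is $\mathcal{C}_e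 = \mathcal{C}_{\mathrm{ad}}$; it is universal in that every grading of $\mathcal{C}$ by a group $G$ is obtained from it through a unique group homomorphism $U(\mathcal{C}) \to G$. *)

theory Defs
  imports "HOL-Algebra.Algebra"
begin

text \<open>The library reserves \<open>X\<close> as notation for the polynomial indeterminate.\<close>

no_notation Polynomials.var ("X\<index>")

text \<open>
  The data of a \<open>k\<close>-linear monoidal category. Objects form a set; the hom-sets need not be
  disjoint, but composition, addition, scaling and the tensor product of morphisms do not
  carry object indices. Every category can be presented in this way by tagging morphisms with their
  source and target.
\<close>

record ('o, 'm, 'k) linear_monoidal =
  Obj :: "'o set"
  Hom :: "'o \<Rightarrow> 'o \<Rightarrow> 'm set"
  ident :: "'o \<Rightarrow> 'm"
  cmp :: "'m \<Rightarrow> 'm \<Rightarrow> 'm" (infixl "\<bullet>\<index>" 70)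
  addm :: "'m \<Rightarrow> 'm \<Rightarrow> 'm"
  zerom :: "'o \<Rightarrow> 'o \<Rightarrow> 'm"
  scalem :: "'k \<Rightarrow> 'm \<Rightarrow> 'm"
  unito :: 'o
  teno :: "'o \<Rightarrow> 'o \<Rightarrow> 'o" (infixl "\<otimes>\<^sub>o\<index>" 75)
  tenm :: "'m \<Rightarrow> 'm \<Rightarrow> 'm" (infixl "\<otimes>\<^sub>m\<index>" 75)
  assoc :: "'o \<Rightarrow> 'o \<Rightarrow> 'o \<Rightarrow> 'm"
  lunit :: "'o \<Rightarrow> 'm"
  runit :: "'o \<Rightarrow> 'm"

text \<open>The multiplicative fields of the record are irrelevant for the library's \<open>module\<close> locale.\<close>

definition hom_module ::
    "('o, 'm, 'k) linear_monoidal \<Rightarrow> 'o \<Rightarrow> 'o \<Rightarrow> ('k, 'm) module" where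
  "hom_module C X Y =
     \<lparr>carrier = Hom C X Y, monoid.mult = undefined, one = undefined,
      ring.zero = zerom C X Y, add = addm C, smult = scalem C\<rparr>"

definition full_subcat ::
    "('o, 'm, 'k) linear_monoidal \<Rightarrow> 'o set \<Rightarrow> ('o, 'm, 'k) linear_monoidal" where
  "full_subcat C A = C\<lparr>Obj := A\<rparr>"


section \<open>Linear and abelian categories\<close>

locale linear_category =
  fixes K :: "'k ring" and C :: "('o, 'm, 'k) linear_monoidal" (structure)
  assumes field_K: "field K"
    and ident_in: "X \<in> Obj C \<Longrightarrow> ident C X \<in> Hom C X X"
    and cmp_in: "\<lbrakk>X \<in> Obj C; Y \<in> Obj C; Z \<in> Obj C; f \<in> Hom C X Y; g \<in> Hom C Y Z\<rbrakk>
      \<Longrightarrow> g \<bullet> f \<in> Hom C X Z"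
    and cmp_ident_right: "\<lbrakk>X \<in> Obj C; Y \<in> Obj C; f \<in> Hom C X Y\<rbrakk> \<Longrightarrow> f \<bullet> ident C X = f"
    and cmp_ident_left: "\<lbrakk>X \<in> Obj C; Y \<in> Obj C; f \<in> Hom C X Y\<rbrakk> \<Longrightarrow> ident C Y \<bullet> f = f"
    and cmp_assoc: "\<lbrakk>W \<in> Obj C; X \<in> Obj C; Y \<in> Obj C; Z \<in> Obj C;
        f \<in> Hom C W X; g \<in> Hom C X Y; h \<in> Hom C Y Z\<rbrakk> \<Longrightarrow> h \<bullet> (g \<bullet> f) = (h \<bullet> g) \<bullet> f"
    and hom_module: "\<lbrakk>X \<in> Obj C; Y \<in> Obj C\<rbrakk> \<Longrightarrow> module K (hom_module C X Y)"
    and cmp_add_right: "\<lbrakk>X \<in> Obj C; Y \<in> Obj C; Z \<in> Obj C;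
        f \<in> Hom C X Y; f' \<in> Hom C X Y; g \<in> Hom C Y Z\<rbrakk>
      \<Longrightarrow> g \<bullet> addm C f f' = addm C (g \<bullet> f) (g \<bullet> f')"
    and cmp_add_left: "\<lbrakk>X \<in> Obj C; Y \<in> Obj C; Z \<in> Obj C;
        f \<in> Hom C X Y; g \<in> Hom C Y Z; g' \<in> Hom C Y Z\<rbrakk>
      \<Longrightarrow> addm C g g' \<bullet> f = addm C (g \<bullet> f) (g' \<bullet> f)"
    and cmp_scale_right: "\<lbrakk>X \<in> Obj C; Y \<in> Obj C; Z \<in> Obj C;
        a \<in> carrier K; f \<in> Hom C X Y; g \<in> Hom C Y Z\<rbrakk>
      \<Longrightarrow> g \<bullet> scalem C a f = scalem C a (g \<bullet> f)"
    and cmp_scale_left: "\<lbrakk>X \<in> Obj C; Y \<in> Obj C; Z \<in> Obj C;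
        a \<in> carrier K; f \<in> Hom C X Y; g \<in> Hom C Y Z\<rbrakk>
      \<Longrightarrow> scalem C a g \<bullet> f = scalem C a (g \<bullet> f)"

definition inverse_pair ::
    "('o, 'm, 'k) linear_monoidal \<Rightarrow> 'o \<Rightarrow> 'o \<Rightarrow> 'm \<Rightarrow> 'm \<Rightarrow> bool" where
  "inverse_pair C X Y f g \<longleftrightarrow> X \<in> Obj C \<and> Y \<in> Obj C \<and> f \<in> Hom C X Y \<and> g \<in> Hom C Y X \<and>
     g \<bullet>\<^bsub>C\<^esub> f = ident C X \<and> f \<bullet>\<^bsub>C\<^esub> g = ident C Y"

definition isomorphism :: "('o, 'm, 'k) linear_monoidal \<Rightarrow> 'o \<Rightarrow> 'o \<Rightarrow> 'm \<Rightarrow> bool" where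
  "isomorphism C X Y f \<longleftrightarrow> (\<exists>g. inverse_pair C X Y f g)"

definition inverse_mor :: "('o, 'm, 'k) linear_monoidal \<Rightarrow> 'o \<Rightarrow> 'o \<Rightarrow> 'm \<Rightarrow> 'm" where
  "inverse_mor C X Y f = (THE g. inverse_pair C X Y f g)"

definition isomorphic :: "('o, 'm, 'k) linear_monoidal \<Rightarrow> 'o \<Rightarrow> 'o \<Rightarrow> bool" where
  "isomorphic C X Y \<longleftrightarrow> (\<exists>f. isomorphism C X Y f)"

definition monic :: "('o, 'm, 'k) linear_monoidal \<Rightarrow> 'o \<Rightarrow> 'o \<Rightarrow> 'm \<Rightarrow> bool" where
  "monic C X Y f \<longleftrightarrow> X \<in> Obj C \<and> Y \<in> Obj C \<and> f \<in> Hom C X Y \<and>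
     (\<forall>W \<in> Obj C. \<forall>g \<in> Hom C W X. \<forall>h \<in> Hom C W X. f \<bullet>\<^bsub>C\<^esub> g = f \<bullet>\<^bsub>C\<^esub> h \<longrightarrow> g = h)"

definition epic :: "('o, 'm, 'k) linear_monoidal \<Rightarrow> 'o \<Rightarrow> 'o \<Rightarrow> 'm \<Rightarrow> bool" where
  "epic C X Y f \<longleftrightarrow> X \<in> Obj C \<and> Y \<in> Obj C \<and> f \<in> Hom C X Y \<and>
     (\<forall>W \<in> Obj C. \<forall>g \<in> Hom C Y W. \<forall>h \<in> Hom C Y W. g \<bullet>\<^bsub>C\<^esub> f = h \<bullet>\<^bsub>C\<^esub> f \<longrightarrow> g = h)"

definition zero_object :: "('o, 'm, 'k) linear_monoidal \<Rightarrow> 'o \<Rightarrow> bool" where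
  "zero_object C X \<longleftrightarrow> X \<in> Obj C \<and>
     (\<forall>Y \<in> Obj C. (\<exists>!f. f \<in> Hom C X Y) \<and> (\<exists>!f. f \<in> Hom C Y X))"

text \<open>
  \<open>W\<close> is a biproduct of the finite family \<open>Xs\<close>; for the empty list the condition says that the
  identity of \<open>W\<close> vanishes, so the empty direct sums are the zero objects.
\<close>

definition direct_sum :: "('o, 'm, 'k) linear_monoidal \<Rightarrow> 'o \<Rightarrow> 'o list \<Rightarrow> bool" where
  "direct_sum C W Xs \<longleftrightarrow> W \<in> Obj C \<and> set Xs \<subseteq> Obj C \<and>
     (\<exists>\<iota> \<pi>. (\<forall>i < length Xs. \<iota> i \<in> Hom C (Xs ! i) W \<and> \<pi> i \<in> Hom C W (Xs ! i)) \<and>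
       (\<forall>i < length Xs. \<forall>j < length Xs.
          \<pi> j \<bullet>\<^bsub>C\<^esub> \<iota> i = (if i = j then ident C (Xs ! i) else zerom C (Xs ! i) (Xs ! j))) \<and>
       finsum (hom_module C W W) (\<lambda>i. \<iota> i \<bullet>\<^bsub>C\<^esub> \<pi> i) {..<length Xs} = ident C W)"

definition is_kernel ::
    "('o, 'm, 'k) linear_monoidal \<Rightarrow> 'o \<Rightarrow> 'o \<Rightarrow> 'm \<Rightarrow> 'o \<Rightarrow> 'm \<Rightarrow> bool" where
  "is_kernel C X Y f N i \<longleftrightarrow> N \<in> Obj C \<and> i \<in> Hom C N X \<and> f \<bullet>\<^bsub>C\<^esub> i = zerom C N Y \<and>
     (\<forall>W \<in> Obj C. \<forall>g \<in> Hom C W X. f \<bullet>\<^bsub>C\<^esub> g = zerom C W Y \<longrightarrow>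
        (\<exists>!h. h \<in> Hom C W N \<and> i \<bullet>\<^bsub>C\<^esub> h = g))"

definition is_cokernel ::
    "('o, 'm, 'k) linear_monoidal \<Rightarrow> 'o \<Rightarrow> 'o \<Rightarrow> 'm \<Rightarrow> 'o \<Rightarrow> 'm \<Rightarrow> bool" where
  "is_cokernel C X Y f Q p \<longleftrightarrow> Q \<in> Obj C \<and> p \<in> Hom C Y Q \<and> p \<bullet>\<^bsub>C\<^esub> f = zerom C X Q \<and>
     (\<forall>W \<in> Obj C. \<forall>g \<in> Hom C Y W. g \<bullet>\<^bsub>C\<^esub> f = zerom C X W \<longrightarrow>
        (\<exists>!h. h \<in> Hom C Q W \<and> h \<bullet>\<^bsub>C\<^esub> p = g))"

text \<open>The enrichment in abelian groups is part of \<open>linear_category\<close> and is not repeated here.\<close>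

definition abelian_category :: "('o, 'm, 'k) linear_monoidal \<Rightarrow> bool" where
  "abelian_category C \<longleftrightarrow>
     (\<exists>Z. zero_object C Z) \<and>
     (\<forall>X \<in> Obj C. \<forall>Y \<in> Obj C. \<exists>W. direct_sum C W [X, Y]) \<and>
     (\<forall>X \<in> Obj C. \<forall>Y \<in> Obj C. \<forall>f \<in> Hom C X Y.
        (\<exists>N i. is_kernel C X Y f N i) \<and> (\<exists>Q p. is_cokernel C X Y f Q p)) \<and>
     (\<forall>X Y f. monic C X Y f \<longrightarrow> (\<exists>Z \<in> Obj C. \<exists>g \<in> Hom C Y Z. is_kernel C Y Z g X f)) \<and>
     (\<forall>X Y f. epic C X Y f \<longrightarrow> (\<exists>Z \<in> Obj C. \<exists>g \<in> Hom C Z X. is_cokernel C Z X g Y f))"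

definition simple_object :: "('o, 'm, 'k) linear_monoidal \<Rightarrow> 'o \<Rightarrow> bool" where
  "simple_object C X \<longleftrightarrow> X \<in> Obj C \<and> \<not> zero_object C X \<and>
     (\<forall>Y i. monic C Y X i \<longrightarrow> zero_object C Y \<or> isomorphism C Y X i)"

definition iso_class :: "('o, 'm, 'k) linear_monoidal \<Rightarrow> 'o \<Rightarrow> 'o set" where
  "iso_class C X = {Y. isomorphic C X Y}"

definition simple_classes :: "('o, 'm, 'k) linear_monoidal \<Rightarrow> 'o set set" where
  "simple_classes C = iso_class C ` {X. simple_object C X}"


section \<open>Tensor categories and fusion categories\<close>

locale linear_monoidal_category = linear_category K C
  for K :: "'k ring" and C :: "('o, 'm, 'k) linear_monoidal" (structure) +
  assumes unit_in: "unito C \<in> Obj C"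
    and teno_in: "\<lbrakk>X \<in> Obj C; Y \<in> Obj C\<rbrakk> \<Longrightarrow> X \<otimes>\<^sub>o Y \<in> Obj C"
    and tenm_in: "\<lbrakk>X \<in> Obj C; X' \<in> Obj C; Y \<in> Obj C; Y' \<in> Obj C;
        f \<in> Hom C X X'; g \<in> Hom C Y Y'\<rbrakk> \<Longrightarrow> f \<otimes>\<^sub>m g \<in> Hom C (X \<otimes>\<^sub>o Y) (X' \<otimes>\<^sub>o Y')"
    and tenm_ident: "\<lbrakk>X \<in> Obj C; Y \<in> Obj C\<rbrakk>
      \<Longrightarrow> ident C X \<otimes>\<^sub>m ident C Y = ident C (X \<otimes>\<^sub>o Y)"
    and tenm_cmp: "\<lbrakk>X \<in> Obj C; X' \<in> Obj C; X'' \<in> Obj C; Y \<in> Obj C; Y' \<in> Obj C; Y'' \<in> Obj C;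
        f \<in> Hom C X X'; f' \<in> Hom C X' X''; g \<in> Hom C Y Y'; g' \<in> Hom C Y' Y''\<rbrakk>
      \<Longrightarrow> (f' \<bullet> f) \<otimes>\<^sub>m (g' \<bullet> g) = (f' \<otimes>\<^sub>m g') \<bullet> (f \<otimes>\<^sub>m g)"
    and tenm_add_left: "\<lbrakk>X \<in> Obj C; X' \<in> Obj C; Y \<in> Obj C; Y' \<in> Obj C;
        f \<in> Hom C X X'; f' \<in> Hom C X X'; g \<in> Hom C Y Y'\<rbrakk>
      \<Longrightarrow> addm C f f' \<otimes>\<^sub>m g = addm C (f \<otimes>\<^sub>m g) (f' \<otimes>\<^sub>m g)"
    and tenm_add_right: "\<lbrakk>X \<in> Obj C; X' \<in> Obj C; Y \<in> Obj C; Y' \<in> Obj C;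
        f \<in> Hom C X X'; g \<in> Hom C Y Y'; g' \<in> Hom C Y Y'\<rbrakk>
      \<Longrightarrow> f \<otimes>\<^sub>m addm C g g' = addm C (f \<otimes>\<^sub>m g) (f \<otimes>\<^sub>m g')"
    and tenm_scale_left: "\<lbrakk>X \<in> Obj C; X' \<in> Obj C; Y \<in> Obj C; Y' \<in> Obj C;
        a \<in> carrier K; f \<in> Hom C X X'; g \<in> Hom C Y Y'\<rbrakk>
      \<Longrightarrow> scalem C a f \<otimes>\<^sub>m g = scalem C a (f \<otimes>\<^sub>m g)"
    and tenm_scale_right: "\<lbrakk>X \<in> Obj C; X' \<in> Obj C; Y \<in> Obj C; Y' \<in> Obj C;
        a \<in> carrier K; f \<in> Hom C X X'; g \<in> Hom C Y Y'\<rbrakk>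
      \<Longrightarrow> f \<otimes>\<^sub>m scalem C a g = scalem C a (f \<otimes>\<^sub>m g)"
    and assoc_iso: "\<lbrakk>X \<in> Obj C; Y \<in> Obj C; Z \<in> Obj C\<rbrakk>
      \<Longrightarrow> isomorphism C (X \<otimes>\<^sub>o Y \<otimes>\<^sub>o Z) (X \<otimes>\<^sub>o (Y \<otimes>\<^sub>o Z)) (assoc C X Y Z)"
    and assoc_natural: "\<lbrakk>X \<in> Obj C; X' \<in> Obj C; Y \<in> Obj C; Y' \<in> Obj C; Z \<in> Obj C; Z' \<in> Obj C;
        f \<in> Hom C X X'; g \<in> Hom C Y Y'; h \<in> Hom C Z Z'\<rbrakk>
      \<Longrightarrow> assoc C X' Y' Z' \<bullet> (f \<otimes>\<^sub>m g \<otimes>\<^sub>m h) = (f \<otimes>\<^sub>m (g \<otimes>\<^sub>m h)) \<bullet> assoc C X Y Z"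
    and lunit_iso: "X \<in> Obj C \<Longrightarrow> isomorphism C (unito C \<otimes>\<^sub>o X) X (lunit C X)"
    and lunit_natural: "\<lbrakk>X \<in> Obj C; X' \<in> Obj C; f \<in> Hom C X X'\<rbrakk>
      \<Longrightarrow> lunit C X' \<bullet> (ident C (unito C) \<otimes>\<^sub>m f) = f \<bullet> lunit C X"
    and runit_iso: "X \<in> Obj C \<Longrightarrow> isomorphism C (X \<otimes>\<^sub>o unito C) X (runit C X)"
    and runit_natural: "\<lbrakk>X \<in> Obj C; X' \<in> Obj C; f \<in> Hom C X X'\<rbrakk>
      \<Longrightarrow> runit C X' \<bullet> (f \<otimes>\<^sub>m ident C (unito C)) = f \<bullet> runit C X"
    and pentagon: "\<lbrakk>W \<in> Obj C; X \<in> Obj C; Y \<in> Obj C; Z \<in> Obj C\<rbrakk>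
      \<Longrightarrow> (ident C W \<otimes>\<^sub>m assoc C X Y Z) \<bullet> assoc C W (X \<otimes>\<^sub>o Y) Z \<bullet> (assoc C W X Y \<otimes>\<^sub>m ident C Z)
        = assoc C W X (Y \<otimes>\<^sub>o Z) \<bullet> assoc C (W \<otimes>\<^sub>o X) Y Z"
    and triangle: "\<lbrakk>X \<in> Obj C; Y \<in> Obj C\<rbrakk>
      \<Longrightarrow> (ident C X \<otimes>\<^sub>m lunit C Y) \<bullet> assoc C X (unito C) Y = runit C X \<otimes>\<^sub>m ident C Y"

text \<open>
  \<open>X'\<close> is a left dual of \<open>X\<close>, with evaluation \<open>X' \<otimes> X \<rightarrow> 1\<close> and coevaluation \<open>1 \<rightarrow> X \<otimes> X'\<close>.
  In the two zigzag identities the unit constraint on the source has been moved to the right-hand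
  side. The dual \<open>X*\<close> of an object always means its left dual.
\<close>

definition left_dual :: "('o, 'm, 'k) linear_monoidal \<Rightarrow> 'o \<Rightarrow> 'o \<Rightarrow> bool" where
  "left_dual C X X' \<longleftrightarrow> X \<in> Obj C \<and> X' \<in> Obj C \<and>
     (\<exists>ev \<in> Hom C (X' \<otimes>\<^sub>o\<^bsub>C\<^esub> X) (unito C). \<exists>coev \<in> Hom C (unito C) (X \<otimes>\<^sub>o\<^bsub>C\<^esub> X').
        runit C X \<bullet>\<^bsub>C\<^esub> (ident C X \<otimes>\<^sub>m\<^bsub>C\<^esub> ev) \<bullet>\<^bsub>C\<^esub> assoc C X X' X \<bullet>\<^bsub>C\<^esub> (coev \<otimes>\<^sub>m\<^bsub>C\<^esub> ident C X)
          = lunit C X \<and>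
        lunit C X' \<bullet>\<^bsub>C\<^esub> (ev \<otimes>\<^sub>m\<^bsub>C\<^esub> ident C X') \<bullet>\<^bsub>C\<^esub>
            inverse_mor C (X' \<otimes>\<^sub>o\<^bsub>C\<^esub> X \<otimes>\<^sub>o\<^bsub>C\<^esub> X') (X' \<otimes>\<^sub>o\<^bsub>C\<^esub> (X \<otimes>\<^sub>o\<^bsub>C\<^esub> X')) (assoc C X' X X') \<bullet>\<^bsub>C\<^esub>
            (ident C X' \<otimes>\<^sub>m\<^bsub>C\<^esub> coev)
          = runit C X')"

locale fusion_category = linear_monoidal_category K C
  for K :: "'k ring" and C :: "('o, 'm, 'k) linear_monoidal" (structure) +
  assumes abelian: "abelian_category C"
    and semisimple: "X \<in> Obj C
      \<Longrightarrow> \<exists>Xs. (\<forall>Y \<in> set Xs. simple_object C Y) \<and> direct_sum C X Xs"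
    and rigid: "X \<in> Obj C \<Longrightarrow> (\<exists>Y. left_dual C X Y) \<and> (\<exists>Y. left_dual C Y X)"
    and finite_simple_classes: "finite (simple_classes C)"
    and hom_finite_dimensional: "\<lbrakk>X \<in> Obj C; Y \<in> Obj C\<rbrakk>
      \<Longrightarrow> \<exists>B. finite B \<and> B \<subseteq> Hom C X Y \<and>
        (\<forall>f \<in> Hom C X Y. \<exists>a \<in> B \<rightarrow> carrier K.
           f = finsum (hom_module C X Y) (\<lambda>b. scalem C (a b) b) B)"
    and unit_simple: "simple_object C (unito C)"


section \<open>The Grothendieck ring\<close>

definition multiplicity :: "('o, 'm, 'k) linear_monoidal \<Rightarrow> 'o set \<Rightarrow> 'o \<Rightarrow> nat" where
  "multiplicity C S W = (THE n. \<exists>Xs. (\<forall>X \<in> set Xs. simple_object C X) \<and> direct_sum C W Xs \<and>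
     n = length (filter (\<lambda>X. X \<in> S) Xs))"

definition object_class :: "('o, 'm, 'k) linear_monoidal \<Rightarrow> 'o \<Rightarrow> ('o set \<Rightarrow>\<^sub>0 int)" where
  "object_class C W =
     (\<Sum>S \<in> simple_classes C. frag_cmul (int (multiplicity C S W)) (frag_of S))"

text \<open>
  The free abelian group on the isomorphism classes of simple objects, with the bilinear
  multiplication determined by \<open>[X][Y] = [X \<otimes> Y]\<close> for simple \<open>X\<close> and \<open>Y\<close>.
\<close>

definition grothendieck_ring :: "('o, 'm, 'k) linear_monoidal \<Rightarrow> ('o set \<Rightarrow>\<^sub>0 int) ring" where
  "grothendieck_ring C =
     \<lparr>carrier = carrier (free_Abelian_group (simple_classes C)),
      monoid.mult = (\<lambda>x y. frag_extend (\<lambda>S. frag_extend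
        (\<lambda>T. object_class C ((SOME X. X \<in> S) \<otimes>\<^sub>o\<^bsub>C\<^esub> (SOME Y. Y \<in> T))) y) x),
      one = object_class C (unito C),
      ring.zero = 0,
      add = (+)\<rparr>"

definition commutative_grothendieck_ring :: "('o, 'm, 'k) linear_monoidal \<Rightarrow> bool" where
  "commutative_grothendieck_ring C \<longleftrightarrow>
     (\<forall>x \<in> carrier (grothendieck_ring C). \<forall>y \<in> carrier (grothendieck_ring C).
        x \<otimes>\<^bsub>grothendieck_ring C\<^esub> y = y \<otimes>\<^bsub>grothendieck_ring C\<^esub> x)"


section \<open>Fusion subcategories, nilpotency\<close>

text \<open>
  Full subcategories are given by their sets of objects. Closure under subobjects makes a fusion
  subcategory closed under isomorphism, so that equality of fusion subcategories is equality of
  these sets. Closure under duals is not demanded: for fusion categories it is a consequence.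
\<close>

definition fusion_subcategory :: "('o, 'm, 'k) linear_monoidal \<Rightarrow> 'o set \<Rightarrow> bool" where
  "fusion_subcategory C D \<longleftrightarrow> D \<subseteq> Obj C \<and> unito C \<in> D \<and>
     (\<forall>X \<in> D. \<forall>Y \<in> D. X \<otimes>\<^sub>o\<^bsub>C\<^esub> Y \<in> D) \<and>
     (\<forall>W Xs. set Xs \<subseteq> D \<and> direct_sum C W Xs \<longrightarrow> W \<in> D) \<and>
     (\<forall>X Y i. X \<in> D \<and> monic C Y X i \<longrightarrow> Y \<in> D)"

definition generated_fusion_subcategory ::
    "('o, 'm, 'k) linear_monoidal \<Rightarrow> 'o set \<Rightarrow> 'o set" where
  "generated_fusion_subcategory C S = \<Inter>{D. fusion_subcategory C D \<and> S \<subseteq> D}"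

definition adjoint_subcategory :: "('o, 'm, 'k) linear_monoidal \<Rightarrow> 'o set" where
  "adjoint_subcategory C =
     generated_fusion_subcategory C {X \<otimes>\<^sub>o\<^bsub>C\<^esub> X' | X X'. simple_object C X \<and> left_dual C X X'}"

primrec adjoint_series :: "('o, 'm, 'k) linear_monoidal \<Rightarrow> nat \<Rightarrow> 'o set" where
  "adjoint_series C 0 = Obj C"
| "adjoint_series C (Suc n) = adjoint_subcategory (full_subcat C (adjoint_series C n))"

definition vec_subcategory :: "('o, 'm, 'k) linear_monoidal \<Rightarrow> 'o set" where
  "vec_subcategory C = {X. \<exists>n. direct_sum C X (replicate n (unito C))}"

definition nilpotent_category :: "('o, 'm, 'k) linear_monoidal \<Rightarrow> bool" where
  "nilpotent_category C \<longleftrightarrow> (\<exists>n. adjoint_series C n = vec_subcategory C)"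


section \<open>Gradings\<close>

definition full_abelian_subcategory :: "('o, 'm, 'k) linear_monoidal \<Rightarrow> 'o set \<Rightarrow> bool" where
  "full_abelian_subcategory C A \<longleftrightarrow> A \<subseteq> Obj C \<and>
     (\<forall>X Y. X \<in> A \<and> isomorphic C X Y \<longrightarrow> Y \<in> A) \<and> abelian_category (full_subcat C A)"

definition grading ::
    "('o, 'm, 'k) linear_monoidal \<Rightarrow> 'g monoid \<Rightarrow> ('g \<Rightarrow> 'o set) \<Rightarrow> bool" where
  "grading C G A \<longleftrightarrow> group G \<and>
     (\<forall>g \<in> carrier G. full_abelian_subcategory C (A g)) \<and>
     (\<forall>X \<in> Obj C. \<exists>Xs. set Xs \<subseteq> (\<Union>g \<in> carrier G. A g) \<and> direct_sum C X Xs) \<and>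
     (\<forall>g \<in> carrier G. \<forall>h \<in> carrier G. g \<noteq> h \<longrightarrow>
        (\<forall>X \<in> A g. \<forall>Y \<in> A h. Hom C X Y = {zerom C X Y})) \<and>
     (\<forall>g \<in> carrier G. {X'. \<exists>X \<in> A g. left_dual C X X'} = A (inv\<^bsub>G\<^esub> g)) \<and>
     (\<forall>g \<in> carrier G. \<forall>h \<in> carrier G. \<forall>X \<in> A g. \<forall>Y \<in> A h.
        X \<otimes>\<^sub>o\<^bsub>C\<^esub> Y \<in> A (g \<otimes>\<^bsub>G\<^esub> h))"

definition faithful_grading ::
    "('o, 'm, 'k) linear_monoidal \<Rightarrow> 'g monoid \<Rightarrow> ('g \<Rightarrow> 'o set) \<Rightarrow> bool" where
  "faithful_grading C G A \<longleftrightarrow> grading C G A \<and>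
     (\<forall>g \<in> carrier G. \<exists>X \<in> A g. \<not> zero_object C X)"

text \<open>
  The component of degree \<open>h\<close> of the grading induced along \<open>\<phi>\<close> is the direct sum of the
  components \<open>A g\<close> with \<open>\<phi> g = h\<close>.
\<close>

definition induced_grading ::
    "('o, 'm, 'k) linear_monoidal \<Rightarrow> 'g monoid \<Rightarrow> ('g \<Rightarrow> 'o set) \<Rightarrow> ('g \<Rightarrow> 'h) \<Rightarrow> 'h \<Rightarrow> 'o set"
  where
  "induced_grading C U A \<phi> h =
     {X. \<exists>Xs. set Xs \<subseteq> (\<Union>g \<in> {g \<in> carrier U. \<phi> g = h}. A g) \<and> direct_sum C X Xs}"

text \<open>
  The universal property is stated for groups carried by sets of natural numbers. This is no
  restriction: a fusion category has only finitely many simple objects up to isomorphism, so the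
  support of a grading by any group is a finite subgroup.
\<close>

definition universal_grading ::
    "('o, 'm, 'k) linear_monoidal \<Rightarrow> 'u monoid \<Rightarrow> ('u \<Rightarrow> 'o set) \<Rightarrow> bool" where
  "universal_grading C U A \<longleftrightarrow> faithful_grading C U A \<and>
     A \<one>\<^bsub>U\<^esub> = adjoint_subcategory C \<and>
     (\<forall>(G :: nat monoid) B. grading C G B \<longrightarrow>
        (\<exists>!\<phi>. \<phi> \<in> hom U G \<inter> extensional (carrier U) \<and>
              (\<forall>h \<in> carrier G. B h = induced_grading C U A \<phi> h)))"

end

theory Submission
  imports Defs
begin

text \<open>
  The statement is the analogue of the fact that a subgroup \<open>H\<close> of a nilpotent group \<open>G\<close> with
  \<open>H[G, G] = G\<close> is all of \<open>G\<close>. For a fusion subcategory \<open>E\<close> let the commutator \<open>E\<^sup>c\<^sup>o\<close> consist of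
  the objects all of whose simple constituents \<open>Z\<close> satisfy \<open>Z \<otimes> Z* \<in> E\<close>. If the Grothendieck ring
  is commutative, then \<open>E\<^sup>c\<^sup>o\<close> is again a fusion subcategory and contains \<open>E\<close>, and it is made so
  that \<open>A\<^sub>a\<^sub>d \<subseteq> E\<close> implies \<open>A \<subseteq> E\<^sup>c\<^sup>o\<close> for every fusion subcategory \<open>A\<close>.

  Now suppose that \<open>E\<close> meets all components of the universal grading. If \<open>E\<close> also contains the
  adjoint subcategory, then \<open>E\<close> is everything: for \<open>X\<close> in the component of degree \<open>g\<close> choose
  \<open>Y \<noteq> 0\<close> in \<open>E\<close> of the same degree; then \<open>X \<otimes> Y*\<close> has trivial degree, so it lies in \<open>E\<close>, and \<open>X\<close> is a
  subobject of \<open>X \<otimes> Y* \<otimes> Y \<in> E\<close> (\<open>adjoint_le_meets_components_imp_eq\<close>). By induction on \<open>n\<close>, it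
  is enough that \<open>E\<close> contains the \<open>n\<close>-th term of the adjoint series
  (\<open>adjoint_series_le_imp_eq\<close>): if \<open>E\<close> contains the term of index \<open>n + 1\<close>, then \<open>E\<^sup>c\<^sup>o\<close> contains
  the one of index \<open>n\<close>, so \<open>E\<^sup>c\<^sup>o\<close> is everything by induction, which means that \<open>E\<close> contains
  the adjoint subcategory. In a nilpotent category some term of the series consists of the
  multiples of the unit object, and these lie in every fusion subcategory.

  Commutativity is an identity between multiplicities of simple objects, so most of the argument is
  arithmetic with these. Multiplicities are well defined by the exchange argument of
  \<open>simple_summands_card_eq\<close>, they are additive, and \<open>mult_tensor_commute\<close> extends the
  commutativity of products from simple objects to all objects. Two facts about duals are needed
  besides. Fusion subcategories are closed under duals (\<open>fusion_subcategory_left_dual\<close>); this is a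
  counting argument in which the finiteness of the number of simple objects is essential. And if \<open>Z\<close>
  is a constituent of \<open>X \<otimes> Y\<close>, then the constituents of \<open>Z*\<close> are constituents of \<open>Y* \<otimes> X*\<close>
  (part of \<open>tensor_dual_constituents\<close>); this rests on a weak form of Frobenius reciprocity,
  \<open>left_dual_reciprocity\<close>.
\<close>


section \<open>Zero morphisms, differences and biproducts\<close>

lemma additive_map_finsum:
  assumes G: "abelian_monoid G" and H: "abelian_monoid H"
    and \<phi>: "\<phi> \<in> carrier G \<rightarrow> carrier H" "\<phi> \<zero>\<^bsub>G\<^esub> = \<zero>\<^bsub>H\<^esub>"
    and add: "\<And>x y. \<lbrakk>x \<in> carrier G; y \<in> carrier G\<rbrakk> \<Longrightarrow> \<phi> (x \<oplus>\<^bsub>G\<^esub> y) = \<phi> x \<oplus>\<^bsub>H\<^esub> \<phi> y"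
    and A: "finite A" "f \<in> A \<rightarrow> carrier G"
  shows "\<phi> (finsum G f A) = finsum H (\<lambda>i. \<phi> (f i)) A"
  using A
proof (induction A rule: finite_induct)
  case empty
  show ?case
    using \<phi>(2) by (simp add: abelian_monoid.finsum_empty[OF G] abelian_monoid.finsum_empty[OF H])
next
  case (insert a A)
  then have f: "f \<in> A \<rightarrow> carrier G" "f a \<in> carrier G"
    by auto
  moreover have "(\<lambda>i. \<phi> (f i)) \<in> A \<rightarrow> carrier H" "\<phi> (f a) \<in> carrier H"
    using f \<phi>(1) by auto
  ultimately show ?case
    using insert by (simp add: abelian_monoid.finsum_insert[OF G] abelian_monoid.finsum_insert[OF H]
        add abelian_monoid.finsum_closed[OF G])
qed


context linear_category
begin

text \<open>
  The premises that fix the intermediate object come first, so that proof search finds it.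
\<close>

lemma cmp_closed:
  "\<lbrakk>f \<in> Hom C X Y; g \<in> Hom C Y Z; X \<in> Obj C; Y \<in> Obj C; Z \<in> Obj C\<rbrakk> \<Longrightarrow> g \<bullet> f \<in> Hom C X Z"
  by (rule cmp_in)

lemma cmp_ident [simp]:
  "\<lbrakk>f \<in> Hom C X Y; X \<in> Obj C; Y \<in> Obj C\<rbrakk> \<Longrightarrow> ident C Y \<bullet> f = f"
  "\<lbrakk>f \<in> Hom C X Y; X \<in> Obj C; Y \<in> Obj C\<rbrakk> \<Longrightarrow> f \<bullet> ident C X = f"
  by (simp_all add: cmp_ident_left cmp_ident_right)

declare ident_in [simp]

lemma hom_module_simps [simp]:
  "carrier (hom_module C X Y) = Hom C X Y"
  "\<zero>\<^bsub>hom_module C X Y\<^esub> = zerom C X Y"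
  "f \<oplus>\<^bsub>hom_module C X Y\<^esub> g = addm C f g"
  by (simp_all add: hom_module_def)

lemma hom_abelian_group:
  "\<lbrakk>X \<in> Obj C; Y \<in> Obj C\<rbrakk> \<Longrightarrow> abelian_group (hom_module C X Y)"
  using hom_module by (meson module.axioms(2))

lemma hom_abelian_monoid:
  "\<lbrakk>X \<in> Obj C; Y \<in> Obj C\<rbrakk> \<Longrightarrow> abelian_monoid (hom_module C X Y)"
  using hom_abelian_group by (rule abelian_group.axioms(1))

lemma zerom_in [intro, simp]: "\<lbrakk>X \<in> Obj C; Y \<in> Obj C\<rbrakk> \<Longrightarrow> zerom C X Y \<in> Hom C X Y"
  using abelian_monoid.zero_closed[OF hom_abelian_monoid] by simp

lemma addm_zerom:
  assumes "X \<in> Obj C" "Y \<in> Obj C" "f \<in> Hom C X Y"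
  shows "addm C (zerom C X Y) f = f" "addm C f (zerom C X Y) = f"
  using abelian_monoid.l_zero[OF hom_abelian_monoid, of X Y f]
    abelian_monoid.r_zero[OF hom_abelian_monoid, of X Y f] assms by simp_all

lemma addm_right_cancel:
  assumes "X \<in> Obj C" "Y \<in> Obj C" "f \<in> Hom C X Y" "g \<in> Hom C X Y" "h \<in> Hom C X Y"
    and "addm C f h = addm C g h"
  shows "f = g"
proof -
  interpret H: abelian_group "hom_module C X Y"
    using assms hom_abelian_group by blast
  show ?thesis
    using H.add.r_cancel[of f h g] assms by simp
qed

lemma addm_idem_zerom:
  assumes "X \<in> Obj C" "Y \<in> Obj C" "f \<in> Hom C X Y" "addm C f f = f"
  shows "f = zerom C X Y"
  using addm_right_cancel[of X Y f "zerom C X Y" f] assms by (simp add: addm_zerom)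

lemma cmp_zerom_right [simp]:
  assumes "g \<in> Hom C Y Z" "X \<in> Obj C" "Y \<in> Obj C" "Z \<in> Obj C"
  shows "g \<bullet> zerom C X Y = zerom C X Z"
proof (rule addm_idem_zerom)
  show "addm C (g \<bullet> zerom C X Y) (g \<bullet> zerom C X Y) = g \<bullet> zerom C X Y"
    using cmp_add_right[of X Y Z "zerom C X Y" "zerom C X Y" g] assms by (simp add: addm_zerom)
qed (use assms cmp_in in auto)

lemma cmp_zerom_left [simp]:
  assumes "f \<in> Hom C X Y" "X \<in> Obj C" "Y \<in> Obj C" "Z \<in> Obj C"
  shows "zerom C Y Z \<bullet> f = zerom C X Z"
proof (rule addm_idem_zerom)
  show "addm C (zerom C Y Z \<bullet> f) (zerom C Y Z \<bullet> f) = zerom C Y Z \<bullet> f"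
    using cmp_add_left[of X Y Z f "zerom C Y Z" "zerom C Y Z"] assms by (simp add: addm_zerom)
qed (use assms cmp_in in auto)

definition diff :: "'o \<Rightarrow> 'o \<Rightarrow> 'm \<Rightarrow> 'm \<Rightarrow> 'm" where
  "diff X Y f g = f \<ominus>\<^bsub>hom_module C X Y\<^esub> g"

lemma diff_in:
  assumes "X \<in> Obj C" "Y \<in> Obj C" "f \<in> Hom C X Y" "g \<in> Hom C X Y"
  shows "diff X Y f g \<in> Hom C X Y"
  using abelian_group.minus_closed[OF hom_abelian_group, of X Y f g] assms
  by (simp add: diff_def)

lemma addm_diff:
  assumes "X \<in> Obj C" "Y \<in> Obj C" "f \<in> Hom C X Y" "g \<in> Hom C X Y"
  shows "addm C (diff X Y f g) g = f"
proof -
  interpret H: abelian_group "hom_module C X Y"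
    using assms hom_abelian_group by blast
  have g: "\<ominus>\<^bsub>hom_module C X Y\<^esub> g \<in> Hom C X Y"
    using H.a_inv_closed[of g] assms by simp
  show ?thesis
    using H.a_assoc[of f "\<ominus>\<^bsub>hom_module C X Y\<^esub> g" g] H.l_neg[of g] g assms
    by (simp add: diff_def a_minus_def addm_zerom)
qed

lemma diff_eqI:
  assumes "X \<in> Obj C" "Y \<in> Obj C" "f \<in> Hom C X Y" "g \<in> Hom C X Y" "d \<in> Hom C X Y"
    and "addm C d g = f"
  shows "diff X Y f g = d"
  by (rule addm_right_cancel[of X Y _ _ g]) (use assms in \<open>simp_all add: diff_in addm_diff\<close>)

lemma diff_self [simp]:
  "\<lbrakk>X \<in> Obj C; Y \<in> Obj C; f \<in> Hom C X Y\<rbrakk> \<Longrightarrow> diff X Y f f = zerom C X Y"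
  by (rule diff_eqI) (simp_all add: addm_zerom)

lemma diff_zerom [simp]:
  "\<lbrakk>X \<in> Obj C; Y \<in> Obj C; f \<in> Hom C X Y\<rbrakk> \<Longrightarrow> diff X Y f (zerom C X Y) = f"
  by (rule diff_eqI) (simp_all add: addm_zerom)

lemma diff_eq_zerom_iff:
  assumes "X \<in> Obj C" "Y \<in> Obj C" "f \<in> Hom C X Y" "g \<in> Hom C X Y"
  shows "diff X Y f g = zerom C X Y \<longleftrightarrow> f = g"
  using addm_diff[OF assms] assms by (auto simp: addm_zerom)

lemma cmp_diff_right:
  assumes "X \<in> Obj C" "Y \<in> Obj C" "Z \<in> Obj C" "f \<in> Hom C X Y" "f' \<in> Hom C X Y" "g \<in> Hom C Y Z"
  shows "g \<bullet> diff X Y f f' = diff X Z (g \<bullet> f) (g \<bullet> f')"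
proof (rule diff_eqI[symmetric])
  show "addm C (g \<bullet> diff X Y f f') (g \<bullet> f') = g \<bullet> f"
    using cmp_add_right[of X Y Z "diff X Y f f'" f' g] assms by (simp add: diff_in addm_diff)
qed (use assms in \<open>auto intro!: cmp_closed diff_in\<close>)

lemma cmp_finsum_left:
  assumes "X \<in> Obj C" "Y \<in> Obj C" "Z \<in> Obj C" "f \<in> Hom C X Y"
    and "finite I" "\<And>i. i \<in> I \<Longrightarrow> g i \<in> Hom C Y Z"
  shows "finsum (hom_module C Y Z) g I \<bullet> f = finsum (hom_module C X Z) (\<lambda>i. g i \<bullet> f) I"
  using assms
  by (intro additive_map_finsum[where \<phi> = "\<lambda>g. g \<bullet> f"])
    (auto simp: hom_abelian_monoid cmp_add_left intro: cmp_closed)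

lemma cmp_finsum_right:
  assumes "X \<in> Obj C" "Y \<in> Obj C" "Z \<in> Obj C" "g \<in> Hom C Y Z"
    and "finite I" "\<And>i. i \<in> I \<Longrightarrow> f i \<in> Hom C X Y"
  shows "g \<bullet> finsum (hom_module C X Y) f I = finsum (hom_module C X Z) (\<lambda>i. g \<bullet> f i) I"
  using assms
  by (intro additive_map_finsum[where \<phi> = "\<lambda>f. g \<bullet> f"])
    (auto simp: hom_abelian_monoid cmp_add_right intro: cmp_closed)

lemma finsum_zerom:
  assumes "X \<in> Obj C" "Y \<in> Obj C" "\<And>i. i \<in> I \<Longrightarrow> f i = zerom C X Y"
  shows "finsum (hom_module C X Y) f I = zerom C X Y"
proof -
  interpret H: abelian_monoid "hom_module C X Y"
    using assms hom_abelian_monoid by blast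
  have "finsum (hom_module C X Y) f I = finsum (hom_module C X Y) (\<lambda>i. zerom C X Y) I"
    using assms by (intro H.finsum_cong') auto
  then show ?thesis
    using H.finsum_zero[of I] by simp
qed

text \<open>
  Joint monicity of the projections replaces the usual condition \<open>\<Sum>\<iota>\<^sub>i\<pi>\<^sub>i = 1\<close>: the two are
  equivalent (\<open>biproduct_sum\<close>, \<open>sum_jointly_monic\<close>), but the former passes to kernels and to
  iterated biproducts without any computation with sums. Arbitrary index sets allow the removal of
  one summand and dependent sums of index sets.
\<close>

definition biproduct ::
    "'o \<Rightarrow> 'i set \<Rightarrow> ('i \<Rightarrow> 'o) \<Rightarrow> ('i \<Rightarrow> 'm) \<Rightarrow> ('i \<Rightarrow> 'm) \<Rightarrow> bool" where
  "biproduct W I X \<iota> \<pi> \<longleftrightarrow> finite I \<and> W \<in> Obj C \<and>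
     (\<forall>i\<in>I. X i \<in> Obj C \<and> \<iota> i \<in> Hom C (X i) W \<and> \<pi> i \<in> Hom C W (X i)) \<and>
     (\<forall>i\<in>I. \<forall>j\<in>I. \<pi> j \<bullet> \<iota> i = (if i = j then ident C (X i) else zerom C (X i) (X j))) \<and>
     (\<forall>V\<in>Obj C. \<forall>f\<in>Hom C V W. (\<forall>i\<in>I. \<pi> i \<bullet> f = zerom C V (X i)) \<longrightarrow> f = zerom C V W)"

lemma biproductD:
  assumes "biproduct W I X \<iota> \<pi>"
  shows "finite I" "W \<in> Obj C"
    "\<And>i. i \<in> I \<Longrightarrow> X i \<in> Obj C"
    "\<And>i. i \<in> I \<Longrightarrow> \<iota> i \<in> Hom C (X i) W"
    "\<And>i. i \<in> I \<Longrightarrow> \<pi> i \<in> Hom C W (X i)"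
    "\<And>i. i \<in> I \<Longrightarrow> \<pi> i \<bullet> \<iota> i = ident C (X i)"
    "\<And>i j. \<lbrakk>i \<in> I; j \<in> I; i \<noteq> j\<rbrakk> \<Longrightarrow> \<pi> j \<bullet> \<iota> i = zerom C (X i) (X j)"
  using assms unfolding biproduct_def by auto

lemma biproduct_jointly_monic:
  assumes "biproduct W I X \<iota> \<pi>" "V \<in> Obj C" "f \<in> Hom C V W"
    "\<And>i. i \<in> I \<Longrightarrow> \<pi> i \<bullet> f = zerom C V (X i)"
  shows "f = zerom C V W"
  using assms unfolding biproduct_def by blast

lemma biproductI:
  assumes "finite I" "W \<in> Obj C"
    "\<And>i. i \<in> I \<Longrightarrow> X i \<in> Obj C"
    "\<And>i. i \<in> I \<Longrightarrow> \<iota> i \<in> Hom C (X i) W"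
    "\<And>i. i \<in> I \<Longrightarrow> \<pi> i \<in> Hom C W (X i)"
    "\<And>i. i \<in> I \<Longrightarrow> \<pi> i \<bullet> \<iota> i = ident C (X i)"
    "\<And>i j. \<lbrakk>i \<in> I; j \<in> I; i \<noteq> j\<rbrakk> \<Longrightarrow> \<pi> j \<bullet> \<iota> i = zerom C (X i) (X j)"
    "\<And>V f. \<lbrakk>V \<in> Obj C; f \<in> Hom C V W; \<And>i. i \<in> I \<Longrightarrow> \<pi> i \<bullet> f = zerom C V (X i)\<rbrakk>
       \<Longrightarrow> f = zerom C V W"
  shows "biproduct W I X \<iota> \<pi>"
  using assms unfolding biproduct_def by auto

text \<open>Both sides have the same composite with every projection.\<close>

lemma biproduct_sum:
  assumes B: "biproduct W I X \<iota> \<pi>"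
  shows "finsum (hom_module C W W) (\<lambda>i. \<iota> i \<bullet> \<pi> i) I = ident C W" (is "?s = _")
proof -
  note D = biproductD[OF B]
  interpret H: abelian_group "hom_module C W W"
    using D(2) hom_abelian_group by blast
  have e: "\<iota> i \<bullet> \<pi> i \<in> Hom C W W" if "i \<in> I" for i
    using that D cmp_in by metis
  have s: "?s \<in> Hom C W W"
    using H.finsum_closed[of "\<lambda>i. \<iota> i \<bullet> \<pi> i" I] e by (auto simp: Pi_iff)
  have "\<pi> j \<bullet> ?s = \<pi> j" if j: "j \<in> I" for j
  proof -
    interpret Hj: abelian_group "hom_module C W (X j)"
      using D(2,3) j hom_abelian_group by blast
    have pe: "\<pi> j \<bullet> (\<iota> i \<bullet> \<pi> i) = (if j = i then \<pi> j else \<zero>\<^bsub>hom_module C W (X j)\<^esub>)"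
      if "i \<in> I" for i
      using that j D by (auto simp: cmp_assoc[of W "X i" W "X j"] cmp_ident_left)
    have "\<pi> j \<bullet> ?s = finsum (hom_module C W (X j)) (\<lambda>i. \<pi> j \<bullet> (\<iota> i \<bullet> \<pi> i)) I"
      using j D e by (intro cmp_finsum_right) auto
    also have "\<dots> = finsum (hom_module C W (X j))
        (\<lambda>i. if j = i then \<pi> j else \<zero>\<^bsub>hom_module C W (X j)\<^esub>) I"
      using j D pe by (intro Hj.add.finprod_cong') (auto simp: Pi_iff)
    also have "\<dots> = \<pi> j"
      using j D by (intro Hj.add.finprod_singleton[where f = "\<lambda>_. \<pi> j"]) auto
    finally show ?thesis .
  qed
  then have "\<pi> j \<bullet> diff W W ?s (ident C W) = zerom C W (X j)" if "j \<in> I" for j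
    using that D(2) D(3,5)[OF that] s cmp_diff_right[of W W "X j" ?s "ident C W" "\<pi> j"]
    by simp
  then have "diff W W ?s (ident C W) = zerom C W W"
    using B D s by (intro biproduct_jointly_monic[OF B]) (auto intro: diff_in)
  then show ?thesis
    using D s by (simp add: diff_eq_zerom_iff)
qed

lemma biproduct_jointly_epic:
  assumes B: "biproduct W I X \<iota> \<pi>" and V: "V \<in> Obj C" and f: "f \<in> Hom C W V"
    and 0: "\<And>i. i \<in> I \<Longrightarrow> f \<bullet> \<iota> i = zerom C (X i) V"
  shows "f = zerom C W V"
proof -
  note D = biproductD[OF B]
  have e: "\<iota> i \<bullet> \<pi> i \<in> Hom C W W" if "i \<in> I" for i
    using that D cmp_in by metis
  have "f = f \<bullet> finsum (hom_module C W W) (\<lambda>i. \<iota> i \<bullet> \<pi> i) I"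
    using biproduct_sum[OF B] D V f by simp
  also have "\<dots> = finsum (hom_module C W V) (\<lambda>i. f \<bullet> (\<iota> i \<bullet> \<pi> i)) I"
    using D V f e by (intro cmp_finsum_right) auto
  also have "\<dots> = zerom C W V"
  proof (rule finsum_zerom)
    fix i assume "i \<in> I"
    then show "f \<bullet> (\<iota> i \<bullet> \<pi> i) = zerom C W V"
      using cmp_assoc[of W "X i" W V "\<pi> i" "\<iota> i" f] V f D(2) D(3-5)[of i] 0[of i] by simp
  qed (use V D in auto)
  finally show ?thesis .
qed

lemma sum_jointly_monic:
  assumes "finite I" "W \<in> Obj C"
    and obj: "\<And>i. i \<in> I \<Longrightarrow> X i \<in> Obj C"
    and \<iota>: "\<And>i. i \<in> I \<Longrightarrow> \<iota> i \<in> Hom C (X i) W"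
    and \<pi>: "\<And>i. i \<in> I \<Longrightarrow> \<pi> i \<in> Hom C W (X i)"
    and sum: "finsum (hom_module C W W) (\<lambda>i. \<iota> i \<bullet> \<pi> i) I = ident C W"
    and V: "V \<in> Obj C" and f: "f \<in> Hom C V W"
    and 0: "\<And>i. i \<in> I \<Longrightarrow> \<pi> i \<bullet> f = zerom C V (X i)"
  shows "f = zerom C V W"
proof -
  have e: "\<iota> i \<bullet> \<pi> i \<in> Hom C W W" if "i \<in> I" for i
    using that assms(2) obj \<iota> \<pi> cmp_in by metis
  have "f = finsum (hom_module C W W) (\<lambda>i. \<iota> i \<bullet> \<pi> i) I \<bullet> f"
    using sum V f assms(2) by simp
  also have "\<dots> = finsum (hom_module C V W) (\<lambda>i. \<iota> i \<bullet> \<pi> i \<bullet> f) I"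
    using V f e assms(1,2) by (intro cmp_finsum_left) auto
  also have "\<dots> = zerom C V W"
  proof (rule finsum_zerom)
    fix i assume "i \<in> I"
    then show "\<iota> i \<bullet> \<pi> i \<bullet> f = zerom C V W"
      using cmp_assoc[of V W "X i" W f "\<pi> i" "\<iota> i", symmetric] V f assms(2)
        obj[of i] \<iota>[of i] \<pi>[of i] 0[of i] by simp
  qed (use V assms(2) in auto)
  finally show ?thesis .
qed

lemma direct_sum_biproduct:
  assumes "direct_sum C W Xs"
  obtains \<iota> \<pi> where "biproduct W {..<length Xs} (\<lambda>i. Xs ! i) \<iota> \<pi>"
proof -
  have W: "W \<in> Obj C" and Xs: "set Xs \<subseteq> Obj C"
    using assms unfolding direct_sum_def by blast+
  obtain \<iota> \<pi> where
    in_Hom: "\<forall>i<length Xs. \<iota> i \<in> Hom C (Xs ! i) W \<and> \<pi> i \<in> Hom C W (Xs ! i)" and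
    orth: "\<forall>i<length Xs. \<forall>j<length Xs.
      \<pi> j \<bullet> \<iota> i = (if i = j then ident C (Xs ! i) else zerom C (Xs ! i) (Xs ! j))" and
    sum: "finsum (hom_module C W W) (\<lambda>i. \<iota> i \<bullet> \<pi> i) {..<length Xs} = ident C W"
    using assms unfolding direct_sum_def by (elim conjE exE) blast
  have obj: "Xs ! i \<in> Obj C" if "i < length Xs" for i
    using that Xs nth_mem by blast
  show ?thesis
  proof
    show "biproduct W {..<length Xs} (\<lambda>i. Xs ! i) \<iota> \<pi>"
    proof (rule biproductI)
      show "f = zerom C V W" if "V \<in> Obj C" "f \<in> Hom C V W"
        "\<And>i. i \<in> {..<length Xs} \<Longrightarrow> \<pi> i \<bullet> f = zerom C V (Xs ! i)" for V f
        by (rule sum_jointly_monic[of "{..<length Xs}" W "\<lambda>i. Xs ! i" \<iota> \<pi>])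
          (use W in_Hom obj sum that in auto)
    qed (use W obj in_Hom orth in auto)
  qed
qed

lemma biproduct_refine:
  assumes B: "biproduct W I X \<iota> \<pi>"
    and Bi: "\<And>i. i \<in> I \<Longrightarrow> biproduct (X i) (J i) (Y i) (\<iota>' i) (\<pi>' i)"
  shows "biproduct W (Sigma I J) (\<lambda>(i, j). Y i j) (\<lambda>(i, j). \<iota> i \<bullet> \<iota>' i j) (\<lambda>(i, j). \<pi>' i j \<bullet> \<pi> i)"
proof -
  note D = biproductD[OF B] and Di = biproductD[OF Bi]
  have \<pi>\<iota>: "(\<pi>' k l \<bullet> \<pi> k) \<bullet> (\<iota> i \<bullet> \<iota>' i j) = \<pi>' k l \<bullet> ((\<pi> k \<bullet> \<iota> i) \<bullet> \<iota>' i j)"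
    if "i \<in> I" "j \<in> J i" "k \<in> I" "l \<in> J k" for i j k l
  proof -
    note ij = D(2) D(3-5)[OF that(1)] Di(3-5)[OF that(1,2)]
      D(3-5)[OF that(3)] Di(3-5)[OF that(3,4)]
    have "\<iota> i \<bullet> \<iota>' i j \<in> Hom C (Y i j) W"
      using cmp_closed[of "\<iota>' i j" "Y i j" "X i" "\<iota> i" W] ij by blast
    then have "(\<pi>' k l \<bullet> \<pi> k) \<bullet> (\<iota> i \<bullet> \<iota>' i j) = \<pi>' k l \<bullet> (\<pi> k \<bullet> (\<iota> i \<bullet> \<iota>' i j))"
      using cmp_assoc[of "Y i j" W "X k" "Y k l"] ij by simp
    also have "\<pi> k \<bullet> (\<iota> i \<bullet> \<iota>' i j) = (\<pi> k \<bullet> \<iota> i) \<bullet> \<iota>' i j"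
      using cmp_assoc[of "Y i j" "X i" W "X k"] ij by simp
    finally show ?thesis .
  qed
  show ?thesis
  proof (rule biproductI, goal_cases)
    case 1 show ?case using D(1) Di(1) by auto
  next
    case 2 show ?case by (rule D(2))
  next
    case (3 p) then show ?case using Di(3) by auto
  next
    case (4 p)
    then obtain i j where p: "p = (i, j)" "i \<in> I" "j \<in> J i"
      by auto
    then show ?case
      using cmp_closed[of "\<iota>' i j" "Y i j" "X i" "\<iota> i" W]
        D(2) D(3,4)[OF p(2)] Di(3,4)[OF p(2,3)] by simp
  next
    case (5 p)
    then obtain i j where p: "p = (i, j)" "i \<in> I" "j \<in> J i"
      by auto
    then show ?case
      using cmp_closed[of "\<pi> i" W "X i" "\<pi>' i j" "Y i j"]
        D(2) D(3,5)[OF p(2)] Di(3,5)[OF p(2,3)] by simp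
  next
    case (6 p)
    then obtain i j where p: "p = (i, j)" "i \<in> I" "j \<in> J i"
      by auto
    then show ?case
      using \<pi>\<iota>[OF p(2,3) p(2,3)] D(3,6)[OF p(2)] Di(3,4,6)[OF p(2,3)]
      by simp
  next
    case (7 p q)
    then obtain i j k l where p: "p = (i, j)" "i \<in> I" "j \<in> J i"
      and q: "q = (k, l)" "k \<in> I" "l \<in> J k"
      by auto
    note ij = D(3-5)[OF p(2)] Di(3-5)[OF p(2,3)] D(3-5)[OF q(2)] Di(3-5)[OF q(2,3)]
    have "(\<pi>' k l \<bullet> \<pi> k) \<bullet> (\<iota> i \<bullet> \<iota>' i j) = zerom C (Y i j) (Y k l)"
    proof (cases "i = k")
      case True
      with p q 7 have "j \<noteq> l"
        by auto
      then show ?thesis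
        using True \<pi>\<iota>[OF p(2,3) q(2,3)] Di(7)[OF p(2,3)] D(6)[OF p(2)] q ij
        by simp
    next
      case False
      then show ?thesis
        using \<pi>\<iota>[OF p(2,3) q(2,3)] D(7)[OF p(2) q(2)] ij by simp
    qed
    then show ?case
      using p q by simp
  next
    case (8 V f)
    have "\<pi> i \<bullet> f = zerom C V (X i)" if i: "i \<in> I" for i
    proof (rule biproduct_jointly_monic[OF Bi[OF i]])
      show "\<pi> i \<bullet> f \<in> Hom C V (X i)"
        using cmp_closed[of f V W "\<pi> i" "X i"] 8 D(2) D(3,5)[OF i] by simp
      fix j assume j: "j \<in> J i"
      have "\<pi>' i j \<bullet> (\<pi> i \<bullet> f) = (\<pi>' i j \<bullet> \<pi> i) \<bullet> f"
        using cmp_assoc[of V W "X i"] 8(1,2) D(2) D(3,5)[OF i] Di(3,5)[OF i j] by simp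
      then show "\<pi>' i j \<bullet> (\<pi> i \<bullet> f) = zerom C V (Y i j)"
        using 8(3)[of "(i, j)"] i j by simp
    qed (rule 8(1))
    then show ?case
      using 8(1,2) biproduct_jointly_monic[OF B] by blast
  qed
qed

end


section \<open>Simple objects and multiplicities\<close>

context linear_category
begin

lemma inverse_pairD:
  assumes "inverse_pair C X Y f g"
  shows "X \<in> Obj C" "Y \<in> Obj C" "f \<in> Hom C X Y" "g \<in> Hom C Y X"
    "g \<bullet> f = ident C X" "f \<bullet> g = ident C Y"
  using assms by (simp_all add: inverse_pair_def)

lemma inverse_pair_sym: "inverse_pair C X Y f g \<Longrightarrow> inverse_pair C Y X g f"
  by (simp add: inverse_pair_def)

lemma inverse_pair_cmp:
  assumes f: "inverse_pair C X Y f g" and f': "inverse_pair C Y Z f' g'"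
  shows "inverse_pair C X Z (f' \<bullet> f) (g \<bullet> g')"
proof -
  note D = inverse_pairD[OF f] inverse_pairD[OF f']
  have 1: "f' \<bullet> f \<in> Hom C X Z" "g \<bullet> g' \<in> Hom C Z X"
    using cmp_closed[of f X Y f' Z] cmp_closed[of g' Z Y g X] D by simp_all
  have "(g \<bullet> g') \<bullet> (f' \<bullet> f) = g \<bullet> (g' \<bullet> (f' \<bullet> f))"
    using cmp_assoc[of X Z Y X "f' \<bullet> f" g' g] D 1 by simp
  also have "\<dots> = g \<bullet> ((g' \<bullet> f') \<bullet> f)"
    using cmp_assoc[of X Y Z Y f f' g'] D by simp
  finally have 2: "(g \<bullet> g') \<bullet> (f' \<bullet> f) = ident C X"
    using D by simp
  have "(f' \<bullet> f) \<bullet> (g \<bullet> g') = f' \<bullet> (f \<bullet> (g \<bullet> g'))"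
    using cmp_assoc[of Z X Y Z "g \<bullet> g'" f f'] D 1 by simp
  also have "\<dots> = f' \<bullet> ((f \<bullet> g) \<bullet> g')"
    using cmp_assoc[of Z Y X Y g' g f] D by simp
  finally have "(f' \<bullet> f) \<bullet> (g \<bullet> g') = ident C Z"
    using D by simp
  then show ?thesis
    using D 1 2 by (simp add: inverse_pair_def)
qed

lemma isomorphic_iff: "isomorphic C X Y \<longleftrightarrow> (\<exists>f g. inverse_pair C X Y f g)"
  by (simp add: isomorphic_def isomorphism_def)

lemma isomorphic_refl: "X \<in> Obj C \<Longrightarrow> isomorphic C X X"
  unfolding isomorphic_iff by (intro exI[of _ "ident C X"]) (simp add: inverse_pair_def cmp_ident(1)[of _ X X])

lemma isomorphic_sym: "isomorphic C X Y \<Longrightarrow> isomorphic C Y X"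
  unfolding isomorphic_iff using inverse_pair_sym by blast

lemma isomorphic_trans: "\<lbrakk>isomorphic C X Y; isomorphic C Y Z\<rbrakk> \<Longrightarrow> isomorphic C X Z"
  unfolding isomorphic_iff using inverse_pair_cmp by blast

lemma isomorphic_obj: "isomorphic C X Y \<Longrightarrow> X \<in> Obj C \<and> Y \<in> Obj C"
  unfolding isomorphic_iff inverse_pair_def by blast

lemma zero_object_iff:
  assumes X: "X \<in> Obj C"
  shows "zero_object C X \<longleftrightarrow> ident C X = zerom C X X"
proof
  assume "zero_object C X"
  then show "ident C X = zerom C X X"
    unfolding zero_object_def using X ident_in zerom_in by blast
next
  assume 0: "ident C X = zerom C X X"
  have "f = zerom C X Y" if "Y \<in> Obj C" "f \<in> Hom C X Y" for Y f
    using that X 0 cmp_ident(2)[of f X Y] cmp_zerom_right[of f X Y X] by simp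
  moreover have "f = zerom C Y X" if "Y \<in> Obj C" "f \<in> Hom C Y X" for Y f
    using that X 0 cmp_ident(1)[of f Y X] cmp_zerom_left[of f Y X X] by simp
  ultimately show "zero_object C X"
    unfolding zero_object_def using X by (blast intro: zerom_in)
qed

lemma simple_objectD:
  assumes "simple_object C S"
  shows "S \<in> Obj C" "ident C S \<noteq> zerom C S S"
  using assms zero_object_iff unfolding simple_object_def by blast+

lemma kernel_monic:
  assumes k: "is_kernel C X Y f N i" and "X \<in> Obj C" "Y \<in> Obj C" "f \<in> Hom C X Y"
  shows "monic C N X i"
  unfolding monic_def
proof (intro conjI ballI impI)
  have i: "N \<in> Obj C" "i \<in> Hom C N X" "f \<bullet> i = zerom C N Y"
    using k by (auto simp: is_kernel_def)
  then show "N \<in> Obj C" "i \<in> Hom C N X" "X \<in> Obj C"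
    using assms by auto
  fix W g h assume *: "W \<in> Obj C" "g \<in> Hom C W N" "h \<in> Hom C W N" "i \<bullet> g = i \<bullet> h"
  have "i \<bullet> g \<in> Hom C W X" "f \<bullet> (i \<bullet> g) = zerom C W Y"
    using cmp_closed[of g W N i X] cmp_assoc[of W N X Y g i f] assms i * by simp_all
  then have "\<exists>!u. u \<in> Hom C W N \<and> i \<bullet> u = i \<bullet> g"
    using k * unfolding is_kernel_def by blast
  then show "g = h"
    using * by metis
qed

lemma monicI:
  assumes "X \<in> Obj C" "Y \<in> Obj C" "f \<in> Hom C X Y"
    and 0: "\<And>W g. \<lbrakk>W \<in> Obj C; g \<in> Hom C W X; f \<bullet> g = zerom C W Y\<rbrakk> \<Longrightarrow> g = zerom C W X"
  shows "monic C X Y f"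
  unfolding monic_def
proof (intro conjI ballI impI)
  fix W g h assume *: "W \<in> Obj C" "g \<in> Hom C W X" "h \<in> Hom C W X" "f \<bullet> g = f \<bullet> h"
  have "f \<bullet> diff W X g h = zerom C W Y"
    using cmp_diff_right[of W X Y g h f] cmp_closed[of h W X f Y] assms * by simp
  then show "g = h"
    using 0[of W "diff W X g h"] * assms(1) diff_in[of W X g h] diff_eq_zerom_iff[of W X g h]
    by simp
qed (use assms in auto)

lemma monic_zeroD:
  assumes "monic C X Y f" "W \<in> Obj C" "g \<in> Hom C W X" "f \<bullet> g = zerom C W Y"
  shows "g = zerom C W X"
proof -
  have "X \<in> Obj C" "Y \<in> Obj C" "f \<in> Hom C X Y"
    using assms(1) by (auto simp: monic_def)
  then have "f \<bullet> g = f \<bullet> zerom C W X" "zerom C W X \<in> Hom C W X"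
    using assms by auto
  then show ?thesis
    using assms unfolding monic_def by blast
qed

end

context fusion_category
begin

lemma kernel_exists:
  assumes "X \<in> Obj C" "Y \<in> Obj C" "f \<in> Hom C X Y"
  obtains N i where "is_kernel C X Y f N i" "monic C N X i"
proof -
  have "\<exists>N i. is_kernel C X Y f N i"
    using abelian assms unfolding abelian_category_def by blast
  then show ?thesis
    using kernel_monic assms that by blast
qed

text \<open>The kernel is a subobject of \<open>S\<close>; it is not all of \<open>S\<close>, hence zero.\<close>

lemma simple_nonzero_monic:
  assumes S: "simple_object C S" and T: "T \<in> Obj C" and f: "f \<in> Hom C S T" "f \<noteq> zerom C S T"
  shows "monic C S T f"
proof -
  have S': "S \<in> Obj C"
    using S by (rule simple_objectD)
  obtain N i where k: "is_kernel C S T f N i" and m: "monic C N S i"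
    using kernel_exists[OF S' T f(1)] .
  have i: "N \<in> Obj C" "i \<in> Hom C N S" "f \<bullet> i = zerom C N T"
    using k by (auto simp: is_kernel_def)
  have "\<not> isomorphism C N S i"
  proof
    assume "isomorphism C N S i"
    then obtain j where j: "inverse_pair C N S i j"
      by (auto simp: isomorphism_def)
    note D = inverse_pairD[OF j]
    have "f = f \<bullet> (i \<bullet> j)"
      using D f S' T by simp
    also have "\<dots> = zerom C S T"
      using cmp_assoc[of S N S T j i f] D f S' T i by simp
    finally show False
      using f by simp
  qed
  then have N: "zero_object C N"
    using S m unfolding simple_object_def by blast
  show ?thesis
  proof (rule monicI[OF S' T f(1)])
    fix W g assume g: "W \<in> Obj C" "g \<in> Hom C W S" "f \<bullet> g = zerom C W T"
    then obtain u where u: "u \<in> Hom C W N" "i \<bullet> u = g"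
      using k unfolding is_kernel_def by blast
    have "i = zerom C N S"
      using N i S' zerom_in[of N S] unfolding zero_object_def by blast
    then show "g = zerom C W S"
      using u g i S' by auto
  qed
qed

lemma schur:
  assumes S: "simple_object C S" and T: "simple_object C T"
    and f: "f \<in> Hom C S T" "f \<noteq> zerom C S T"
  obtains g where "inverse_pair C S T f g"
proof -
  have "monic C S T f"
    using simple_nonzero_monic simple_objectD(1) S T f by blast
  moreover have "\<not> zero_object C S"
    using S by (simp add: simple_object_def)
  ultimately show ?thesis
    using T that unfolding simple_object_def isomorphism_def by blast
qed

text \<open>
  The Krull--Schmidt theorem for sums of simple objects, by exchange: a summand \<open>X a\<close> of one
  decomposition is isomorphic, by Schur's lemma, to some summand \<open>Y j\<close> of the other, and the kernel
  of the projection onto \<open>X a\<close> is a biproduct both of the remaining \<open>X i\<close> and of the remaining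
  \<open>Y l\<close>.
\<close>

lemma simple_summands_card_eq:
  assumes "biproduct W I X \<iota> \<pi>" "biproduct W J Y \<iota>' \<pi>'"
    and "\<forall>i\<in>I. simple_object C (X i)" "\<forall>j\<in>J. simple_object C (Y j)"
  shows "card {i\<in>I. isomorphic C S (X i)} = card {j\<in>J. isomorphic C S (Y j)}"
proof -
  have "finite I"
    using assms(1) by (rule biproductD)
  then show ?thesis
    using assms
  proof (induction I arbitrary: W \<iota> \<pi> J \<iota>' \<pi>' rule: finite_induct)
    case empty
    note D = biproductD[OF empty(1)] and D' = biproductD[OF empty(2)]
    have W0: "ident C W = zerom C W W"
      using biproduct_jointly_monic[OF empty(1), of W "ident C W"] D by simp
    have "J = {}"
    proof (rule equals0I)
      fix j assume j: "j \<in> J"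
      note Dj = D'(3-6)[OF j]
      have "\<pi>' j = zerom C W (Y j)"
        using cmp_ident(2)[of "\<pi>' j" W "Y j"] W0 Dj D(2) cmp_zerom_right[of "\<pi>' j" W "Y j" W]
        by simp
      then have "ident C (Y j) = zerom C (Y j) (Y j)"
        using Dj D(2) cmp_zerom_left[of "\<iota>' j" "Y j" W "Y j"] by simp
      then show False
        using simple_objectD(2) j empty(4) by blast
    qed
    then show ?case by simp
  next
    case (insert a I)
    note B = insert.prems(1) and B' = insert.prems(2)
    note D = biproductD[OF B] and D' = biproductD[OF B']
    have W: "W \<in> Obj C" by (rule D(2))
    have a: "a \<in> insert a I" by simp
    note Da = D(3-6)[OF a]
    let ?p = "\<pi> a"
    have "\<exists>j\<in>J. ?p \<bullet> \<iota>' j \<noteq> zerom C (Y j) (X a)"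
    proof (rule ccontr)
      assume "\<not> ?thesis"
      then have "?p = zerom C W (X a)"
        using biproduct_jointly_epic[OF B', of "X a" ?p] Da by auto
      then have "ident C (X a) = zerom C (X a) (X a)"
        using Da W cmp_zerom_left[of "\<iota> a" "X a" W "X a"] by simp
      then show False
        using simple_objectD(2) insert.prems(3) by blast
    qed
    then obtain j where j: "j \<in> J" and c0: "?p \<bullet> \<iota>' j \<noteq> zerom C (Y j) (X a)" ..
    note Dj = D'(3-6)[OF j]
    define c where "c = ?p \<bullet> \<iota>' j"
    have c: "c \<in> Hom C (Y j) (X a)"
      unfolding c_def using cmp_closed[of "\<iota>' j" "Y j" W ?p "X a"] Da Dj W by simp
    obtain d where d: "inverse_pair C (Y j) (X a) c d"
      using schur[of "Y j" "X a" c] c c0 insert.prems(3,4) j c_def by blast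
    note Dd = inverse_pairD[OF d]
    \<comment> \<open>\<open>N\<close> is a complement of \<open>X a\<close> and also of the image of \<open>\<iota>' j\<close>.\<close>
    obtain N k where ker: "is_kernel C W (X a) ?p N k" and mono: "monic C N W k"
      using kernel_exists[of W "X a" ?p] W Da by blast
    have k: "N \<in> Obj C" "k \<in> Hom C N W" "?p \<bullet> k = zerom C N (X a)"
      using ker by (auto simp: is_kernel_def)
    have lift: "\<exists>h. h \<in> Hom C V N \<and> k \<bullet> h = g"
      if "V \<in> Obj C" "g \<in> Hom C V W" "?p \<bullet> g = zerom C V (X a)" for V g
      using ker that unfolding is_kernel_def by blast
    have kD: "f \<bullet> k \<in> Hom C N Z" "(f \<bullet> k) \<bullet> g = f \<bullet> (k \<bullet> g)" "k \<bullet> g \<in> Hom C V W"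
      if "V \<in> Obj C" "Z \<in> Obj C" "f \<in> Hom C W Z" "g \<in> Hom C V N" for f g V Z
      using cmp_closed[of k N W f Z] cmp_assoc[of V N W Z g k f] cmp_closed[of g V N k W] that k W
      by auto

    have "\<exists>h. h \<in> Hom C (X i) N \<and> k \<bullet> h = \<iota> i" if "i \<in> I" for i
      using lift[of "X i" "\<iota> i"] that D(3,4)[of i] D(7)[of i a] insert.hyps by auto
    then obtain h where h: "\<And>i. i \<in> I \<Longrightarrow> h i \<in> Hom C (X i) N \<and> k \<bullet> h i = \<iota> i"
      by metis
    have B1: "biproduct N I X h (\<lambda>i. \<pi> i \<bullet> k)"
    proof (rule biproductI, goal_cases)
      case (6 i)
      then show ?case
        using kD(2)[of "X i" "X i" "\<pi> i" "h i"] h[of i] D(3-6)[of i] by simp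
    next
      case (7 i l)
      then show ?case
        using kD(2)[of "X i" "X l" "\<pi> l" "h i"] h[of i] D(3-6)[of i] D(3-6)[of l] D(7)[of i l]
        by simp
    next
      case (8 V f)
      have "k \<bullet> f = zerom C V W"
      proof (rule biproduct_jointly_monic[OF B 8(1)])
        show "k \<bullet> f \<in> Hom C V W"
          using kD(3) 8 W by blast
        fix i assume i: "i \<in> insert a I"
        show "\<pi> i \<bullet> (k \<bullet> f) = zerom C V (X i)"
        proof (cases "i = a")
          case True
          then show ?thesis
            using kD(2)[of V "X a" ?p f] 8 Da k by simp
        next
          case False
          then show ?thesis
            using kD(2)[of V "X i" "\<pi> i" f] 8 i D(3,5)[of i] by auto
        qed
      qed
      then show ?case
        using monic_zeroD mono 8 by blast
    qed (use insert.hyps h k D in \<open>auto intro: kD\<close>)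

    \<comment> \<open>The inclusion of \<open>Y l\<close>, corrected by a multiple of that of \<open>Y j\<close> so as to land in \<open>N\<close>; the
      correction is invisible to the projections onto the other summands.\<close>
    define m where "m l = diff (Y l) W (\<iota>' l) (\<iota>' j \<bullet> (d \<bullet> (?p \<bullet> \<iota>' l)))" for l
    have m: "m l \<in> Hom C (Y l) W" "?p \<bullet> m l = zerom C (Y l) (X a)"
      "\<And>q. \<lbrakk>q \<in> J; q \<noteq> j\<rbrakk> \<Longrightarrow> \<pi>' q \<bullet> m l = \<pi>' q \<bullet> \<iota>' l"
      if l: "l \<in> J" for l
    proof -
      note Dl = D'(3-6)[OF l]
      let ?e = "d \<bullet> (?p \<bullet> \<iota>' l)"
      have pl: "?p \<bullet> \<iota>' l \<in> Hom C (Y l) (X a)"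
        using cmp_closed[of "\<iota>' l" "Y l" W ?p "X a"] Dl Da W by simp
      have e: "?e \<in> Hom C (Y l) (Y j)"
        using cmp_closed[of "?p \<bullet> \<iota>' l" "Y l" "X a" d "Y j"] pl Dd Dl by simp
      have je: "\<iota>' j \<bullet> ?e \<in> Hom C (Y l) W"
        using cmp_closed[of ?e "Y l" "Y j" "\<iota>' j" W] e Dj Dl W by simp
      show "m l \<in> Hom C (Y l) W"
        unfolding m_def using diff_in[of "Y l" W] Dl W je by simp
      have "?p \<bullet> (\<iota>' j \<bullet> ?e) = c \<bullet> ?e"
        using cmp_assoc[of "Y l" "Y j" W "X a" ?e "\<iota>' j" ?p] e Dj Dl Da W by (simp add: c_def)
      also have "\<dots> = (c \<bullet> d) \<bullet> (?p \<bullet> \<iota>' l)"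
        using cmp_assoc[of "Y l" "X a" "Y j" "X a" "?p \<bullet> \<iota>' l" d c] Dd Dl pl by simp
      finally show "?p \<bullet> m l = zerom C (Y l) (X a)"
        unfolding m_def using cmp_diff_right[of "Y l" W "X a" "\<iota>' l" "\<iota>' j \<bullet> ?e" ?p] Dl Da W je pl Dd
        by simp
      fix q assume q: "q \<in> J" "q \<noteq> j"
      note Dq = D'(3-6)[OF q(1)]
      have "\<pi>' q \<bullet> (\<iota>' j \<bullet> ?e) = zerom C (Y l) (Y q)"
        using cmp_assoc[of "Y l" "Y j" W "Y q" ?e "\<iota>' j" "\<pi>' q"] e Dj Dl Dq W D'(7)[OF j q(1)] q
        by simp
      moreover have "\<pi>' q \<bullet> \<iota>' l \<in> Hom C (Y l) (Y q)"
        using cmp_closed[of "\<iota>' l" "Y l" W "\<pi>' q" "Y q"] Dl Dq W by simp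
      ultimately show "\<pi>' q \<bullet> m l = \<pi>' q \<bullet> \<iota>' l"
        unfolding m_def using cmp_diff_right[of "Y l" W "Y q" "\<iota>' l" "\<iota>' j \<bullet> ?e" "\<pi>' q"] Dl Dq W je
        by simp
    qed
    have "\<exists>h. h \<in> Hom C (Y l) N \<and> k \<bullet> h = m l" if "l \<in> J" for l
      using lift[of "Y l" "m l"] that D'(3)[of l] m[of l] by auto
    then obtain h' where h': "\<And>l. l \<in> J \<Longrightarrow> h' l \<in> Hom C (Y l) N \<and> k \<bullet> h' l = m l"
      by metis
    have B2: "biproduct N (J - {j}) Y h' (\<lambda>l. \<pi>' l \<bullet> k)"
    proof (rule biproductI, goal_cases)
      case (6 l)
      then show ?case
        using kD(2)[of "Y l" "Y l" "\<pi>' l" "h' l"] h'[of l] D'(3-6)[of l] m(3)[of l l] by simp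
    next
      case (7 l q)
      then show ?case
        using kD(2)[of "Y l" "Y q" "\<pi>' q" "h' l"] h'[of l] D'(3-6)[of l] D'(3-6)[of q] D'(7)[of l q]
          m(3)[of l q] by simp
    next
      case (8 V f)
      let ?u = "k \<bullet> f"
      have u: "?u \<in> Hom C V W"
        using kD(3) 8 W by blast
      have ju: "\<pi>' j \<bullet> ?u \<in> Hom C V (Y j)"
        using cmp_closed[of ?u V W "\<pi>' j" "Y j"] u 8(1) Dj W by simp
      have jju: "\<iota>' j \<bullet> (\<pi>' j \<bullet> ?u) \<in> Hom C V W"
        using cmp_closed[of "\<pi>' j \<bullet> ?u" V "Y j" "\<iota>' j" W] ju 8(1) Dj W by simp
      have "diff V W ?u (\<iota>' j \<bullet> (\<pi>' j \<bullet> ?u)) = zerom C V W"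
      proof (rule biproduct_jointly_monic[OF B' 8(1)])
        show "diff V W ?u (\<iota>' j \<bullet> (\<pi>' j \<bullet> ?u)) \<in> Hom C V W"
          using diff_in 8(1) W u jju by blast
        fix q assume q: "q \<in> J"
        note Dq = D'(3-6)[OF q]
        have 1: "\<pi>' q \<bullet> diff V W ?u (\<iota>' j \<bullet> (\<pi>' j \<bullet> ?u)) =
          diff V (Y q) (\<pi>' q \<bullet> ?u) (\<pi>' q \<bullet> \<iota>' j \<bullet> (\<pi>' j \<bullet> ?u))"
          using cmp_diff_right[of V W "Y q" ?u "\<iota>' j \<bullet> (\<pi>' j \<bullet> ?u)" "\<pi>' q"]
            cmp_assoc[of V "Y j" W "Y q" "\<pi>' j \<bullet> ?u" "\<iota>' j" "\<pi>' q"] 8(1) W u jju ju Dj Dq by simp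
        show "\<pi>' q \<bullet> diff V W ?u (\<iota>' j \<bullet> (\<pi>' j \<bullet> ?u)) = zerom C V (Y q)"
        proof (cases "q = j")
          case True
          then show ?thesis
            using 1 Dj 8(1) ju by simp
        next
          case False
          then show ?thesis
            using 1 Dj(1) Dq(1) 8(1) 8(3)[of q] ju D'(7)[OF j q] q kD(2)[of V "Y q" "\<pi>' q" f] Dq(3) 8(2)
            by simp
        qed
      qed
      then have u_eq: "?u = \<iota>' j \<bullet> (\<pi>' j \<bullet> ?u)"
        using diff_eq_zerom_iff 8(1) W u jju by blast
      have "zerom C V (X a) = ?p \<bullet> ?u"
        using kD(2)[of V "X a" ?p f] k Da 8 by simp
      also have "\<dots> = c \<bullet> (\<pi>' j \<bullet> ?u)"
        using u_eq cmp_assoc[of V "Y j" W "X a" "\<pi>' j \<bullet> ?u" "\<iota>' j" ?p] 8(1) W ju Dj Da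
        by (simp add: c_def)
      finally have 0: "c \<bullet> (\<pi>' j \<bullet> ?u) = zerom C V (X a)"
        by (rule sym)
      have "\<pi>' j \<bullet> ?u = d \<bullet> (c \<bullet> (\<pi>' j \<bullet> ?u))"
        using cmp_assoc[of V "Y j" "X a" "Y j" "\<pi>' j \<bullet> ?u" c d] 8(1) ju Dd by simp
      also have "\<dots> = zerom C V (Y j)"
        unfolding 0 using 8(1) Dd by simp
      finally have "\<pi>' j \<bullet> ?u = zerom C V (Y j)" .
      then have "?u = zerom C V W"
        using u_eq Dj 8(1) W by simp
      then show ?case
        using monic_zeroD mono 8 by blast
    qed (use h' k D' in \<open>auto intro: kD\<close>)

    have IH: "card {i \<in> I. isomorphic C S (X i)} = card {l \<in> J - {j}. isomorphic C S (Y l)}"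
      using insert.IH[OF B1 B2] insert.prems(3,4) by blast
    have iso: "isomorphic C S (X a) \<longleftrightarrow> isomorphic C S (Y j)"
      using d isomorphic_trans[of S] isomorphic_sym isomorphic_iff by blast
    have J: "{l \<in> J. isomorphic C S (Y l)} = (if isomorphic C S (Y j)
        then insert j {l \<in> J - {j}. isomorphic C S (Y l)} else {l \<in> J - {j}. isomorphic C S (Y l)})"
      using j by auto
    have I: "{i \<in> insert a I. isomorphic C S (X i)} = (if isomorphic C S (X a)
        then insert a {i \<in> I. isomorphic C S (X i)} else {i \<in> I. isomorphic C S (X i)})"
      using insert.hyps by auto
    show ?case
      unfolding I J using IH iso insert.hyps D'(1) by auto
  qed
qed

lemma simple_decomposition:
  assumes "W \<in> Obj C"
  obtains n X \<iota> \<pi> where "biproduct W {..<n::nat} X \<iota> \<pi>" "\<forall>i\<in>{..<n}. simple_object C (X i)"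
proof -
  obtain Xs where Xs: "\<forall>Y\<in>set Xs. simple_object C Y" "direct_sum C W Xs"
    using semisimple assms by blast
  obtain \<iota> \<pi> where "biproduct W {..<length Xs} (\<lambda>i. Xs ! i) \<iota> \<pi>"
    using direct_sum_biproduct Xs(2) .
  then show ?thesis
    using Xs(1) by (intro that) auto
qed

text \<open>
  By semisimplicity, nonzero morphisms from and to a simple object split: some component is nonzero,
  and it is invertible by Schur's lemma.
\<close>

lemma nonzero_from_simple_split:
  assumes S: "simple_object C S" and W: "W \<in> Obj C" and f: "f \<in> Hom C S W" "f \<noteq> zerom C S W"
  obtains p where "p \<in> Hom C W S" "p \<bullet> f = ident C S"
proof -
  obtain n X \<iota> \<pi> where B: "biproduct W {..<n::nat} X \<iota> \<pi>"
    and X: "\<forall>i\<in>{..<n}. simple_object C (X i)"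
    using simple_decomposition W .
  note D = biproductD[OF B]
  have S': "S \<in> Obj C"
    using S by (rule simple_objectD)
  obtain i where i: "i \<in> {..<n}" and nz: "\<pi> i \<bullet> f \<noteq> zerom C S (X i)"
    using biproduct_jointly_monic[OF B S' f(1)] f(2) by blast
  have pf: "\<pi> i \<bullet> f \<in> Hom C S (X i)"
    using cmp_closed[of f S W "\<pi> i" "X i"] f S' D(3,5)[OF i] W by simp
  obtain g where "inverse_pair C S (X i) (\<pi> i \<bullet> f) g"
    using schur[OF S _ pf nz] X i by blast
  note g = inverse_pairD[OF this]
  show ?thesis
  proof
    show "g \<bullet> \<pi> i \<in> Hom C W S"
      using cmp_closed[of "\<pi> i" W "X i" g S] D(3,5)[OF i] W g by simp
    show "g \<bullet> \<pi> i \<bullet> f = ident C S"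
      using cmp_assoc[of S W "X i" S f "\<pi> i" g] D(3,5)[OF i] W g f by simp
  qed
qed

lemma nonzero_to_simple_split:
  assumes S: "simple_object C S" and W: "W \<in> Obj C" and p: "p \<in> Hom C W S" "p \<noteq> zerom C W S"
  obtains f where "f \<in> Hom C S W" "p \<bullet> f = ident C S"
proof -
  obtain n X \<iota> \<pi> where B: "biproduct W {..<n::nat} X \<iota> \<pi>"
    and X: "\<forall>i\<in>{..<n}. simple_object C (X i)"
    using simple_decomposition W .
  note D = biproductD[OF B]
  have S': "S \<in> Obj C"
    using S by (rule simple_objectD)
  obtain i where i: "i \<in> {..<n}" and nz: "p \<bullet> \<iota> i \<noteq> zerom C (X i) S"
    using biproduct_jointly_epic[OF B S' p(1)] p(2) by blast
  have pf: "p \<bullet> \<iota> i \<in> Hom C (X i) S"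
    using cmp_closed[of "\<iota> i" "X i" W p S] p S' D(3,4)[OF i] W by simp
  obtain g where "inverse_pair C (X i) S (p \<bullet> \<iota> i) g"
    using schur[OF _ S pf nz] X i by blast
  note g = inverse_pairD[OF this]
  show ?thesis
  proof
    show "\<iota> i \<bullet> g \<in> Hom C S W"
      using cmp_closed[of g S "X i" "\<iota> i" W] D(3,4)[OF i] W g by simp
    show "p \<bullet> (\<iota> i \<bullet> g) = ident C S"
      using cmp_assoc[of S "X i" W S g "\<iota> i" p] D(3,4)[OF i] W g p by simp
  qed
qed

lemma simple_object_isomorphic:
  assumes X: "simple_object C X" and "isomorphic C X Y"
  shows "simple_object C Y"
proof -
  obtain f g where fg: "inverse_pair C X Y f g"
    using assms(2) isomorphic_iff by blast
  note D = inverse_pairD[OF fg]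
  have "ident C Y \<noteq> zerom C Y Y"
  proof
    assume *: "ident C Y = zerom C Y Y"
    have "ident C X = g \<bullet> (ident C Y \<bullet> f)"
      using D by simp
    also have "\<dots> = zerom C X X"
      unfolding * using D by simp
    finally show False
      using simple_objectD(2)[OF X] by simp
  qed
  moreover have "isomorphism C Z Y i" if m: "monic C Z Y i" and Z: "\<not> zero_object C Z" for Z i
  proof -
    have i: "Z \<in> Obj C" "i \<in> Hom C Z Y"
      using m by (auto simp: monic_def)
    have gi: "g \<bullet> i \<in> Hom C Z X" "f \<bullet> (g \<bullet> i) = i"
      using cmp_closed[of i Z Y g X] cmp_assoc[of Z Y X Y i g f] i D by simp_all
    have "monic C Z X (g \<bullet> i)"
    proof (rule monicI)
      fix W u assume u: "W \<in> Obj C" "u \<in> Hom C W Z" "g \<bullet> i \<bullet> u = zerom C W X"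
      have "i \<bullet> u = f \<bullet> (g \<bullet> i \<bullet> u)"
        using cmp_assoc[of W Z X Y u "g \<bullet> i" f] gi D i u by simp
      also have "\<dots> = zerom C W Y"
        unfolding u(3) using u D by simp
      finally show "u = zerom C W Z"
        using monic_zeroD m u by blast
    qed (use i gi D in auto)
    then have "isomorphism C Z X (g \<bullet> i)"
      using X Z unfolding simple_object_def by blast
    then obtain h where "inverse_pair C Z X (g \<bullet> i) h"
      by (auto simp: isomorphism_def)
    then have "inverse_pair C Z Y (f \<bullet> (g \<bullet> i)) (h \<bullet> g)"
      using fg by (rule inverse_pair_cmp)
    then show ?thesis
      using gi by (auto simp: isomorphism_def)
  qed
  ultimately show ?thesis
    using D zero_object_iff unfolding simple_object_def by blast
qed

definition mult :: "'o \<Rightarrow> 'o \<Rightarrow> nat" where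
  "mult S W = multiplicity C (iso_class C S) W"

text \<open>
  The multiplicity is a definite description over all decompositions; by Krull--Schmidt all of them
  give the same number.
\<close>

lemma mult_eq_card:
  assumes B: "biproduct W I X \<iota> \<pi>" and X: "\<forall>i\<in>I. simple_object C (X i)"
  shows "mult S W = card {i\<in>I. isomorphic C S (X i)}"
  unfolding mult_def multiplicity_def
proof (rule the_equality)
  have W: "W \<in> Obj C"
    using B by (rule biproductD)
  have *: "length (filter (\<lambda>X. X \<in> iso_class C S) Xs) = card {i\<in>I. isomorphic C S (X i)}"
    if Xs: "\<forall>X\<in>set Xs. simple_object C X" "direct_sum C W Xs" for Xs
  proof -
    obtain \<iota>' \<pi>' where B': "biproduct W {..<length Xs} (\<lambda>i. Xs ! i) \<iota>' \<pi>'"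
      using direct_sum_biproduct Xs(2) .
    have "length (filter (\<lambda>X. X \<in> iso_class C S) Xs)
        = card {i\<in>{..<length Xs}. isomorphic C S (Xs ! i)}"
      by (simp add: length_filter_conv_card iso_class_def)
    also have "\<dots> = card {i\<in>I. isomorphic C S (X i)}"
      using simple_summands_card_eq[OF B' B _ X] Xs(1) by simp
    finally show ?thesis .
  qed
  show "\<exists>Xs. (\<forall>X\<in>set Xs. simple_object C X) \<and> direct_sum C W Xs \<and>
      card {i\<in>I. isomorphic C S (X i)} = length (filter (\<lambda>X. X \<in> iso_class C S) Xs)"
    using semisimple[OF W] * by metis
  fix n assume "\<exists>Xs. (\<forall>X\<in>set Xs. simple_object C X) \<and> direct_sum C W Xs \<and>
      n = length (filter (\<lambda>X. X \<in> iso_class C S) Xs)"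
  then show "n = card {i\<in>I. isomorphic C S (X i)}"
    using * by blast
qed

lemma mult_biproduct:
  assumes B: "biproduct W I X \<iota> \<pi>"
  shows "mult S W = (\<Sum>i\<in>I. mult S (X i))"
proof -
  note D = biproductD[OF B]
  have "\<exists>n Y \<kappa> \<rho>. biproduct (X i) {..<n::nat} Y \<kappa> \<rho> \<and> (\<forall>j\<in>{..<n}. simple_object C (Y j))"
    if "i \<in> I" for i
    using simple_decomposition[OF D(3)[OF that]] by metis
  then obtain n Y \<kappa> \<rho> where
    Bi: "\<And>i. i \<in> I \<Longrightarrow> biproduct (X i) {..<n i :: nat} (Y i) (\<kappa> i) (\<rho> i)" and
    Y: "\<And>i. i \<in> I \<Longrightarrow> \<forall>j\<in>{..<n i}. simple_object C (Y i j)"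
    by metis
  have "mult S W = card {p \<in> Sigma I (\<lambda>i. {..<n i}). isomorphic C S (case p of (i, j) \<Rightarrow> Y i j)}"
    using Y by (intro mult_eq_card[OF biproduct_refine[OF B Bi]]) auto
  also have "{p \<in> Sigma I (\<lambda>i. {..<n i}). isomorphic C S (case p of (i, j) \<Rightarrow> Y i j)}
      = Sigma I (\<lambda>i. {j\<in>{..<n i}. isomorphic C S (Y i j)})"
    by auto
  also have "card \<dots> = (\<Sum>i\<in>I. card {j\<in>{..<n i}. isomorphic C S (Y i j)})"
    using D(1) by (intro card_SigmaI) auto
  also have "\<dots> = (\<Sum>i\<in>I. mult S (X i))"
    using mult_eq_card[OF Bi Y] by (intro sum.cong) auto
  finally show ?thesis .
qed

lemma inverse_pair_biproduct:
  assumes "inverse_pair C X W f g"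
  shows "biproduct W {()} (\<lambda>_. X) (\<lambda>_. f) (\<lambda>_. g)"
proof (rule biproductI)
  note D = inverse_pairD[OF assms]
  fix V h assume V: "V \<in> Obj C" "h \<in> Hom C V W" and 0: "\<And>i. i \<in> {()} \<Longrightarrow> g \<bullet> h = zerom C V X"
  have "h = f \<bullet> (g \<bullet> h)"
    using cmp_assoc[of V W X W h g f] D V by simp
  also have "\<dots> = zerom C V W"
    using 0 D V by simp
  finally show "h = zerom C V W" .
qed (use inverse_pairD[OF assms] in auto)

lemma mult_isomorphic:
  assumes "isomorphic C X W"
  shows "mult S X = mult S W"
proof -
  obtain f g where "inverse_pair C X W f g"
    using assms isomorphic_iff by blast
  then show ?thesis
    using mult_biproduct[OF inverse_pair_biproduct] by simp
qed

lemma mult_pos_iff: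
  assumes S: "simple_object C S" and W: "W \<in> Obj C"
  shows "0 < mult S W \<longleftrightarrow> (\<exists>f\<in>Hom C S W. f \<noteq> zerom C S W)"
proof -
  obtain n X \<iota> \<pi> where B: "biproduct W {..<n::nat} X \<iota> \<pi>"
    and X: "\<forall>i\<in>{..<n}. simple_object C (X i)"
    using simple_decomposition W .
  note D = biproductD[OF B]
  have S': "S \<in> Obj C"
    using S by (rule simple_objectD)
  have "0 < mult S W \<longleftrightarrow> (\<exists>i\<in>{..<n}. isomorphic C S (X i))"
    unfolding mult_eq_card[OF B X] by (auto simp: card_gt_0_iff)
  also have "\<dots> \<longleftrightarrow> (\<exists>f\<in>Hom C S W. f \<noteq> zerom C S W)"
  proof safe
    fix i assume i: "i < n" and "isomorphic C S (X i)"
    then obtain f g where "inverse_pair C S (X i) f g"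
      using isomorphic_iff by blast
    note g = inverse_pairD[OF this]
    have i': "i \<in> {..<n}"
      using i by simp
    note Di = D(3-6)[OF i']
    have f: "\<iota> i \<bullet> f \<in> Hom C S W"
      using cmp_closed[of f S "X i" "\<iota> i" W] g Di W by simp
    have "f = \<pi> i \<bullet> (\<iota> i \<bullet> f)"
      using cmp_assoc[of S "X i" W "X i" f "\<iota> i" "\<pi> i"] g Di W by simp
    moreover have "f \<noteq> zerom C S (X i)"
    proof
      assume "f = zerom C S (X i)"
      then have "ident C S = zerom C S S"
        using g by simp
      then show False
        using simple_objectD(2)[OF S] by simp
    qed
    ultimately have "\<iota> i \<bullet> f \<noteq> zerom C S W"
      using Di S' W by auto
    then show "\<exists>f\<in>Hom C S W. f \<noteq> zerom C S W"
      using f by blast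
  next
    fix f assume f: "f \<in> Hom C S W" "f \<noteq> zerom C S W"
    obtain i where i: "i \<in> {..<n}" and nz: "\<pi> i \<bullet> f \<noteq> zerom C S (X i)"
      using biproduct_jointly_monic[OF B S' f(1)] f(2) by blast
    have "\<pi> i \<bullet> f \<in> Hom C S (X i)"
      using cmp_closed[of f S W "\<pi> i" "X i"] f S' D(3,5)[OF i] W by simp
    then show "\<exists>i\<in>{..<n}. isomorphic C S (X i)"
      using schur[OF S, of "X i"] X i nz isomorphic_iff by metis
  qed
  finally show ?thesis .
qed

text \<open>
  Representatives of the isomorphism classes, chosen as in the multiplication of the Grothendieck
  ring.
\<close>

definition rep :: "'o \<Rightarrow> 'o" where
  "rep X = (SOME Y. Y \<in> iso_class C X)"

definition reps :: "'o set" where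
  "reps = rep ` {X. simple_object C X}"

lemma rep_isomorphic: "X \<in> Obj C \<Longrightarrow> isomorphic C X (rep X)"
  using someI[of "\<lambda>Y. Y \<in> iso_class C X" X] isomorphic_refl
  by (simp add: rep_def iso_class_def)

lemma iso_class_eq: "isomorphic C X Y \<Longrightarrow> iso_class C X = iso_class C Y"
  unfolding iso_class_def using isomorphic_sym isomorphic_trans by blast

lemma rep_eq: "isomorphic C X Y \<Longrightarrow> rep X = rep Y"
  using iso_class_eq by (simp add: rep_def)

lemma reps_simple: "r \<in> reps \<Longrightarrow> simple_object C r"
  unfolding reps_def using rep_isomorphic simple_object_isomorphic simple_objectD(1) by blast

lemma reps_obj: "r \<in> reps \<Longrightarrow> r \<in> Obj C"
  using reps_simple simple_objectD(1) by blast

lemma rep_reps: "r \<in> reps \<Longrightarrow> rep r = r"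
  unfolding reps_def using rep_eq[OF rep_isomorphic] simple_objectD(1) by auto

lemma rep_eq_iff:
  assumes "r \<in> reps" "X \<in> Obj C"
  shows "rep X = r \<longleftrightarrow> isomorphic C r X"
  using assms rep_reps rep_eq rep_isomorphic isomorphic_sym by metis

lemma finite_reps: "finite reps"
proof -
  have "reps = (\<lambda>S. SOME Y. Y \<in> S) ` simple_classes C"
    by (auto simp: reps_def rep_def simple_classes_def)
  then show ?thesis
    using finite_simple_classes by simp
qed

end


section \<open>Tensor products and multiplicities\<close>

context linear_monoidal_category
begin

lemma tenm_zerom_right [simp]:
  assumes "f \<in> Hom C X X'" "X \<in> Obj C" "X' \<in> Obj C" "Y \<in> Obj C" "Y' \<in> Obj C"
  shows "f \<otimes>\<^sub>m zerom C Y Y' = zerom C (X \<otimes>\<^sub>o Y) (X' \<otimes>\<^sub>o Y')"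
proof (rule addm_idem_zerom)
  show "addm C (f \<otimes>\<^sub>m zerom C Y Y') (f \<otimes>\<^sub>m zerom C Y Y') = f \<otimes>\<^sub>m zerom C Y Y'"
    using tenm_add_right[of X X' Y Y' f "zerom C Y Y'" "zerom C Y Y'"] assms
    by (simp add: addm_zerom)
qed (use assms in \<open>auto intro: teno_in tenm_in\<close>)

lemma tenm_zerom_left [simp]:
  assumes "f \<in> Hom C X X'" "X \<in> Obj C" "X' \<in> Obj C" "Y \<in> Obj C" "Y' \<in> Obj C"
  shows "zerom C Y Y' \<otimes>\<^sub>m f = zerom C (Y \<otimes>\<^sub>o X) (Y' \<otimes>\<^sub>o X')"
proof (rule addm_idem_zerom)
  show "addm C (zerom C Y Y' \<otimes>\<^sub>m f) (zerom C Y Y' \<otimes>\<^sub>m f) = zerom C Y Y' \<otimes>\<^sub>m f"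
    using tenm_add_left[of Y Y' X X' "zerom C Y Y'" "zerom C Y Y'" f] assms
    by (simp add: addm_zerom)
qed (use assms in \<open>auto intro: teno_in tenm_in\<close>)

lemma tenm_right_cmp:
  assumes "V \<in> Obj C" "X \<in> Obj C" "Y \<in> Obj C" "Z \<in> Obj C" "f \<in> Hom C X Y" "g \<in> Hom C Y Z"
  shows "ident C V \<otimes>\<^sub>m (g \<bullet> f) = (ident C V \<otimes>\<^sub>m g) \<bullet> (ident C V \<otimes>\<^sub>m f)"
  using tenm_cmp[of V V V X Y Z "ident C V" "ident C V" f g] assms
    cmp_ident(1)[of "ident C V" V V] by simp

lemma tenm_left_cmp:
  assumes "V \<in> Obj C" "X \<in> Obj C" "Y \<in> Obj C" "Z \<in> Obj C" "f \<in> Hom C X Y" "g \<in> Hom C Y Z"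
  shows "(g \<bullet> f) \<otimes>\<^sub>m ident C V = (g \<otimes>\<^sub>m ident C V) \<bullet> (f \<otimes>\<^sub>m ident C V)"
  using tenm_cmp[of X Y Z V V V f g "ident C V" "ident C V"] assms
    cmp_ident(1)[of "ident C V" V V] by simp

lemma inverse_pair_tensor:
  assumes "inverse_pair C X X' f f'" "inverse_pair C Y Y' g g'"
  shows "inverse_pair C (X \<otimes>\<^sub>o Y) (X' \<otimes>\<^sub>o Y') (f \<otimes>\<^sub>m g) (f' \<otimes>\<^sub>m g')"
proof -
  note D = inverse_pairD[OF assms(1)] inverse_pairD[OF assms(2)]
  show ?thesis
    using tenm_cmp[of X X' X Y Y' Y f f' g g'] tenm_cmp[of X' X X' Y' Y Y' f' f g' g]
      tenm_in[of X X' Y Y' f g] tenm_in[of X' X Y' Y f' g'] D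
    by (simp add: inverse_pair_def teno_in tenm_ident)
qed

lemma isomorphic_tensor:
  "\<lbrakk>isomorphic C X X'; isomorphic C Y Y'\<rbrakk> \<Longrightarrow> isomorphic C (X \<otimes>\<^sub>o Y) (X' \<otimes>\<^sub>o Y')"
  unfolding isomorphic_iff using inverse_pair_tensor by blast

lemma isomorphic_assoc:
  "\<lbrakk>X \<in> Obj C; Y \<in> Obj C; Z \<in> Obj C\<rbrakk> \<Longrightarrow> isomorphic C (X \<otimes>\<^sub>o Y \<otimes>\<^sub>o Z) (X \<otimes>\<^sub>o (Y \<otimes>\<^sub>o Z))"
  unfolding isomorphic_def using assoc_iso by blast

lemma isomorphic_runit: "X \<in> Obj C \<Longrightarrow> isomorphic C (X \<otimes>\<^sub>o unito C) X"
  unfolding isomorphic_def using runit_iso by blast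

text \<open>Tensoring with a fixed object is an additive functor, so it preserves biproducts.\<close>

lemma biproduct_tensor_right:
  assumes B: "biproduct W I X \<iota> \<pi>" and V: "V \<in> Obj C"
  shows "biproduct (V \<otimes>\<^sub>o W) I (\<lambda>i. V \<otimes>\<^sub>o X i) (\<lambda>i. ident C V \<otimes>\<^sub>m \<iota> i) (\<lambda>i. ident C V \<otimes>\<^sub>m \<pi> i)"
proof -
  note D = biproductD[OF B]
  have "finsum (hom_module C (V \<otimes>\<^sub>o W) (V \<otimes>\<^sub>o W))
      (\<lambda>i. (ident C V \<otimes>\<^sub>m \<iota> i) \<bullet> (ident C V \<otimes>\<^sub>m \<pi> i)) I
    = finsum (hom_module C (V \<otimes>\<^sub>o W) (V \<otimes>\<^sub>o W)) (\<lambda>i. ident C V \<otimes>\<^sub>m (\<iota> i \<bullet> \<pi> i)) I"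
  proof (intro abelian_monoid.finsum_cong' hom_abelian_monoid teno_in V D(2) refl)
    show "(\<lambda>i. ident C V \<otimes>\<^sub>m (\<iota> i \<bullet> \<pi> i)) \<in> I \<rightarrow> carrier (hom_module C (V \<otimes>\<^sub>o W) (V \<otimes>\<^sub>o W))"
      using tenm_in[of V V W W "ident C V"] cmp_closed[of _ W _ _ W] D V by fastforce
    show "(ident C V \<otimes>\<^sub>m \<iota> i) \<bullet> (ident C V \<otimes>\<^sub>m \<pi> i) = ident C V \<otimes>\<^sub>m (\<iota> i \<bullet> \<pi> i)" if "i \<in> I" for i
      using tenm_right_cmp[of V W "X i" W "\<pi> i" "\<iota> i"] V D(2) D(3-5)[OF that] by simp
  qed
  also have "\<dots> = ident C V \<otimes>\<^sub>m finsum (hom_module C W W) (\<lambda>i. \<iota> i \<bullet> \<pi> i) I"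
  proof (intro additive_map_finsum[where \<phi> = "\<lambda>f. ident C V \<otimes>\<^sub>m f", symmetric]
      hom_abelian_monoid teno_in V D(1,2))
    show "(\<lambda>i. \<iota> i \<bullet> \<pi> i) \<in> I \<rightarrow> carrier (hom_module C W W)"
      using cmp_closed[of _ W _ _ W] D by fastforce
  qed (use V D(2) tenm_in[of V V W W] tenm_add_right[of V V W W "ident C V"] in auto)
  also have "\<dots> = ident C (V \<otimes>\<^sub>o W)"
    using biproduct_sum[OF B] V D(2) by (simp add: tenm_ident)
  finally have sum: "finsum (hom_module C (V \<otimes>\<^sub>o W) (V \<otimes>\<^sub>o W))
      (\<lambda>i. (ident C V \<otimes>\<^sub>m \<iota> i) \<bullet> (ident C V \<otimes>\<^sub>m \<pi> i)) I = ident C (V \<otimes>\<^sub>o W)" .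
  show ?thesis
  proof (rule biproductI, goal_cases)
    case (4 i)
    then show ?case
      using tenm_in[of V V "X i" W] V D(2) D(3-5)[of i] by simp
  next
    case (5 i)
    then show ?case
      using tenm_in[of V V W "X i"] V D(2) D(3-5)[of i] by simp
  next
    case (6 i)
    then show ?case
      using tenm_right_cmp[of V "X i" W "X i" "\<iota> i" "\<pi> i"] V D(2) D(3-6)[of i]
      by (simp add: tenm_ident)
  next
    case (7 i j)
    then show ?case
      using tenm_right_cmp[of V "X i" W "X j" "\<iota> i" "\<pi> j"] V D(2) D(3-6)[of i] D(3-6)[of j]
        D(7)[of i j] tenm_zerom_right[of "ident C V" V V] by simp
  next
    case (8 U f)
    show ?case
    proof (rule sum_jointly_monic[OF D(1) _ _ _ _ sum])
      show "\<And>i. i \<in> I \<Longrightarrow> ident C V \<otimes>\<^sub>m \<iota> i \<in> Hom C (V \<otimes>\<^sub>o X i) (V \<otimes>\<^sub>o W)"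
        using tenm_in[of V V _ W] V D(2-5) by simp
      show "\<And>i. i \<in> I \<Longrightarrow> ident C V \<otimes>\<^sub>m \<pi> i \<in> Hom C (V \<otimes>\<^sub>o W) (V \<otimes>\<^sub>o X i)"
        using tenm_in[of V V W] V D(2-5) by simp
    qed (use 8 V D in \<open>auto intro: teno_in\<close>)
  qed (use V D in \<open>auto intro: teno_in\<close>)
qed

lemma biproduct_tensor_left:
  assumes B: "biproduct W I X \<iota> \<pi>" and V: "V \<in> Obj C"
  shows "biproduct (W \<otimes>\<^sub>o V) I (\<lambda>i. X i \<otimes>\<^sub>o V) (\<lambda>i. \<iota> i \<otimes>\<^sub>m ident C V) (\<lambda>i. \<pi> i \<otimes>\<^sub>m ident C V)"
proof -
  note D = biproductD[OF B]
  have "finsum (hom_module C (W \<otimes>\<^sub>o V) (W \<otimes>\<^sub>o V))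
      (\<lambda>i. (\<iota> i \<otimes>\<^sub>m ident C V) \<bullet> (\<pi> i \<otimes>\<^sub>m ident C V)) I
    = finsum (hom_module C (W \<otimes>\<^sub>o V) (W \<otimes>\<^sub>o V)) (\<lambda>i. (\<iota> i \<bullet> \<pi> i) \<otimes>\<^sub>m ident C V) I"
  proof (intro abelian_monoid.finsum_cong' hom_abelian_monoid teno_in V D(2) refl)
    show "(\<lambda>i. (\<iota> i \<bullet> \<pi> i) \<otimes>\<^sub>m ident C V) \<in> I \<rightarrow> carrier (hom_module C (W \<otimes>\<^sub>o V) (W \<otimes>\<^sub>o V))"
      using tenm_in[of W W V V _ "ident C V"] cmp_closed[of _ W _ _ W] D V by fastforce
    show "(\<iota> i \<otimes>\<^sub>m ident C V) \<bullet> (\<pi> i \<otimes>\<^sub>m ident C V) = (\<iota> i \<bullet> \<pi> i) \<otimes>\<^sub>m ident C V" if "i \<in> I" for i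
      using tenm_left_cmp[of V W "X i" W "\<pi> i" "\<iota> i"] V D(2) D(3-5)[OF that] by simp
  qed
  also have "\<dots> = finsum (hom_module C W W) (\<lambda>i. \<iota> i \<bullet> \<pi> i) I \<otimes>\<^sub>m ident C V"
  proof (intro additive_map_finsum[where \<phi> = "\<lambda>f. f \<otimes>\<^sub>m ident C V", symmetric]
      hom_abelian_monoid teno_in V D(1,2))
    show "(\<lambda>i. \<iota> i \<bullet> \<pi> i) \<in> I \<rightarrow> carrier (hom_module C W W)"
      using cmp_closed[of _ W _ _ W] D by fastforce
  qed (use V D(2) tenm_in[of W W V V] tenm_add_left[of W W V V _ _ "ident C V"] in auto)
  also have "\<dots> = ident C (W \<otimes>\<^sub>o V)"
    using biproduct_sum[OF B] V D(2) by (simp add: tenm_ident)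
  finally have sum: "finsum (hom_module C (W \<otimes>\<^sub>o V) (W \<otimes>\<^sub>o V))
      (\<lambda>i. (\<iota> i \<otimes>\<^sub>m ident C V) \<bullet> (\<pi> i \<otimes>\<^sub>m ident C V)) I = ident C (W \<otimes>\<^sub>o V)" .
  show ?thesis
  proof (rule biproductI, goal_cases)
    case (4 i)
    then show ?case
      using tenm_in[of "X i" W V V] V D(2) D(3-5)[of i] by simp
  next
    case (5 i)
    then show ?case
      using tenm_in[of W "X i" V V] V D(2) D(3-5)[of i] by simp
  next
    case (6 i)
    then show ?case
      using tenm_left_cmp[of V "X i" W "X i" "\<iota> i" "\<pi> i"] V D(2) D(3-6)[of i]
      by (simp add: tenm_ident)
  next
    case (7 i j)
    then show ?case
      using tenm_left_cmp[of V "X i" W "X j" "\<iota> i" "\<pi> j"] V D(2) D(3-6)[of i] D(3-6)[of j]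
        D(7)[of i j] tenm_zerom_left[of "ident C V" V V] by simp
  next
    case (8 U f)
    show ?case
    proof (rule sum_jointly_monic[OF D(1) _ _ _ _ sum])
      show "\<And>i. i \<in> I \<Longrightarrow> \<iota> i \<otimes>\<^sub>m ident C V \<in> Hom C (X i \<otimes>\<^sub>o V) (W \<otimes>\<^sub>o V)"
        using tenm_in[of _ W V V] V D(2-5) by simp
      show "\<And>i. i \<in> I \<Longrightarrow> \<pi> i \<otimes>\<^sub>m ident C V \<in> Hom C (W \<otimes>\<^sub>o V) (X i \<otimes>\<^sub>o V)"
        using tenm_in[of W _ V V] V D(2-5) by simp
    qed (use 8 V D in \<open>auto intro: teno_in\<close>)
  qed (use V D in \<open>auto intro: teno_in\<close>)
qed

end

context fusion_category
begin

text \<open>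
  Collecting the summands of \<open>W\<close> by isomorphism class. The operation \<open>F\<close> stands for the tensor
  product with a fixed object on either side.
\<close>

lemma mult_linear:
  assumes B: "biproduct W I X \<iota> \<pi>" and X: "\<forall>i\<in>I. simple_object C (X i)"
    and B': "biproduct (F W) I (\<lambda>i. F (X i)) \<iota>' \<pi>'"
    and F: "\<And>Y Z. isomorphic C Y Z \<Longrightarrow> isomorphic C (F Y) (F Z)"
  shows "mult S (F W) = (\<Sum>r\<in>reps. mult r W * mult S (F r))"
proof -
  note D = biproductD[OF B]
  have "mult S (F W) = (\<Sum>i\<in>I. mult S (F (X i)))"
    by (rule mult_biproduct[OF B'])
  also have "\<dots> = (\<Sum>i\<in>I. mult S (F (rep (X i))))"
    using D(3) F rep_isomorphic mult_isomorphic by (intro sum.cong) auto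
  also have "\<dots> = (\<Sum>r\<in>reps. \<Sum>i\<in>{i\<in>I. rep (X i) = r}. mult S (F (rep (X i))))"
    using D(1) finite_reps X by (intro sum.group[symmetric]) (auto simp: reps_def)
  also have "\<dots> = (\<Sum>r\<in>reps. mult r W * mult S (F r))"
  proof (rule sum.cong)
    fix r assume r: "r \<in> reps"
    have "{i\<in>I. rep (X i) = r} = {i\<in>I. isomorphic C r (X i)}"
      using rep_eq_iff[OF r] D(3) by auto
    then have "mult r W = card {i\<in>I. rep (X i) = r}"
      using mult_eq_card[OF B X, of r] by simp
    then show "(\<Sum>i\<in>{i\<in>I. rep (X i) = r}. mult S (F (rep (X i)))) = mult r W * mult S (F r)"
      by simp
  qed simp
  finally show ?thesis .
qed

lemma mult_tensor_right:
  assumes V: "V \<in> Obj C" and W: "W \<in> Obj C"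
  shows "mult S (V \<otimes>\<^sub>o W) = (\<Sum>r\<in>reps. mult r W * mult S (V \<otimes>\<^sub>o r))"
proof -
  obtain n X \<iota> \<pi> where B: "biproduct W {..<n::nat} X \<iota> \<pi>"
    and X: "\<forall>i\<in>{..<n}. simple_object C (X i)"
    using simple_decomposition W .
  show ?thesis
    using mult_linear[OF B X biproduct_tensor_right[OF B V]]
      isomorphic_tensor[OF isomorphic_refl[OF V]] by blast
qed

lemma mult_tensor_left:
  assumes V: "V \<in> Obj C" and W: "W \<in> Obj C"
  shows "mult S (W \<otimes>\<^sub>o V) = (\<Sum>r\<in>reps. mult r W * mult S (r \<otimes>\<^sub>o V))"
proof -
  obtain n X \<iota> \<pi> where B: "biproduct W {..<n::nat} X \<iota> \<pi>"
    and X: "\<forall>i\<in>{..<n}. simple_object C (X i)"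
    using simple_decomposition W .
  show ?thesis
    using mult_linear[where F = "\<lambda>W. W \<otimes>\<^sub>o V", OF B X biproduct_tensor_left[OF B V]]
      isomorphic_tensor[OF _ isomorphic_refl[OF V]] by blast
qed

lemma lookup_object_class:
  assumes "S \<in> simple_classes C"
  shows "Poly_Mapping.lookup (object_class C W) S = int (multiplicity C S W)"
proof -
  have "Poly_Mapping.lookup (object_class C W) S
      = (\<Sum>T\<in>simple_classes C. if S = T then int (multiplicity C T W) else 0)"
    unfolding object_class_def lookup_sum by (intro sum.cong) (auto simp: lookup_frag_of)
  also have "\<dots> = int (multiplicity C S W)"
    using assms finite_simple_classes by simp
  finally show ?thesis .
qed

text \<open>
  Commutativity of the Grothendieck ring concerns the products of the chosen simple representatives;
  both sides here are the same bilinear combination of such products.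
\<close>

lemma mult_tensor_commute:
  assumes comm: "commutative_grothendieck_ring C"
    and S: "simple_object C S" and X: "X \<in> Obj C" and Y: "Y \<in> Obj C"
  shows "mult S (X \<otimes>\<^sub>o Y) = mult S (Y \<otimes>\<^sub>o X)"
proof -
  have reps: "mult S (r \<otimes>\<^sub>o q) = mult S (q \<otimes>\<^sub>o r)" if r: "r \<in> reps" and q: "q \<in> reps" for r q
  proof -
    let ?R = "grothendieck_ring C"
    have cls: "iso_class C r \<in> simple_classes C" "iso_class C q \<in> simple_classes C"
      "iso_class C S \<in> simple_classes C"
      using reps_simple r q S by (auto simp: simple_classes_def)
    then have "frag_of (iso_class C r) \<in> carrier ?R" "frag_of (iso_class C q) \<in> carrier ?R"
      by (simp_all add: grothendieck_ring_def)
    then have "frag_of (iso_class C r) \<otimes>\<^bsub>?R\<^esub> frag_of (iso_class C q)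
        = frag_of (iso_class C q) \<otimes>\<^bsub>?R\<^esub> frag_of (iso_class C r)"
      using comm by (simp add: commutative_grothendieck_ring_def)
    then have "object_class C (rep r \<otimes>\<^sub>o rep q) = object_class C (rep q \<otimes>\<^sub>o rep r)"
      by (simp add: grothendieck_ring_def rep_def)
    then show ?thesis
      using lookup_object_class[OF cls(3)] rep_reps r q by (metis mult_def of_nat_eq_iff)
  qed
  have "mult S (X \<otimes>\<^sub>o Y) = (\<Sum>r\<in>reps. mult r X * (\<Sum>q\<in>reps. mult q Y * mult S (r \<otimes>\<^sub>o q)))"
    using mult_tensor_left[OF Y X] mult_tensor_right[OF _ Y] reps_obj by (simp cong: sum.cong)
  also have "\<dots> = (\<Sum>r\<in>reps. mult r X * (\<Sum>q\<in>reps. mult q Y * mult S (q \<otimes>\<^sub>o r)))"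
    using reps by (simp cong: sum.cong)
  also have "\<dots> = mult S (Y \<otimes>\<^sub>o X)"
    using mult_tensor_right[OF Y X] mult_tensor_left[OF _ Y] reps_obj by (simp cong: sum.cong)
  finally show ?thesis .
qed

end


section \<open>Duals\<close>

context linear_category
begin

text \<open>
  Hom-sets may overlap, so a morphism does not determine its source and target. This predicate
  bundles all typing information, and the type of a composite can be read off from its parts.
\<close>

definition arr :: "'o \<Rightarrow> 'o \<Rightarrow> 'm \<Rightarrow> bool" where
  "arr X Y f \<longleftrightarrow> X \<in> Obj C \<and> Y \<in> Obj C \<and> f \<in> Hom C X Y"

lemma arrD: "arr X Y f \<Longrightarrow> X \<in> Obj C" "arr X Y f \<Longrightarrow> Y \<in> Obj C" "arr X Y f \<Longrightarrow> f \<in> Hom C X Y"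
  by (simp_all add: arr_def)

lemma arr_ident: "X \<in> Obj C \<Longrightarrow> arr X X (ident C X)"
  by (simp add: arr_def)

lemma arr_cmp: "\<lbrakk>arr X Y f; arr Y Z g\<rbrakk> \<Longrightarrow> arr X Z (g \<bullet> f)"
  using cmp_closed by (auto simp: arr_def)

lemma arr_cmp_assoc: "\<lbrakk>arr W X f; arr X Y g; arr Y Z h\<rbrakk> \<Longrightarrow> h \<bullet> (g \<bullet> f) = h \<bullet> g \<bullet> f"
  unfolding arr_def by (blast intro: cmp_assoc)

lemma arr_cmp_ident:
  assumes "arr X Y f"
  shows "ident C Y \<bullet> f = f" "f \<bullet> ident C X = f"
  using arrD[OF assms] by simp_all

lemma arr_inverse_pair:
  assumes "inverse_pair C X Y f g"
  shows "arr X Y f" "arr Y X g"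
  using inverse_pairD[OF assms] by (simp_all add: arr_def)

text \<open>Rewriting at the head of a right-nested composite.\<close>

lemma square_extend:
  assumes "u \<bullet> v = u' \<bullet> v'" and "arr A B w" "arr B D v" "arr D E u" "arr B D' v'" "arr D' E u'"
  shows "u \<bullet> (v \<bullet> w) = u' \<bullet> (v' \<bullet> w)"
  using arr_cmp_assoc[of A B w D v E u] arr_cmp_assoc[of A B w D' v' E u'] assms by simp

lemma triangle_extend:
  assumes "u \<bullet> v = t" and "arr A B w" "arr B D v" "arr D E u"
  shows "u \<bullet> (v \<bullet> w) = t \<bullet> w"
  using arr_cmp_assoc[of A B w D v E u] assms by simp

lemma inverse_pair_cancel_left:
  assumes "inverse_pair C Y Z g h" "arr X Y f"
  shows "h \<bullet> (g \<bullet> f) = f"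
  using triangle_extend[of h g "ident C Y" X Y f Z Y] arr_inverse_pair[OF assms(1)]
    inverse_pairD(5)[OF assms(1)] assms(2) arr_cmp_ident by simp

lemma inverse_pair_cancel_right:
  assumes "inverse_pair C X Y g h" "arr X Z f"
  shows "f \<bullet> h \<bullet> g = f"
  using arr_cmp_assoc[of X Y g X h Z f] arr_inverse_pair[OF assms(1)]
    inverse_pairD(5)[OF assms(1)] assms(2) arr_cmp_ident by simp

lemma inverse_mor_eq:
  assumes "inverse_pair C X Y f g"
  shows "inverse_mor C X Y f = g"
  unfolding inverse_mor_def
proof (rule the_equality)
  fix h assume h: "inverse_pair C X Y f h"
  have "h = (g \<bullet> f) \<bullet> h"
    using inverse_pairD[OF assms] inverse_pairD[OF h] by simp
  also have "\<dots> = g \<bullet> (f \<bullet> h)"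
    using arr_cmp_assoc arr_inverse_pair assms h by metis
  also have "\<dots> = g"
    using inverse_pairD[OF assms] inverse_pairD[OF h] by simp
  finally show "h = g" .
qed (rule assms)

lemma inverse_square:
  assumes \<alpha>: "inverse_pair C X Y \<alpha> \<beta>" and \<alpha>': "inverse_pair C X' Y' \<alpha>' \<beta>'"
    and u: "arr X X' u" and v: "arr Y Y' v" and eq: "\<alpha>' \<bullet> u = v \<bullet> \<alpha>"
  shows "u \<bullet> \<beta> = \<beta>' \<bullet> v"
proof -
  note a = arr_inverse_pair[OF \<alpha>] arr_inverse_pair[OF \<alpha>']
  have "u \<bullet> \<beta> = \<beta>' \<bullet> (\<alpha>' \<bullet> (u \<bullet> \<beta>))"
    using inverse_pair_cancel_left[OF \<alpha>'] arr_cmp[OF a(2) u] by simp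
  also have "\<alpha>' \<bullet> (u \<bullet> \<beta>) = v \<bullet> \<alpha> \<bullet> \<beta>"
    using arr_cmp_assoc[OF a(2) u a(3)] eq by simp
  also have "\<dots> = v"
    using inverse_pair_cancel_right[OF inverse_pair_sym[OF \<alpha>] v] .
  finally show ?thesis .
qed

end

context linear_monoidal_category
begin

lemma arr_ten: "\<lbrakk>arr X X' f; arr Y Y' g\<rbrakk> \<Longrightarrow> arr (X \<otimes>\<^sub>o Y) (X' \<otimes>\<^sub>o Y') (f \<otimes>\<^sub>m g)"
  unfolding arr_def using teno_in tenm_in by blast

lemma arr_lunit: "X \<in> Obj C \<Longrightarrow> arr (unito C \<otimes>\<^sub>o X) X (lunit C X)"
  and arr_runit: "X \<in> Obj C \<Longrightarrow> arr (X \<otimes>\<^sub>o unito C) X (runit C X)"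
  and arr_assoc: "\<lbrakk>X \<in> Obj C; Y \<in> Obj C; Z \<in> Obj C\<rbrakk>
    \<Longrightarrow> arr (X \<otimes>\<^sub>o Y \<otimes>\<^sub>o Z) (X \<otimes>\<^sub>o (Y \<otimes>\<^sub>o Z)) (assoc C X Y Z)"
  using lunit_iso runit_iso assoc_iso arr_inverse_pair unfolding isomorphism_def by blast+

lemma ten_cmp:
  assumes "arr X X' f" "arr X' X'' f'" "arr Y Y' g" "arr Y' Y'' g'"
  shows "(f' \<otimes>\<^sub>m g') \<bullet> (f \<otimes>\<^sub>m g) = (f' \<bullet> f) \<otimes>\<^sub>m (g' \<bullet> g)"
  using tenm_cmp[of X X' X'' Y Y' Y'' f f' g g'] assms by (simp add: arr_def)

lemma ten_interchange:
  assumes "arr X X' f" "arr Y Y' g"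
  shows "(f \<otimes>\<^sub>m ident C Y') \<bullet> (ident C X \<otimes>\<^sub>m g) = f \<otimes>\<^sub>m g"
    "(ident C X' \<otimes>\<^sub>m g) \<bullet> (f \<otimes>\<^sub>m ident C Y) = f \<otimes>\<^sub>m g"
  using ten_cmp[of X X "ident C X" X' f Y Y' g Y' "ident C Y'"]
    ten_cmp[of X X' f X' "ident C X'" Y Y "ident C Y" Y' g] assms
    arr_cmp_ident[OF assms(1)] arr_cmp_ident[OF assms(2)] arrD[OF assms(1)] arrD[OF assms(2)]
  by (simp_all add: arr_ident)

lemma ten_ident_cmp:
  assumes "arr X Y f" "arr Y Z g" "V \<in> Obj C"
  shows "(ident C V \<otimes>\<^sub>m g) \<bullet> (ident C V \<otimes>\<^sub>m f) = ident C V \<otimes>\<^sub>m (g \<bullet> f)"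
    "(g \<otimes>\<^sub>m ident C V) \<bullet> (f \<otimes>\<^sub>m ident C V) = (g \<bullet> f) \<otimes>\<^sub>m ident C V"
  using tenm_right_cmp[of V X Y Z f g] tenm_left_cmp[of V X Y Z f g] assms by (simp_all add: arr_def)

lemma assoc_nat:
  assumes "arr X X' f" "arr Y Y' g" "arr Z Z' h"
  shows "assoc C X' Y' Z' \<bullet> (f \<otimes>\<^sub>m g \<otimes>\<^sub>m h) = (f \<otimes>\<^sub>m (g \<otimes>\<^sub>m h)) \<bullet> assoc C X Y Z"
  using assms unfolding arr_def by (blast intro: assoc_natural)

text \<open>By naturality of the unit constraint, which is invertible.\<close>

lemma ten_unit_faithful:
  assumes f: "arr W Z f" and 0: "ident C (unito C) \<otimes>\<^sub>m f = zerom C (unito C \<otimes>\<^sub>o W) (unito C \<otimes>\<^sub>o Z)"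
  shows "f = zerom C W Z"
proof -
  have obj: "W \<in> Obj C" "Z \<in> Obj C" "f \<in> Hom C W Z" and u: "unito C \<otimes>\<^sub>o Z \<in> Obj C"
    "unito C \<otimes>\<^sub>o W \<in> Obj C"
    using f teno_in unit_in by (auto simp: arr_def)
  obtain l where l: "inverse_pair C (unito C \<otimes>\<^sub>o W) W (lunit C W) l"
    using lunit_iso obj unfolding isomorphism_def by blast
  note D = inverse_pairD[OF l]
  have "f \<bullet> lunit C W = zerom C (unito C \<otimes>\<^sub>o W) Z"
    using lunit_natural[OF obj] 0 arrD(3)[OF arr_lunit[OF obj(2)]] obj u
      cmp_zerom_right[of "lunit C Z" "unito C \<otimes>\<^sub>o Z" Z "unito C \<otimes>\<^sub>o W"] by simp
  then have "f \<bullet> lunit C W \<bullet> l = zerom C W Z"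
    using D obj by simp
  then show ?thesis
    using inverse_pair_cancel_right[OF inverse_pair_sym[OF l] f] by simp
qed

lemma left_dualE:
  assumes "left_dual C X X'"
  obtains ev coev \<beta> where "X \<in> Obj C" "X' \<in> Obj C"
    "arr (X' \<otimes>\<^sub>o X) (unito C) ev" "arr (unito C) (X \<otimes>\<^sub>o X') coev"
    "inverse_pair C (X' \<otimes>\<^sub>o X \<otimes>\<^sub>o X') (X' \<otimes>\<^sub>o (X \<otimes>\<^sub>o X')) (assoc C X' X X') \<beta>"
    "runit C X \<bullet> (ident C X \<otimes>\<^sub>m ev) \<bullet> assoc C X X' X \<bullet> (coev \<otimes>\<^sub>m ident C X) = lunit C X"
    "lunit C X' \<bullet> (ev \<otimes>\<^sub>m ident C X') \<bullet> \<beta> \<bullet> (ident C X' \<otimes>\<^sub>m coev) = runit C X'"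
proof -
  have X: "X \<in> Obj C" "X' \<in> Obj C"
    using assms by (auto simp: left_dual_def)
  obtain \<beta> where \<beta>: "inverse_pair C (X' \<otimes>\<^sub>o X \<otimes>\<^sub>o X') (X' \<otimes>\<^sub>o (X \<otimes>\<^sub>o X')) (assoc C X' X X') \<beta>"
    using assoc_iso[OF X(2,1,2)] unfolding isomorphism_def by blast
  show ?thesis
    using assms that[OF X _ _ \<beta>] teno_in unit_in X unfolding left_dual_def inverse_mor_eq[OF \<beta>] arr_def
    by blast
qed

text \<open>
  Half of Frobenius reciprocity: \<open>f \<mapsto> \<lambda> \<circ> (ev \<otimes> 1) \<circ> \<alpha>\<^sup>-\<^sup>1 \<circ> (1 \<otimes> f)\<close> is an injection of
  \<open>Hom(W, X \<otimes> Z)\<close> into \<open>Hom(X' \<otimes> W, Z)\<close>. Applying \<open>X \<otimes> -\<close> to the image of \<open>f\<close> and precomposing with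
  the coevaluation gives \<open>Q \<circ> (1 \<otimes> f)\<close> for a morphism \<open>Q\<close> that the pentagon, the triangle and the
  first zigzag identity identify with \<open>\<lambda> \<otimes> 1\<close> up to an associator.
\<close>

lemma left_dual_reciprocity:
  assumes dual: "left_dual C X X'" and Z: "Z \<in> Obj C"
    and f: "arr W (X \<otimes>\<^sub>o Z) f" "f \<noteq> zerom C W (X \<otimes>\<^sub>o Z)"
  shows "\<exists>g\<in>Hom C (X' \<otimes>\<^sub>o W) Z. g \<noteq> zerom C (X' \<otimes>\<^sub>o W) Z"
proof -
  obtain ev coev where X: "X \<in> Obj C" and X': "X' \<in> Obj C"
    and ev: "arr (X' \<otimes>\<^sub>o X) (unito C) ev" and coev: "arr (unito C) (X \<otimes>\<^sub>o X') coev"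
    and zig: "runit C X \<bullet> (ident C X \<otimes>\<^sub>m ev) \<bullet> assoc C X X' X \<bullet> (coev \<otimes>\<^sub>m ident C X) = lunit C X"
    using left_dualE[OF dual] by metis
  have W: "W \<in> Obj C"
    using f(1) by (rule arrD)
  let ?I = "unito C" and ?XZ = "X \<otimes>\<^sub>o Z" and ?XX = "X \<otimes>\<^sub>o X'" and ?E = "X' \<otimes>\<^sub>o X"
  obtain \<beta> where \<beta>: "inverse_pair C (?E \<otimes>\<^sub>o Z) (X' \<otimes>\<^sub>o ?XZ) (assoc C X' X Z) \<beta>"
    using assoc_iso[OF X' X Z] unfolding isomorphism_def by blast
  note arrs = arr_ident arr_cmp arr_ten arr_lunit arr_runit arr_assoc ev coev f(1)
    arr_inverse_pair[OF \<beta>]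
  define L where "L = ident C X \<otimes>\<^sub>m lunit C Z"
  define M where "M = ident C X \<otimes>\<^sub>m (ev \<otimes>\<^sub>m ident C Z)"
  define N where "N = ident C X \<otimes>\<^sub>m \<beta>"
  define A where "A = assoc C X X' ?XZ"
  define B where "B = coev \<otimes>\<^sub>m ident C ?XZ"
  define a1 where "a1 = assoc C ?I X Z"
  define A2 where "A2 = assoc C ?XX X Z"
  define B' where "B' = coev \<otimes>\<^sub>m ident C X \<otimes>\<^sub>m ident C Z"
  define A3 where "A3 = assoc C X ?E Z"
  define P where "P = assoc C X X' X \<otimes>\<^sub>m ident C Z"
  define A4 where "A4 = assoc C X ?I Z"
  define M' where "M' = ident C X \<otimes>\<^sub>m ev \<otimes>\<^sub>m ident C Z"
  define R where "R = runit C X \<otimes>\<^sub>m ident C Z"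
  have L: "arr (X \<otimes>\<^sub>o (?I \<otimes>\<^sub>o Z)) ?XZ L" unfolding L_def by (intro arrs Z X)
  have M: "arr (X \<otimes>\<^sub>o (?E \<otimes>\<^sub>o Z)) (X \<otimes>\<^sub>o (?I \<otimes>\<^sub>o Z)) M" unfolding M_def by (intro arrs Z X)
  have N: "arr (X \<otimes>\<^sub>o (X' \<otimes>\<^sub>o ?XZ)) (X \<otimes>\<^sub>o (?E \<otimes>\<^sub>o Z)) N" unfolding N_def by (intro arrs Z X)
  have A: "arr (?XX \<otimes>\<^sub>o ?XZ) (X \<otimes>\<^sub>o (X' \<otimes>\<^sub>o ?XZ)) A"
    unfolding A_def by (intro arrs Z X X' teno_in)
  have B: "arr (?I \<otimes>\<^sub>o ?XZ) (?XX \<otimes>\<^sub>o ?XZ) B" unfolding B_def by (intro arrs Z X X' teno_in)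
  have a1: "arr (?I \<otimes>\<^sub>o X \<otimes>\<^sub>o Z) (?I \<otimes>\<^sub>o ?XZ) a1" unfolding a1_def by (intro arrs Z X unit_in)
  have A2: "arr (?XX \<otimes>\<^sub>o X \<otimes>\<^sub>o Z) (?XX \<otimes>\<^sub>o ?XZ) A2" unfolding A2_def by (intro arrs Z X X' teno_in)
  have B': "arr (?I \<otimes>\<^sub>o X \<otimes>\<^sub>o Z) (?XX \<otimes>\<^sub>o X \<otimes>\<^sub>o Z) B'" unfolding B'_def by (intro arrs Z X)
  have A3: "arr (X \<otimes>\<^sub>o ?E \<otimes>\<^sub>o Z) (X \<otimes>\<^sub>o (?E \<otimes>\<^sub>o Z)) A3"
    unfolding A3_def by (intro arrs Z X X' teno_in)
  have P: "arr (?XX \<otimes>\<^sub>o X \<otimes>\<^sub>o Z) (X \<otimes>\<^sub>o ?E \<otimes>\<^sub>o Z) P" unfolding P_def by (intro arrs Z X X')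
  have A4: "arr (X \<otimes>\<^sub>o ?I \<otimes>\<^sub>o Z) (X \<otimes>\<^sub>o (?I \<otimes>\<^sub>o Z)) A4" unfolding A4_def by (intro arrs Z X unit_in)
  have M': "arr (X \<otimes>\<^sub>o ?E \<otimes>\<^sub>o Z) (X \<otimes>\<^sub>o ?I \<otimes>\<^sub>o Z) M'" unfolding M'_def by (intro arrs Z X)
  have R: "arr (X \<otimes>\<^sub>o ?I \<otimes>\<^sub>o Z) ?XZ R" unfolding R_def by (intro arrs Z X)

  \<comment> \<open>Naturality, the pentagon, naturality again and the triangle move the coevaluation and the
    evaluation past \<open>Z\<close>; what remains is the first zigzag tensored with \<open>Z\<close>.\<close>
  have e1: "B \<bullet> a1 = A2 \<bullet> B'"
    using assoc_nat[OF coev arr_ident[OF X] arr_ident[OF Z]] X Z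
    by (simp add: B_def a1_def A2_def B'_def tenm_ident)
  have "(ident C X \<otimes>\<^sub>m assoc C X' X Z) \<bullet> A3 \<bullet> P = A \<bullet> A2"
    using pentagon[OF X X' X Z] by (simp add: A_def A2_def A3_def P_def)
  moreover have "inverse_pair C (X \<otimes>\<^sub>o (?E \<otimes>\<^sub>o Z)) (X \<otimes>\<^sub>o (X' \<otimes>\<^sub>o ?XZ))
      (ident C X \<otimes>\<^sub>m assoc C X' X Z) N"
    unfolding N_def using \<beta> X
    by (intro inverse_pair_tensor) (auto simp: inverse_pair_def cmp_ident(1)[of _ X X])
  ultimately have e2: "N \<bullet> (A \<bullet> A2) = A3 \<bullet> P"
    using inverse_pair_cancel_left arr_cmp[OF P A3] arr_cmp_assoc[OF P A3] arr_inverse_pair(1)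
    by metis
  have e3: "M \<bullet> A3 = A4 \<bullet> M'"
    using assoc_nat[OF arr_ident[OF X] ev arr_ident[OF Z]]
    by (simp add: M_def A3_def A4_def M'_def)
  have e4: "L \<bullet> A4 = R"
    using triangle[OF X Z] by (simp add: L_def A4_def R_def)
  have e5: "R \<bullet> (M' \<bullet> (P \<bullet> B')) = lunit C X \<otimes>\<^sub>m ident C Z"
  proof -
    have c1: "arr (?I \<otimes>\<^sub>o X) (?XX \<otimes>\<^sub>o X) (coev \<otimes>\<^sub>m ident C X)"
      and c2: "arr (?XX \<otimes>\<^sub>o X) (X \<otimes>\<^sub>o ?E) (assoc C X X' X)"
      and c3: "arr (X \<otimes>\<^sub>o ?E) (X \<otimes>\<^sub>o ?I) (ident C X \<otimes>\<^sub>m ev)"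
      and c4: "arr (X \<otimes>\<^sub>o ?I) X (runit C X)"
      by (intro arrs X X')+
    have "R \<bullet> (M' \<bullet> (P \<bullet> B')) = R \<bullet> M' \<bullet> P \<bullet> B'"
      using arr_cmp_assoc[OF arr_cmp[OF B' P] M' R] arr_cmp_assoc[OF B' P arr_cmp[OF M' R]] by simp
    also have "R \<bullet> M' = (runit C X \<bullet> (ident C X \<otimes>\<^sub>m ev)) \<otimes>\<^sub>m ident C Z"
      unfolding R_def M'_def by (rule ten_ident_cmp(2)[OF c3 c4 Z])
    also have "\<dots> \<bullet> P = (runit C X \<bullet> (ident C X \<otimes>\<^sub>m ev) \<bullet> assoc C X X' X) \<otimes>\<^sub>m ident C Z"
      unfolding P_def by (rule ten_ident_cmp(2)[OF c2 arr_cmp[OF c3 c4] Z])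
    also have "\<dots> \<bullet> B' = lunit C X \<otimes>\<^sub>m ident C Z"
      unfolding B'_def zig[symmetric]
      by (rule ten_ident_cmp(2)[OF c1 arr_cmp[OF c2 arr_cmp[OF c3 c4]] Z])
    finally show ?thesis .
  qed

  define Q where "Q = L \<bullet> (M \<bullet> (N \<bullet> (A \<bullet> B)))"
  have Q: "arr (?I \<otimes>\<^sub>o ?XZ) ?XZ Q"
    unfolding Q_def by (intro arr_cmp[OF _ L] arr_cmp[OF _ M] arr_cmp[OF _ N] arr_cmp[OF _ A] B)
  have Qa1: "Q \<bullet> a1 = lunit C X \<otimes>\<^sub>m ident C Z"
  proof -
    note AB = arr_cmp[OF B A] and PB = arr_cmp[OF B' P]
    note NAB = arr_cmp[OF AB N]
    note MNAB = arr_cmp[OF NAB M]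
    have "Q \<bullet> a1 = L \<bullet> (M \<bullet> (N \<bullet> (A \<bullet> (B \<bullet> a1))))"
      unfolding Q_def
      using arr_cmp_assoc[OF a1 MNAB L] arr_cmp_assoc[OF a1 NAB M] arr_cmp_assoc[OF a1 AB N]
        arr_cmp_assoc[OF a1 B A] by simp
    also have "A \<bullet> (B \<bullet> a1) = A \<bullet> A2 \<bullet> B'"
      unfolding e1 by (rule arr_cmp_assoc[OF B' A2 A])
    also have "N \<bullet> (A \<bullet> A2 \<bullet> B') = A3 \<bullet> (P \<bullet> B')"
      using arr_cmp_assoc[OF B' arr_cmp[OF A2 A] N] arr_cmp_assoc[OF B' P A3] e2 by simp
    also have "M \<bullet> (A3 \<bullet> (P \<bullet> B')) = A4 \<bullet> (M' \<bullet> (P \<bullet> B'))"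
      by (rule square_extend[OF e3 PB A3 M M' A4])
    also have "L \<bullet> (A4 \<bullet> (M' \<bullet> (P \<bullet> B'))) = R \<bullet> (M' \<bullet> (P \<bullet> B'))"
      by (rule triangle_extend[OF e4 arr_cmp[OF PB M'] A4 L])
    finally show ?thesis
      using e5 by simp
  qed

  define g where "g = lunit C Z \<bullet> ((ev \<otimes>\<^sub>m ident C Z) \<bullet> (\<beta> \<bullet> (ident C X' \<otimes>\<^sub>m f)))"
  have c1: "arr (X' \<otimes>\<^sub>o W) (X' \<otimes>\<^sub>o ?XZ) (ident C X' \<otimes>\<^sub>m f)"
    and c2: "arr (X' \<otimes>\<^sub>o ?XZ) (?E \<otimes>\<^sub>o Z) \<beta>"
    and c3: "arr (?E \<otimes>\<^sub>o Z) (?I \<otimes>\<^sub>o Z) (ev \<otimes>\<^sub>m ident C Z)"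
    and c4: "arr (?I \<otimes>\<^sub>o Z) Z (lunit C Z)"
    by (intro arrs X X' Z)+
  have g: "arr (X' \<otimes>\<^sub>o W) Z g"
    unfolding g_def by (intro arr_cmp[OF _ c4] arr_cmp[OF _ c3] arr_cmp[OF _ c2] c1)
  have "g \<noteq> zerom C (X' \<otimes>\<^sub>o W) Z"
  proof
    assume g0: "g = zerom C (X' \<otimes>\<^sub>o W) Z"
    define F where "F = ident C X \<otimes>\<^sub>m (ident C X' \<otimes>\<^sub>m f)"
    define f1 where "f1 = ident C ?I \<otimes>\<^sub>m f"
    define AW where "AW = assoc C X X' W"
    define BW where "BW = coev \<otimes>\<^sub>m ident C W"
    have F: "arr (X \<otimes>\<^sub>o (X' \<otimes>\<^sub>o W)) (X \<otimes>\<^sub>o (X' \<otimes>\<^sub>o ?XZ)) F" unfolding F_def by (intro arrs X X')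
    have f1: "arr (?I \<otimes>\<^sub>o W) (?I \<otimes>\<^sub>o ?XZ) f1" unfolding f1_def by (intro arrs unit_in)
    have AW: "arr (?XX \<otimes>\<^sub>o W) (X \<otimes>\<^sub>o (X' \<otimes>\<^sub>o W)) AW" unfolding AW_def by (intro arrs X X' W)
    have BW: "arr (?I \<otimes>\<^sub>o W) (?XX \<otimes>\<^sub>o W) BW" unfolding BW_def by (intro arrs W)
    have "ident C X \<otimes>\<^sub>m g = L \<bullet> (M \<bullet> (N \<bullet> F))"
      unfolding g_def L_def M_def N_def F_def
      using ten_ident_cmp(1)[OF c1 c2 X] ten_ident_cmp(1)[OF arr_cmp[OF c1 c2] c3 X]
        ten_ident_cmp(1)[OF arr_cmp[OF arr_cmp[OF c1 c2] c3] c4 X] by simp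
    then have 0: "L \<bullet> (M \<bullet> (N \<bullet> F)) = zerom C (X \<otimes>\<^sub>o (X' \<otimes>\<^sub>o W)) ?XZ"
      unfolding g0 using tenm_zerom_right[of "ident C X" X X "X' \<otimes>\<^sub>o W" Z] X X' W Z teno_in by simp
    have FA: "F \<bullet> AW = A \<bullet> (ident C ?XX \<otimes>\<^sub>m f)"
      using assoc_nat[OF arr_ident[OF X] arr_ident[OF X'] f(1)] X X'
      by (simp add: F_def AW_def A_def tenm_ident)
    have fB: "(ident C ?XX \<otimes>\<^sub>m f) \<bullet> BW = B \<bullet> f1"
      using ten_interchange[OF coev f(1)] by (simp add: BW_def B_def f1_def)
    have XXf: "arr (?XX \<otimes>\<^sub>o W) (?XX \<otimes>\<^sub>o ?XZ) (ident C ?XX \<otimes>\<^sub>m f)"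
      by (intro arrs X X' teno_in)
    note NF = arr_cmp[OF F N]
    note MNF = arr_cmp[OF NF M]
    note AB = arr_cmp[OF B A]
    note NAB = arr_cmp[OF AB N]
    note MNAB = arr_cmp[OF NAB M]
    have "Q \<bullet> f1 = L \<bullet> (M \<bullet> (N \<bullet> (A \<bullet> (B \<bullet> f1))))"
      unfolding Q_def
      using arr_cmp_assoc[OF f1 MNAB L] arr_cmp_assoc[OF f1 NAB M] arr_cmp_assoc[OF f1 AB N]
        arr_cmp_assoc[OF f1 B A] by simp
    also have "A \<bullet> (B \<bullet> f1) = F \<bullet> (AW \<bullet> BW)"
      unfolding fB[symmetric] by (rule square_extend[OF FA[symmetric] BW XXf A AW F])
    also have "L \<bullet> (M \<bullet> (N \<bullet> (F \<bullet> (AW \<bullet> BW)))) = L \<bullet> (M \<bullet> (N \<bullet> F)) \<bullet> (AW \<bullet> BW)"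
      using arr_cmp_assoc[OF arr_cmp[OF BW AW] MNF L] arr_cmp_assoc[OF arr_cmp[OF BW AW] NF M]
        arr_cmp_assoc[OF arr_cmp[OF BW AW] F N] by simp
    also have "\<dots> = zerom C (?I \<otimes>\<^sub>o W) ?XZ"
      unfolding 0 using arr_cmp[OF BW AW] teno_in[OF X Z] by (auto simp: arr_def)
    finally have Qf1: "Q \<bullet> f1 = zerom C (?I \<otimes>\<^sub>o W) ?XZ" .
    obtain b1 where b1: "inverse_pair C (?I \<otimes>\<^sub>o X \<otimes>\<^sub>o Z) (?I \<otimes>\<^sub>o ?XZ) a1 b1"
      using assoc_iso[OF unit_in X Z] unfolding isomorphism_def a1_def by blast
    obtain l where l: "inverse_pair C (?I \<otimes>\<^sub>o X) X (lunit C X) l"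
      using lunit_iso[OF X] unfolding isomorphism_def by blast
    have "inverse_pair C Z Z (ident C Z) (ident C Z)"
      using Z by (simp add: inverse_pair_def cmp_ident(1)[of _ Z Z])
    then have "inverse_pair C (?I \<otimes>\<^sub>o ?XZ) ?XZ ((lunit C X \<otimes>\<^sub>m ident C Z) \<bullet> b1) (a1 \<bullet> (l \<otimes>\<^sub>m ident C Z))"
      using inverse_pair_cmp[OF inverse_pair_sym[OF b1] inverse_pair_tensor[OF l]] by blast
    moreover have "(lunit C X \<otimes>\<^sub>m ident C Z) \<bullet> b1 = Q"
      unfolding Qa1[symmetric] using inverse_pair_cancel_right[OF inverse_pair_sym[OF b1] Q] .
    ultimately have "inverse_pair C (?I \<otimes>\<^sub>o ?XZ) ?XZ Q (a1 \<bullet> (l \<otimes>\<^sub>m ident C Z))"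
      by simp
    then obtain q where q: "inverse_pair C (?I \<otimes>\<^sub>o ?XZ) ?XZ Q q" ..
    have "f1 = q \<bullet> (Q \<bullet> f1)"
      using inverse_pair_cancel_left[OF q f1] by simp
    also have "\<dots> = zerom C (?I \<otimes>\<^sub>o W) (?I \<otimes>\<^sub>o ?XZ)"
      unfolding Qf1 using inverse_pairD[OF q] f1 by (auto simp: arr_def)
    finally show False
      using ten_unit_faithful[OF f(1)] f(2) by (simp add: f1_def)
  qed
  then show ?thesis
    using g arrD(3) by blast
qed

text \<open>
  If \<open>(1 \<otimes> p) \<circ> coev\<close> vanishes, then so does \<open>p\<close>, by naturality and the second zigzag identity.
\<close>

lemma left_dual_coev_quotient:
  assumes dual: "left_dual C X X'" and p: "arr X' P p" "p \<noteq> zerom C X' P"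
  shows "\<exists>f\<in>Hom C (unito C) (X \<otimes>\<^sub>o P). f \<noteq> zerom C (unito C) (X \<otimes>\<^sub>o P)"
proof -
  obtain ev coev \<beta> where X: "X \<in> Obj C" and X': "X' \<in> Obj C"
    and ev: "arr (X' \<otimes>\<^sub>o X) (unito C) ev" and coev: "arr (unito C) (X \<otimes>\<^sub>o X') coev"
    and \<beta>: "inverse_pair C (X' \<otimes>\<^sub>o X \<otimes>\<^sub>o X') (X' \<otimes>\<^sub>o (X \<otimes>\<^sub>o X')) (assoc C X' X X') \<beta>"
    and zag: "lunit C X' \<bullet> (ev \<otimes>\<^sub>m ident C X') \<bullet> \<beta> \<bullet> (ident C X' \<otimes>\<^sub>m coev) = runit C X'"
    using left_dualE[OF dual] by metis
  have P: "P \<in> Obj C"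
    using p by (simp add: arr_def)
  let ?I = "unito C" and ?E = "X' \<otimes>\<^sub>o X"
  obtain \<gamma> where \<gamma>: "inverse_pair C (?E \<otimes>\<^sub>o P) (X' \<otimes>\<^sub>o (X \<otimes>\<^sub>o P)) (assoc C X' X P) \<gamma>"
    using assoc_iso[OF X' X P] unfolding isomorphism_def by blast
  have Xp: "arr (X \<otimes>\<^sub>o X') (X \<otimes>\<^sub>o P) (ident C X \<otimes>\<^sub>m p)"
    by (intro arr_ten arr_ident X p)
  have h: "arr ?I (X \<otimes>\<^sub>o P) ((ident C X \<otimes>\<^sub>m p) \<bullet> coev)"
    by (intro arr_cmp[OF coev] Xp)
  have "(ident C X \<otimes>\<^sub>m p) \<bullet> coev \<noteq> zerom C ?I (X \<otimes>\<^sub>o P)"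
  proof
    assume 0: "(ident C X \<otimes>\<^sub>m p) \<bullet> coev = zerom C ?I (X \<otimes>\<^sub>o P)"
    define G where "G = ident C X' \<otimes>\<^sub>m coev"
    define E where "E = ev \<otimes>\<^sub>m ident C X'"
    define F where "F = ident C X' \<otimes>\<^sub>m (ident C X \<otimes>\<^sub>m p)"
    define Ep where "Ep = ident C ?E \<otimes>\<^sub>m p"
    define EP where "EP = ev \<otimes>\<^sub>m ident C P"
    define Ip where "Ip = ident C ?I \<otimes>\<^sub>m p"
    have G: "arr (X' \<otimes>\<^sub>o ?I) (X' \<otimes>\<^sub>o (X \<otimes>\<^sub>o X')) G" unfolding G_def by (intro arr_ten arr_ident X' coev)
    have E: "arr (?E \<otimes>\<^sub>o X') (?I \<otimes>\<^sub>o X') E" unfolding E_def by (intro arr_ten arr_ident X' ev)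
    have F: "arr (X' \<otimes>\<^sub>o (X \<otimes>\<^sub>o X')) (X' \<otimes>\<^sub>o (X \<otimes>\<^sub>o P)) F" unfolding F_def by (intro arr_ten arr_ident X' Xp)
    have Ep: "arr (?E \<otimes>\<^sub>o X') (?E \<otimes>\<^sub>o P) Ep" unfolding Ep_def by (intro arr_ten arr_ident teno_in X X' p)
    have EP: "arr (?E \<otimes>\<^sub>o P) (?I \<otimes>\<^sub>o P) EP" unfolding EP_def by (intro arr_ten arr_ident P ev)
    have Ip: "arr (?I \<otimes>\<^sub>o X') (?I \<otimes>\<^sub>o P) Ip" unfolding Ip_def by (intro arr_ten arr_ident unit_in p)
    note b = arr_inverse_pair(2)[OF \<beta>] and c = arr_inverse_pair(2)[OF \<gamma>]
    note lX = arr_lunit[OF X'] and lP = arr_lunit[OF P]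
    have e1: "p \<bullet> lunit C X' = lunit C P \<bullet> Ip"
      using lunit_natural[OF X' P] p by (simp add: Ip_def arr_def)
    have e2: "Ip \<bullet> E = EP \<bullet> Ep"
      using ten_interchange[OF ev p(1)] by (simp add: Ip_def E_def EP_def Ep_def)
    have "assoc C X' X P \<bullet> Ep = F \<bullet> assoc C X' X X'"
      using assoc_nat[OF arr_ident[OF X'] arr_ident[OF X] p(1)] X X'
      by (simp add: Ep_def F_def tenm_ident)
    then have e3: "Ep \<bullet> \<beta> = \<gamma> \<bullet> F"
      by (rule inverse_square[OF \<beta> \<gamma> Ep F])
    have e4: "F \<bullet> G = zerom C (X' \<otimes>\<^sub>o ?I) (X' \<otimes>\<^sub>o (X \<otimes>\<^sub>o P))"
      unfolding F_def G_def ten_ident_cmp(1)[OF coev Xp X'] 0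
      using tenm_zerom_right[of "ident C X'" X' X' ?I "X \<otimes>\<^sub>o P"] X' X P unit_in teno_in by simp
    note bG = arr_cmp[OF G b]
    have "p \<bullet> runit C X' = p \<bullet> (lunit C X' \<bullet> (E \<bullet> (\<beta> \<bullet> G)))"
      unfolding zag[symmetric] E_def[symmetric] G_def[symmetric]
      using arr_cmp_assoc[OF bG E lX] arr_cmp_assoc[OF G b arr_cmp[OF E lX]] by simp
    also have "\<dots> = lunit C P \<bullet> (Ip \<bullet> (E \<bullet> (\<beta> \<bullet> G)))"
      by (rule square_extend[OF e1 arr_cmp[OF bG E] lX p(1) Ip lP])
    also have "Ip \<bullet> (E \<bullet> (\<beta> \<bullet> G)) = EP \<bullet> (Ep \<bullet> (\<beta> \<bullet> G))"
      by (rule square_extend[OF e2 bG E Ip Ep EP])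
    also have "Ep \<bullet> (\<beta> \<bullet> G) = \<gamma> \<bullet> (F \<bullet> G)"
      by (rule square_extend[OF e3 G b Ep F c])
    also have "lunit C P \<bullet> (EP \<bullet> (\<gamma> \<bullet> (F \<bullet> G))) = zerom C (X' \<otimes>\<^sub>o ?I) P"
      unfolding e4 using c EP lP G by (auto simp: arr_def)
    finally have pr: "p \<bullet> runit C X' = zerom C (X' \<otimes>\<^sub>o ?I) P" .
    obtain r where r: "inverse_pair C (X' \<otimes>\<^sub>o ?I) X' (runit C X') r"
      using runit_iso[OF X'] unfolding isomorphism_def by blast
    have "p = p \<bullet> runit C X' \<bullet> r"
      using inverse_pair_cancel_right[OF inverse_pair_sym[OF r] p(1)] by simp
    also have "\<dots> = zerom C X' P"
      unfolding pr using inverse_pairD[OF r] P by simp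
    finally show False
      using p(2) by simp
  qed
  then show ?thesis
    using h arrD(3) by blast
qed

lemma left_dual_coev_nonzero:
  assumes dual: "left_dual C X X'" and X: "\<not> zero_object C X"
  shows "\<exists>f\<in>Hom C (unito C) (X \<otimes>\<^sub>o X'). f \<noteq> zerom C (unito C) (X \<otimes>\<^sub>o X')"
proof -
  obtain ev coev where X: "X \<in> Obj C" "ident C X \<noteq> zerom C X X" and X': "X' \<in> Obj C"
    and ev: "arr (X' \<otimes>\<^sub>o X) (unito C) ev" and coev: "arr (unito C) (X \<otimes>\<^sub>o X') coev"
    and zig: "runit C X \<bullet> (ident C X \<otimes>\<^sub>m ev) \<bullet> assoc C X X' X \<bullet> (coev \<otimes>\<^sub>m ident C X) = lunit C X"
    using left_dualE[OF dual] X zero_object_iff by metis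
  let ?I = "unito C"
  have "coev \<noteq> zerom C ?I (X \<otimes>\<^sub>o X')"
  proof
    assume 0: "coev = zerom C ?I (X \<otimes>\<^sub>o X')"
    have 1: "coev \<otimes>\<^sub>m ident C X = zerom C (?I \<otimes>\<^sub>o X) (X \<otimes>\<^sub>o X' \<otimes>\<^sub>o X)"
      unfolding 0 using tenm_zerom_left[of "ident C X" X X ?I "X \<otimes>\<^sub>o X'"] X X' unit_in teno_in by simp
    have a: "arr (X \<otimes>\<^sub>o X' \<otimes>\<^sub>o X) X (runit C X \<bullet> (ident C X \<otimes>\<^sub>m ev) \<bullet> assoc C X X' X)"
      by (rule arr_cmp[OF arr_assoc arr_cmp[OF arr_ten[OF arr_ident ev] arr_runit]]) (rule X X')+
    have l0: "lunit C X = zerom C (?I \<otimes>\<^sub>o X) X"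
      unfolding zig[symmetric] 1 using a unit_in teno_in X by (auto simp: arr_def)
    obtain l where l: "inverse_pair C (?I \<otimes>\<^sub>o X) X (lunit C X) l"
      using lunit_iso[OF X(1)] unfolding isomorphism_def by blast
    show False
      using inverse_pairD[OF l] X l0 by simp
  qed
  then show ?thesis
    using coev arrD(3) by blast
qed

end


section \<open>Constituents and fusion subcategories\<close>

lemma fusion_subcategoryD:
  assumes "fusion_subcategory C E"
  shows "E \<subseteq> Obj C" "unito C \<in> E" "\<And>X Y. \<lbrakk>X \<in> E; Y \<in> E\<rbrakk> \<Longrightarrow> X \<otimes>\<^sub>o\<^bsub>C\<^esub> Y \<in> E"
    "\<And>W Xs. \<lbrakk>set Xs \<subseteq> E; direct_sum C W Xs\<rbrakk> \<Longrightarrow> W \<in> E"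
    "\<And>X Y i. \<lbrakk>X \<in> E; monic C Y X i\<rbrakk> \<Longrightarrow> Y \<in> E"
  using assms unfolding fusion_subcategory_def by blast+

lemma fusion_subcategory_Inter:
  assumes "\<D> \<noteq> {}" and \<D>: "\<And>D. D \<in> \<D> \<Longrightarrow> fusion_subcategory C D"
  shows "fusion_subcategory C (\<Inter>\<D>)"
  unfolding fusion_subcategory_def
proof (intro conjI ballI allI impI)
  note D = fusion_subcategoryD[OF \<D>]
  show "\<Inter>\<D> \<subseteq> Obj C"
    using assms(1) D(1) by blast
  show "unito C \<in> \<Inter>\<D>"
    using D(2) by blast
  show "X \<otimes>\<^sub>o\<^bsub>C\<^esub> Y \<in> \<Inter>\<D>" if "X \<in> \<Inter>\<D>" "Y \<in> \<Inter>\<D>" for X Y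
    using D(3) that by blast
  show "W \<in> \<Inter>\<D>" if "set Xs \<subseteq> \<Inter>\<D> \<and> direct_sum C W Xs" for W Xs
    using D(4)[of _ Xs W] that by blast
  show "Y \<in> \<Inter>\<D>" if "X \<in> \<Inter>\<D> \<and> monic C Y X i" for X Y i
    using D(5)[of _ X Y i] that by blast
qed

context fusion_category
begin

text \<open>
  Fusion subcategories are determined by the simple objects they contain, so membership is tested on
  these sets; multiplicities are forgotten where only their positivity matters.
\<close>

definition constituents :: "'o \<Rightarrow> 'o set" where
  "constituents W = {S. simple_object C S \<and> (\<exists>f\<in>Hom C S W. f \<noteq> zerom C S W)}"

lemma constituentsI:
  "\<lbrakk>simple_object C S; f \<in> Hom C S W; f \<noteq> zerom C S W\<rbrakk> \<Longrightarrow> S \<in> constituents W"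
  by (auto simp: constituents_def)

lemma constituents_simple: "S \<in> constituents W \<Longrightarrow> simple_object C S"
  by (simp add: constituents_def)

lemma constituents_obj: "S \<in> constituents W \<Longrightarrow> S \<in> Obj C"
  by (simp add: constituents_def simple_objectD)

lemma constituents_mult: "W \<in> Obj C \<Longrightarrow> constituents W = {S. simple_object C S \<and> 0 < mult S W}"
  using mult_pos_iff by (auto simp: constituents_def)

lemma constituents_monic: "\<lbrakk>S \<in> constituents W; W \<in> Obj C\<rbrakk> \<Longrightarrow> \<exists>f. monic C S W f"
  using simple_nonzero_monic by (auto simp: constituents_def)

lemma constituents_isomorphic: "isomorphic C W W' \<Longrightarrow> constituents W = constituents W'"
  using isomorphic_obj[of W W'] by (simp add: constituents_mult mult_isomorphic[of W W'])

lemma sum_nat_pos_iff: "finite A \<Longrightarrow> 0 < (\<Sum>a\<in>A. f a :: nat) \<longleftrightarrow> (\<exists>a\<in>A. 0 < f a)"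
  unfolding neq0_conv[symmetric] by simp

lemma constituents_biproduct:
  assumes "biproduct W I X \<iota> \<pi>"
  shows "constituents W = (\<Union>i\<in>I. constituents (X i))"
proof -
  have "S \<in> constituents W \<longleftrightarrow> (\<exists>i\<in>I. S \<in> constituents (X i))" for S
    using biproductD(1-3)[OF assms]
    by (auto simp: constituents_mult mult_biproduct[OF assms] sum_nat_pos_iff)
  then show ?thesis
    by blast
qed

lemma constituents_simple_self: "simple_object C S \<Longrightarrow> S \<in> constituents S"
  using simple_objectD constituentsI ident_in by blast

lemma constituents_subobject:
  assumes m: "monic C Y X i"
  shows "constituents Y \<subseteq> constituents X"
proof
  fix S assume S: "S \<in> constituents Y"
  then obtain f where f: "f \<in> Hom C S Y" "f \<noteq> zerom C S Y"
    by (auto simp: constituents_def)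
  have i: "Y \<in> Obj C" "X \<in> Obj C" "i \<in> Hom C Y X"
    using m by (auto simp: monic_def)
  have S': "S \<in> Obj C"
    using S by (rule constituents_obj)
  have "i \<bullet> f \<noteq> zerom C S X"
    using monic_zeroD[OF m S' f(1)] f(2) by blast
  then show "S \<in> constituents X"
    using constituents_simple[OF S] cmp_closed[OF f(1) i(3)] S' i constituentsI by blast
qed

lemma constituents_of_constituent:
  "\<lbrakk>S \<in> constituents W; W \<in> Obj C\<rbrakk> \<Longrightarrow> constituents S \<subseteq> constituents W"
  using constituents_monic constituents_subobject by blast

text \<open>Constituents are subobjects as well as quotients, since both kinds of maps split.\<close>

lemma constituents_quotient:
  assumes "simple_object C S" "W \<in> Obj C" "p \<in> Hom C W S" "p \<noteq> zerom C W S"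
  shows "S \<in> constituents W"
proof -
  obtain f where f: "f \<in> Hom C S W" "p \<bullet> f = ident C S"
    using nonzero_to_simple_split assms .
  then have "f \<noteq> zerom C S W"
    using simple_objectD[OF assms(1)] assms by auto
  then show ?thesis
    using f assms(1) constituentsI by blast
qed

lemma constituents_projection:
  assumes S: "S \<in> constituents W" and W: "W \<in> Obj C"
  shows "\<exists>p\<in>Hom C W S. p \<noteq> zerom C W S"
proof -
  obtain f where f: "f \<in> Hom C S W" "f \<noteq> zerom C S W"
    using S by (auto simp: constituents_def)
  obtain p where p: "p \<in> Hom C W S" "p \<bullet> f = ident C S"
    using nonzero_from_simple_split[OF constituents_simple[OF S] W f] .
  then have "p \<noteq> zerom C W S"
    using simple_objectD[OF constituents_simple[OF S]] W f by auto
  then show ?thesis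
    using p by blast
qed

lemma constituents_tensor_right:
  assumes "V \<in> Obj C" "W \<in> Obj C"
  shows "constituents (V \<otimes>\<^sub>o W) = (\<Union>r\<in>reps \<inter> constituents W. constituents (V \<otimes>\<^sub>o r))"
proof -
  have "S \<in> constituents (V \<otimes>\<^sub>o W) \<longleftrightarrow> (\<exists>r\<in>reps. r \<in> constituents W \<and> S \<in> constituents (V \<otimes>\<^sub>o r))"
    for S
    using reps_obj reps_simple assms
    by (auto simp: constituents_mult teno_in mult_tensor_right[OF assms] sum_nat_pos_iff[OF finite_reps])
  then show ?thesis
    by blast
qed

lemma constituents_tensor_left:
  assumes "V \<in> Obj C" "W \<in> Obj C"
  shows "constituents (W \<otimes>\<^sub>o V) = (\<Union>r\<in>reps \<inter> constituents W. constituents (r \<otimes>\<^sub>o V))"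
proof -
  have "S \<in> constituents (W \<otimes>\<^sub>o V) \<longleftrightarrow> (\<exists>r\<in>reps. r \<in> constituents W \<and> S \<in> constituents (r \<otimes>\<^sub>o V))"
    for S
    using reps_obj reps_simple assms
    by (auto simp: constituents_mult teno_in mult_tensor_left[OF assms] sum_nat_pos_iff[OF finite_reps])
  then show ?thesis
    by blast
qed

lemma constituents_tensor_mono:
  assumes "V \<in> Obj C" "W \<in> Obj C" "V' \<in> Obj C" "W' \<in> Obj C"
    and "constituents V \<subseteq> constituents V'" "constituents W \<subseteq> constituents W'"
  shows "constituents (V \<otimes>\<^sub>o W) \<subseteq> constituents (V' \<otimes>\<^sub>o W')"
proof -
  have "constituents (V \<otimes>\<^sub>o W) \<subseteq> constituents (V \<otimes>\<^sub>o W')"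
    using assms by (auto simp: constituents_tensor_right)
  also have "\<dots> \<subseteq> constituents (V' \<otimes>\<^sub>o W')"
    using assms by (auto simp: constituents_tensor_left)
  finally show ?thesis .
qed

lemma constituents_assoc:
  "\<lbrakk>X \<in> Obj C; Y \<in> Obj C; Z \<in> Obj C\<rbrakk>
    \<Longrightarrow> constituents (X \<otimes>\<^sub>o Y \<otimes>\<^sub>o Z) = constituents (X \<otimes>\<^sub>o (Y \<otimes>\<^sub>o Z))"
  using constituents_isomorphic isomorphic_assoc by blast

lemma constituents_unit_right: "X \<in> Obj C \<Longrightarrow> constituents (X \<otimes>\<^sub>o unito C) = constituents X"
  using constituents_isomorphic isomorphic_runit by blast

lemma fusion_subcategory_iff_constituents:
  assumes E: "fusion_subcategory C E" and W: "W \<in> Obj C"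
  shows "W \<in> E \<longleftrightarrow> constituents W \<subseteq> E"
proof
  assume "W \<in> E"
  then show "constituents W \<subseteq> E"
    using constituents_monic[OF _ W] fusion_subcategoryD(5)[OF E] by blast
next
  assume *: "constituents W \<subseteq> E"
  obtain Xs where Xs: "\<forall>Y\<in>set Xs. simple_object C Y" "direct_sum C W Xs"
    using semisimple W by blast
  obtain \<iota> \<pi> where B: "biproduct W {..<length Xs} (\<lambda>i. Xs ! i) \<iota> \<pi>"
    using direct_sum_biproduct Xs(2) .
  have "set Xs \<subseteq> constituents W"
    using constituents_biproduct[OF B] constituents_simple_self Xs(1)
    by (fastforce simp: in_set_conv_nth)
  then show "W \<in> E"
    using fusion_subcategoryD(4)[OF E _ Xs(2)] * by blast
qed

lemma fusion_subcategory_isomorphic: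
  assumes "fusion_subcategory C E" "X \<in> E" "isomorphic C X Y"
  shows "Y \<in> E"
  using assms fusion_subcategory_iff_constituents constituents_isomorphic isomorphic_obj by metis

lemma reciprocity:
  assumes dual: "left_dual C X X'" and W: "W \<in> constituents (X \<otimes>\<^sub>o Q)" and Q: "simple_object C Q"
  shows "Q \<in> constituents (X' \<otimes>\<^sub>o W)"
proof -
  have obj: "X \<in> Obj C" "X' \<in> Obj C" "Q \<in> Obj C" "W \<in> Obj C"
    using dual simple_objectD(1)[OF Q] constituents_obj[OF W] by (auto simp: left_dual_def)
  obtain f where "arr W (X \<otimes>\<^sub>o Q) f" "f \<noteq> zerom C W (X \<otimes>\<^sub>o Q)"
    using W obj teno_in by (auto simp: constituents_def arr_def)
  then obtain g where "g \<in> Hom C (X' \<otimes>\<^sub>o W) Q" "g \<noteq> zerom C (X' \<otimes>\<^sub>o W) Q"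
    using left_dual_reciprocity[OF dual obj(3)] by blast
  then show ?thesis
    using constituents_quotient[OF Q teno_in[OF obj(2,4)]] by blast
qed

lemma unit_constituent_dual:
  assumes dual: "left_dual C X X'" and P: "P \<in> constituents X'"
  shows "unito C \<in> constituents (X \<otimes>\<^sub>o P)"
proof -
  have obj: "X' \<in> Obj C" "P \<in> Obj C"
    using dual constituents_obj[OF P] by (auto simp: left_dual_def)
  obtain p where "arr X' P p" "p \<noteq> zerom C X' P"
    using constituents_projection[OF P obj(1)] obj by (auto simp: arr_def)
  then show ?thesis
    using left_dual_coev_quotient[OF dual] constituentsI[OF unit_simple] by blast
qed

end

section \<open>Fusion subcategories are closed under duals\<close>

locale commutative_fusion_category = fusion_category K C
  for K :: "'k ring" and C :: "('o, 'm, 'k) linear_monoidal" (structure) +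
  assumes commutative: "commutative_grothendieck_ring C"
begin

lemma constituents_commute:
  "\<lbrakk>X \<in> Obj C; Y \<in> Obj C\<rbrakk> \<Longrightarrow> constituents (X \<otimes>\<^sub>o Y) = constituents (Y \<otimes>\<^sub>o X)"
  using constituents_mult mult_tensor_commute[OF commutative] teno_in by auto

text \<open>
  Let \<open>T\<close> be the set of simple objects of \<open>E\<close>, and let \<open>u\<close> and \<open>v\<close> be the matrices of multiplication
  by \<open>X\<close> and by \<open>X*\<close>. They commute; compare the traces of the two products over the block \<open>T\<close>. As \<open>E\<close>
  is closed under multiplication by \<open>X\<close>, no entry of \<open>u\<close> leads from \<open>T\<close> to its complement, so one
  of the traces involves only entries inside \<open>T\<close>. These also occur in the other trace, whose
  remaining terms \<open>v Y Z * u Z Y\<close> with \<open>Y \<in> T\<close>, \<open>Z \<notin> T\<close> must therefore vanish. For \<open>Y = 1\<close> and a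
  constituent \<open>Z\<close> of \<open>X*\<close>, however, this term is positive, by the coevaluation. (For matrices that
  are transposes of each other, this is the fact that a normal block triangular matrix is block
  diagonal.)
\<close>

lemma fusion_subcategory_left_dual:
  assumes E: "fusion_subcategory C E" and X: "X \<in> E" and dual: "left_dual C X X'"
  shows "X' \<in> E"
proof (rule ccontr)
  assume "X' \<notin> E"
  note E' = fusion_subcategoryD[OF E]
  have obj: "X \<in> Obj C" "X' \<in> Obj C"
    using dual by (auto simp: left_dual_def)
  obtain P where P: "P \<in> constituents X'" "P \<notin> E"
    using fusion_subcategory_iff_constituents[OF E obj(2)] \<open>X' \<notin> E\<close> by blast
  let ?T = "reps \<inter> E"
  define u where "u Y Z = mult Z (X \<otimes>\<^sub>o Y)" for Y Z
  define v where "v Y Z = mult Z (X' \<otimes>\<^sub>o Y)" for Y Z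
  have swap: "(\<Sum>Z\<in>reps. u Y Z * v Z Y) = (\<Sum>Z\<in>reps. v Y Z * u Z Y)" if Y: "Y \<in> reps" for Y
  proof -
    have Y': "Y \<in> Obj C" "simple_object C Y"
      using Y reps_obj reps_simple by auto
    have "(\<Sum>Z\<in>reps. u Y Z * v Z Y) = mult Y (X' \<otimes>\<^sub>o (X \<otimes>\<^sub>o Y))"
      unfolding u_def v_def using mult_tensor_right[of X' "X \<otimes>\<^sub>o Y" Y] obj Y' teno_in by simp
    also have "\<dots> = mult Y (X' \<otimes>\<^sub>o X \<otimes>\<^sub>o Y)"
      using mult_isomorphic[OF isomorphic_assoc] obj Y' by simp
    also have "\<dots> = (\<Sum>r\<in>reps. mult r (X' \<otimes>\<^sub>o X) * mult Y (r \<otimes>\<^sub>o Y))"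
      using mult_tensor_left[of Y "X' \<otimes>\<^sub>o X" Y] obj Y' teno_in by simp
    also have "\<dots> = (\<Sum>r\<in>reps. mult r (X \<otimes>\<^sub>o X') * mult Y (r \<otimes>\<^sub>o Y))"
      using mult_tensor_commute[OF commutative _ obj] reps_simple by (simp cong: sum.cong)
    also have "\<dots> = mult Y (X \<otimes>\<^sub>o X' \<otimes>\<^sub>o Y)"
      using mult_tensor_left[of Y "X \<otimes>\<^sub>o X'" Y] obj Y' teno_in by simp
    also have "\<dots> = mult Y (X \<otimes>\<^sub>o (X' \<otimes>\<^sub>o Y))"
      using mult_isomorphic[OF isomorphic_assoc] obj Y' by simp
    also have "\<dots> = (\<Sum>Z\<in>reps. v Y Z * u Z Y)"
      unfolding u_def v_def using mult_tensor_right[of X "X' \<otimes>\<^sub>o Y" Y] obj Y' teno_in by simp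
    finally show ?thesis .
  qed
  have u0: "u Y Z = 0" if "Y \<in> ?T" "Z \<in> reps - E" for Y Z
  proof (rule ccontr)
    assume "u Y Z \<noteq> 0"
    then have "Z \<in> constituents (X \<otimes>\<^sub>o Y)"
      using that obj teno_in reps_obj reps_simple by (simp add: u_def constituents_mult)
    moreover have "X \<otimes>\<^sub>o Y \<in> E"
      using E'(3) X that by blast
    ultimately show False
      using that fusion_subcategory_iff_constituents[OF E] E'(1) by blast
  qed
  have split: "sum f reps = sum f ?T + sum f (reps - E)" for f :: "'o \<Rightarrow> nat"
    by (rule sum.Int_Diff[OF finite_reps])
  have "(\<Sum>Y\<in>?T. \<Sum>Z\<in>?T. u Y Z * v Z Y) = (\<Sum>Y\<in>?T. \<Sum>Z\<in>reps. u Y Z * v Z Y)"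
    unfolding split using u0 by (intro sum.cong) simp_all
  also have "\<dots> = (\<Sum>Y\<in>?T. \<Sum>Z\<in>reps. v Y Z * u Z Y)"
    by (rule sum.cong[OF refl]) (rule swap, simp)
  also have "\<dots> = (\<Sum>Y\<in>?T. \<Sum>Z\<in>?T. v Y Z * u Z Y) + (\<Sum>Y\<in>?T. \<Sum>Z\<in>reps - E. v Y Z * u Z Y)"
    unfolding split by (rule sum.distrib)
  also have "(\<Sum>Y\<in>?T. \<Sum>Z\<in>?T. v Y Z * u Z Y) = (\<Sum>Y\<in>?T. \<Sum>Z\<in>?T. u Y Z * v Z Y)"
    by (subst sum.swap) (simp add: mult.commute)
  finally have "(\<Sum>Y\<in>?T. \<Sum>Z\<in>reps - E. v Y Z * u Z Y) = 0"
    by simp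
  then have vu: "v Y Z * u Z Y = 0" if "Y \<in> ?T" "Z \<in> reps - E" for Y Z
    using that finite_reps by simp
  have one: "unito C \<in> Obj C" "simple_object C (unito C)"
    using unit_in unit_simple by auto
  have P': "P \<in> Obj C" "simple_object C P"
    using P constituents_obj constituents_simple by auto
  note iso1 = rep_isomorphic[OF one(1)] and isoP = rep_isomorphic[OF P'(1)]
  have "rep (unito C) \<in> ?T"
    using fusion_subcategory_isomorphic[OF E E'(2) iso1] one by (auto simp: reps_def)
  moreover have "rep P \<in> reps - E"
    using fusion_subcategory_isomorphic[OF E _ isomorphic_sym[OF isoP]] P P' by (auto simp: reps_def)
  moreover have "rep P \<in> constituents (X' \<otimes>\<^sub>o rep (unito C))"
  proof -
    have "constituents (X' \<otimes>\<^sub>o rep (unito C)) = constituents X'"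
      using constituents_isomorphic isomorphic_tensor[OF isomorphic_refl[OF obj(2)] iso1]
        constituents_unit_right[OF obj(2)] by metis
    moreover have "rep P \<in> constituents P"
      using constituents_isomorphic[OF isoP] constituents_simple_self
        simple_object_isomorphic[OF P'(2) isoP] by simp
    ultimately show ?thesis
      using constituents_of_constituent[OF P(1) obj(2)] by blast
  qed
  moreover have "rep (unito C) \<in> constituents (X \<otimes>\<^sub>o rep P)"
  proof -
    have "constituents (X \<otimes>\<^sub>o rep P) = constituents (X \<otimes>\<^sub>o P)"
      using constituents_isomorphic isomorphic_tensor[OF isomorphic_refl[OF obj(1)] isoP] by blast
    moreover have "rep (unito C) \<in> constituents (unito C)"
      using constituents_isomorphic[OF iso1] constituents_simple_self
        simple_object_isomorphic[OF one(2) iso1] by simp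
    ultimately show ?thesis
      using constituents_of_constituent[OF unit_constituent_dual[OF dual P(1)]] teno_in obj P' by blast
  qed
  ultimately have "0 < v (rep (unito C)) (rep P)" "0 < u (rep P) (rep (unito C))"
    using constituents_mult teno_in obj reps_obj by (auto simp: u_def v_def)
  then show False
    using vu[of "rep (unito C)" "rep P"] \<open>rep (unito C) \<in> ?T\<close> \<open>rep P \<in> reps - E\<close> by simp
qed

section \<open>The commutator of a fusion subcategory\<close>

text \<open>
  All left duals are quantified over, so that no choice of duals has to be made. The condition is
  imposed on constituents because \<open>Z \<otimes> Z* \<in> E\<close> is not inherited by direct sums.
\<close>

definition commutator :: "'o set \<Rightarrow> 'o set" where
  "commutator E = {W \<in> Obj C. \<forall>Z\<in>constituents W. \<forall>Z'. left_dual C Z Z' \<longrightarrow> Z \<otimes>\<^sub>o Z' \<in> E}"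

text \<open>
  In effect \<open>Z*\<close> is contained in \<open>(X \<otimes> Y)* = Y* \<otimes> X*\<close>, and commutativity allows the rearrangement of
  \<open>X \<otimes> Y \<otimes> Y* \<otimes> X*\<close>. To avoid the construction of a dual of \<open>X \<otimes> Y\<close>, each constituent \<open>P\<close> of \<open>Z*\<close>
  is located by two applications of reciprocity, starting from the coevaluation of \<open>Z\<close>, which shows
  \<open>1\<close> to be a constituent of \<open>X \<otimes> (Y \<otimes> P)\<close>.
\<close>

lemma tensor_dual_constituents:
  assumes X: "left_dual C X X'" and Y: "left_dual C Y Y'" and Z: "left_dual C Z Z'"
    and ZXY: "Z \<in> constituents (X \<otimes>\<^sub>o Y)"
  shows "constituents (Z \<otimes>\<^sub>o Z') \<subseteq> constituents (X \<otimes>\<^sub>o X' \<otimes>\<^sub>o (Y \<otimes>\<^sub>o Y'))"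
proof -
  let ?I = "unito C"
  have obj: "X \<in> Obj C" "X' \<in> Obj C" "Y \<in> Obj C" "Y' \<in> Obj C" "Z \<in> Obj C" "Z' \<in> Obj C"
    using X Y Z by (auto simp: left_dual_def)
  note [intro!] = teno_in and [intro] = unit_in obj
  have dual: "constituents Z' \<subseteq> constituents (Y' \<otimes>\<^sub>o X')"
  proof
    fix P assume P: "P \<in> constituents Z'"
    have P': "P \<in> Obj C" "simple_object C P"
      using P constituents_obj constituents_simple by auto
    have "?I \<in> constituents (Z \<otimes>\<^sub>o P)"
      using unit_constituent_dual[OF Z P] .
    also have "\<dots> \<subseteq> constituents (X \<otimes>\<^sub>o Y \<otimes>\<^sub>o P)"
      using P' constituents_of_constituent[OF ZXY] by (intro constituents_tensor_mono) auto
    also have "\<dots> = constituents (X \<otimes>\<^sub>o (Y \<otimes>\<^sub>o P))"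
      using P' constituents_assoc by auto
    also have "\<dots> = (\<Union>Q\<in>reps \<inter> constituents (Y \<otimes>\<^sub>o P). constituents (X \<otimes>\<^sub>o Q))"
      using P' by (intro constituents_tensor_right) auto
    finally obtain Q where Q: "Q \<in> constituents (Y \<otimes>\<^sub>o P)" "?I \<in> constituents (X \<otimes>\<^sub>o Q)"
      by blast
    have Q': "Q \<in> Obj C" "simple_object C Q"
      using Q constituents_obj constituents_simple by auto
    have "Q \<in> constituents X'"
      using reciprocity[OF X Q(2) Q'(2)] constituents_unit_right obj by simp
    then have "constituents (Y' \<otimes>\<^sub>o Q) \<subseteq> constituents (Y' \<otimes>\<^sub>o X')"
      using Q' constituents_of_constituent by (intro constituents_tensor_mono) auto
    then show "P \<in> constituents (Y' \<otimes>\<^sub>o X')"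
      using reciprocity[OF Y Q(1) P'(2)] by blast
  qed
  have "constituents (Z \<otimes>\<^sub>o Z') \<subseteq> constituents (X \<otimes>\<^sub>o Y \<otimes>\<^sub>o (Y' \<otimes>\<^sub>o X'))"
    using dual constituents_of_constituent[OF ZXY] by (intro constituents_tensor_mono) auto
  also have "\<dots> = constituents (X \<otimes>\<^sub>o (Y \<otimes>\<^sub>o (Y' \<otimes>\<^sub>o X')))"
    by (rule constituents_assoc) auto
  also have "\<dots> \<subseteq> constituents (X \<otimes>\<^sub>o (X' \<otimes>\<^sub>o (Y \<otimes>\<^sub>o Y')))"
  proof (rule constituents_tensor_mono)
    have "constituents (Y \<otimes>\<^sub>o (Y' \<otimes>\<^sub>o X')) = constituents (Y \<otimes>\<^sub>o Y' \<otimes>\<^sub>o X')"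
      by (rule constituents_assoc[symmetric]) auto
    also have "\<dots> = constituents (X' \<otimes>\<^sub>o (Y \<otimes>\<^sub>o Y'))"
      by (rule constituents_commute) auto
    finally show "constituents (Y \<otimes>\<^sub>o (Y' \<otimes>\<^sub>o X')) \<subseteq> constituents (X' \<otimes>\<^sub>o (Y \<otimes>\<^sub>o Y'))"
      by simp
  qed auto
  also have "\<dots> = constituents (X \<otimes>\<^sub>o X' \<otimes>\<^sub>o (Y \<otimes>\<^sub>o Y'))"
    by (rule constituents_assoc[symmetric]) auto
  finally show ?thesis .
qed

text \<open>Here the closure of \<open>E\<close> under duals is indispensable.\<close>

lemma subset_commutator:
  assumes E: "fusion_subcategory C E"
  shows "E \<subseteq> commutator E"
proof
  fix W assume W: "W \<in> E"
  note E' = fusion_subcategoryD[OF E]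
  have "Z \<otimes>\<^sub>o Z' \<in> E" if "Z \<in> constituents W" "left_dual C Z Z'" for Z Z'
    using that W E' fusion_subcategory_iff_constituents[OF E, of W]
      fusion_subcategory_left_dual[OF E] by blast
  then show "W \<in> commutator E"
    using W E' by (auto simp: commutator_def)
qed

lemma fusion_subcategory_commutator:
  assumes E: "fusion_subcategory C E"
  shows "fusion_subcategory C (commutator E)"
  unfolding fusion_subcategory_def
proof (intro conjI ballI allI impI)
  note E' = fusion_subcategoryD[OF E]
  show "commutator E \<subseteq> Obj C"
    by (auto simp: commutator_def)
  show "unito C \<in> commutator E"
    using E'(2) subset_commutator[OF E] by blast
  fix X Y assume XY: "X \<in> commutator E" "Y \<in> commutator E"
  then have obj: "X \<in> Obj C" "Y \<in> Obj C"
    by (auto simp: commutator_def)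
  have "Z \<otimes>\<^sub>o Z' \<in> E" if Z: "Z \<in> constituents (X \<otimes>\<^sub>o Y)" "left_dual C Z Z'" for Z Z'
  proof -
    obtain q where q: "q \<in> constituents Y" "Z \<in> constituents (X \<otimes>\<^sub>o q)"
      using Z(1) constituents_tensor_right[OF obj] by blast
    then have q': "q \<in> Obj C"
      using constituents_obj by blast
    then obtain r where r: "r \<in> constituents X" "Z \<in> constituents (r \<otimes>\<^sub>o q)"
      using q(2) constituents_tensor_left[OF q' obj(1)] by blast
    obtain q1 r1 where dual: "left_dual C q q1" "left_dual C r r1"
      using rigid q' r constituents_obj by blast
    then have "q \<otimes>\<^sub>o q1 \<in> E" "r \<otimes>\<^sub>o r1 \<in> E"
      using XY q r by (auto simp: commutator_def)
    then have "r \<otimes>\<^sub>o r1 \<otimes>\<^sub>o (q \<otimes>\<^sub>o q1) \<in> E"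
      using E'(3) by blast
    then have "constituents (r \<otimes>\<^sub>o r1 \<otimes>\<^sub>o (q \<otimes>\<^sub>o q1)) \<subseteq> E"
      using fusion_subcategory_iff_constituents[OF E] E'(1) by blast
    then have "constituents (Z \<otimes>\<^sub>o Z') \<subseteq> E"
      using tensor_dual_constituents[OF dual(2,1) Z(2) r(2)] by blast
    moreover have "Z \<otimes>\<^sub>o Z' \<in> Obj C"
      using Z(2) teno_in by (auto simp: left_dual_def)
    ultimately show ?thesis
      using fusion_subcategory_iff_constituents[OF E] by blast
  qed
  then show "X \<otimes>\<^sub>o Y \<in> commutator E"
    using obj teno_in by (auto simp: commutator_def)
next
  fix W Xs assume *: "set Xs \<subseteq> commutator E \<and> direct_sum C W Xs"
  then obtain \<iota> \<pi> where B: "biproduct W {..<length Xs} (\<lambda>i. Xs ! i) \<iota> \<pi>"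
    using direct_sum_biproduct by blast
  have "Xs ! i \<in> commutator E" if "i < length Xs" for i
    using * that nth_mem by blast
  then show "W \<in> commutator E"
    using biproductD(2)[OF B] by (auto simp: commutator_def constituents_biproduct[OF B])
next
  fix X Y i assume *: "X \<in> commutator E \<and> monic C Y X i"
  then have "constituents Y \<subseteq> constituents X" "Y \<in> Obj C"
    using constituents_subobject by (auto simp: monic_def)
  then show "Y \<in> commutator E"
    using * by (auto simp: commutator_def)
qed

section \<open>The adjoint series\<close>

lemma full_subcat_simps [simp]:
  "Obj (full_subcat C A) = A" "Hom (full_subcat C A) = Hom C" "ident (full_subcat C A) = ident C"
  "cmp (full_subcat C A) = cmp C" "zerom (full_subcat C A) = zerom C"
  "unito (full_subcat C A) = unito C" "teno (full_subcat C A) = teno C"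
  "tenm (full_subcat C A) = tenm C" "assoc (full_subcat C A) = assoc C"
  "lunit (full_subcat C A) = lunit C" "runit (full_subcat C A) = runit C"
  "hom_module (full_subcat C A) X Y = hom_module C X Y"
  by (simp_all add: full_subcat_def hom_module_def)

lemma inverse_pair_full_subcat:
  "A \<subseteq> Obj C \<Longrightarrow> inverse_pair (full_subcat C A) X Y f g \<longleftrightarrow> X \<in> A \<and> Y \<in> A \<and> inverse_pair C X Y f g"
  by (auto simp: inverse_pair_def)

lemma direct_sum_full_subcat:
  "A \<subseteq> Obj C \<Longrightarrow>
    direct_sum (full_subcat C A) W Xs \<longleftrightarrow> W \<in> A \<and> set Xs \<subseteq> A \<and> direct_sum C W Xs"
  unfolding direct_sum_def full_subcat_simps by blast

lemma monic_full_subcat: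
  "\<lbrakk>A \<subseteq> Obj C; X \<in> A; Y \<in> A; monic C X Y f\<rbrakk> \<Longrightarrow> monic (full_subcat C A) X Y f"
  unfolding monic_def full_subcat_simps by blast

lemma fusion_subcategory_full_subcat:
  assumes A: "fusion_subcategory C A" and B: "fusion_subcategory (full_subcat C A) B"
  shows "fusion_subcategory C B"
proof -
  note A' = fusion_subcategoryD[OF A]
  have BA: "B \<subseteq> A" and unit: "unito C \<in> B" and ten: "\<forall>X\<in>B. \<forall>Y\<in>B. X \<otimes>\<^sub>o Y \<in> B"
    and sums: "\<And>W Xs. \<lbrakk>set Xs \<subseteq> B; direct_sum (full_subcat C A) W Xs\<rbrakk> \<Longrightarrow> W \<in> B"
    and subs: "\<And>X Y i. \<lbrakk>X \<in> B; monic (full_subcat C A) Y X i\<rbrakk> \<Longrightarrow> Y \<in> B"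
    using B unfolding fusion_subcategory_def full_subcat_simps by blast+
  have "W \<in> B" if "set Xs \<subseteq> B" "direct_sum C W Xs" for W Xs
  proof -
    have "W \<in> A"
      using A'(4) that BA by blast
    then have "direct_sum (full_subcat C A) W Xs"
      using that BA direct_sum_full_subcat[OF A'(1)] by blast
    then show ?thesis
      using sums that by blast
  qed
  moreover have "Y \<in> B" if "X \<in> B" "monic C Y X i" for X Y i
  proof -
    have "Y \<in> A" "X \<in> A"
      using A'(5) that BA by blast+
    then have "monic (full_subcat C A) Y X i"
      using that A'(1) monic_full_subcat by blast
    then show ?thesis
      using subs that by blast
  qed
  ultimately show ?thesis
    unfolding fusion_subcategory_def using BA A'(1) unit ten by blast
qed

lemma fusion_subcategory_self_full_subcat:
  assumes A: "fusion_subcategory C A"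
  shows "fusion_subcategory (full_subcat C A) A"
proof -
  note A' = fusion_subcategoryD[OF A]
  have "Y \<in> A" if "monic (full_subcat C A) Y X i" for X Y i
    using that by (simp add: monic_def)
  then show ?thesis
    unfolding fusion_subcategory_def full_subcat_simps direct_sum_full_subcat[OF A'(1)]
    using A'(2,3) by blast
qed

lemma left_dual_full_subcat:
  assumes A: "fusion_subcategory C A"
  shows "left_dual (full_subcat C A) X X' \<longleftrightarrow> X \<in> A \<and> X' \<in> A \<and> left_dual C X X'"
proof -
  note A' = fusion_subcategoryD[OF A]
  show ?thesis
  proof (cases "X \<in> A \<and> X' \<in> A")
    case True
    then have mem: "X' \<otimes>\<^sub>o X \<otimes>\<^sub>o X' \<in> A" "X' \<otimes>\<^sub>o (X \<otimes>\<^sub>o X') \<in> A"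
      using A'(3) by blast+
    have eq: "inverse_mor (full_subcat C A) (X' \<otimes>\<^sub>o X \<otimes>\<^sub>o X') (X' \<otimes>\<^sub>o (X \<otimes>\<^sub>o X')) f
        = inverse_mor C (X' \<otimes>\<^sub>o X \<otimes>\<^sub>o X') (X' \<otimes>\<^sub>o (X \<otimes>\<^sub>o X')) f" for f
      using mem inverse_pair_full_subcat[OF A'(1)] by (simp add: inverse_mor_def)
    show ?thesis
      unfolding left_dual_def full_subcat_simps eq using True A'(1) by blast
  next
    case False
    then show ?thesis
      unfolding left_dual_def full_subcat_simps by blast
  qed
qed

lemma fusion_subcategory_adjoint:
  assumes A: "fusion_subcategory C A"
  shows "fusion_subcategory C (adjoint_subcategory (full_subcat C A))"
proof (rule fusion_subcategory_full_subcat[OF A])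
  let ?S = "{X \<otimes>\<^sub>o X' | X X'. simple_object (full_subcat C A) X \<and> left_dual (full_subcat C A) X X'}"
  have "?S \<subseteq> A"
    using fusion_subcategoryD(3)[OF A] left_dual_full_subcat[OF A] by auto
  then have "A \<in> {D. fusion_subcategory (full_subcat C A) D \<and> ?S \<subseteq> D}"
    using fusion_subcategory_self_full_subcat[OF A] by blast
  then show "fusion_subcategory (full_subcat C A) (adjoint_subcategory (full_subcat C A))"
    unfolding adjoint_subcategory_def generated_fusion_subcategory_def full_subcat_simps
    by (intro fusion_subcategory_Inter) blast+
qed

lemma fusion_subcategory_Obj: "fusion_subcategory C (Obj C)"
  unfolding fusion_subcategory_def direct_sum_def monic_def using unit_in teno_in by blast

lemma fusion_subcategory_adjoint_series: "fusion_subcategory C (adjoint_series C n)"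
  by (induction n) (simp_all add: fusion_subcategory_Obj fusion_subcategory_adjoint)

text \<open>
  A monomorphism of the full subcategory is one of the whole category, because its kernel is a
  subobject of an object of \<open>A\<close> and so lies in \<open>A\<close>.
\<close>

lemma simple_object_full_subcat:
  assumes A: "fusion_subcategory C A" and S: "simple_object C S" "S \<in> A"
  shows "simple_object (full_subcat C A) S"
proof -
  note A' = fusion_subcategoryD[OF A]
  have "\<not> zero_object (full_subcat C A) S"
  proof
    assume "zero_object (full_subcat C A) S"
    then have "\<exists>!f. f \<in> Hom C S S"
      using S by (auto simp: zero_object_def)
    then show False
      using simple_objectD[OF S(1)] ident_in zerom_in by blast
  qed
  moreover have "zero_object (full_subcat C A) Y \<or> isomorphism (full_subcat C A) Y S i"
    if m: "monic (full_subcat C A) Y S i" for Y i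
  proof -
    have i: "Y \<in> A" "i \<in> Hom C Y S"
      using m by (auto simp: monic_def)
    have obj: "Y \<in> Obj C" "S \<in> Obj C"
      using i S A'(1) by auto
    obtain N k where ker: "is_kernel C Y S i N k" and k: "monic C N Y k"
      using kernel_exists[OF obj i(2)] .
    have N: "N \<in> A"
      using A'(5) i k by blast
    have k': "N \<in> Obj C" "k \<in> Hom C N Y" "i \<bullet> k = zerom C N S"
      using ker by (auto simp: is_kernel_def)
    then have "i \<bullet> k = i \<bullet> zerom C N Y"
      using i obj by simp
    then have k0: "k = zerom C N Y"
      using m N k' obj unfolding monic_def by auto
    have "monic C Y S i"
    proof (rule monicI[OF obj i(2)])
      fix W g assume g: "W \<in> Obj C" "g \<in> Hom C W Y" "i \<bullet> g = zerom C W S"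
      then obtain h where "h \<in> Hom C W N" "k \<bullet> h = g"
        using ker unfolding is_kernel_def by blast
      then show "g = zerom C W Y"
        using k0 k' g obj by auto
    qed
    then have "zero_object C Y \<or> isomorphism C Y S i"
      using S unfolding simple_object_def by blast
    then show ?thesis
    proof
      assume "zero_object C Y"
      then show ?thesis
        unfolding zero_object_def full_subcat_simps using i A'(1) by blast
    next
      assume "isomorphism C Y S i"
      then show ?thesis
        using i S inverse_pair_full_subcat[OF A'(1)] by (simp add: isomorphism_def)
    qed
  qed
  ultimately show ?thesis
    using S by (simp add: simple_object_def)
qed

text \<open>
  The generators of the adjoint subcategory of \<open>A\<close> are formed with simple objects and duals of \<open>A\<close>
  itself. A constituent in the ambient category is simple in \<open>A\<close>, and its dual lies in \<open>A\<close>.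
\<close>

lemma adjoint_le_imp_le_commutator:
  assumes A: "fusion_subcategory C A" and AE: "adjoint_subcategory (full_subcat C A) \<subseteq> E"
  shows "A \<subseteq> commutator E"
proof
  fix W assume W: "W \<in> A"
  note A' = fusion_subcategoryD[OF A]
  have "Z \<otimes>\<^sub>o Z' \<in> E" if Z: "Z \<in> constituents W" "left_dual C Z Z'" for Z Z'
  proof -
    have "Z \<in> A"
      using Z(1) W fusion_subcategory_iff_constituents[OF A] A'(1) by blast
    then have "simple_object (full_subcat C A) Z" "left_dual (full_subcat C A) Z Z'"
      using simple_object_full_subcat[OF A] constituents_simple Z
        fusion_subcategory_left_dual[OF A] left_dual_full_subcat[OF A] by auto
    then have "Z \<otimes>\<^sub>o Z' \<in> adjoint_subcategory (full_subcat C A)"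
      unfolding adjoint_subcategory_def generated_fusion_subcategory_def full_subcat_simps by blast
    then show ?thesis
      using AE by blast
  qed
  then show "W \<in> commutator E"
    using W A'(1) by (auto simp: commutator_def)
qed

lemma commutator_eq_Obj_imp_adjoint_le:
  assumes E: "fusion_subcategory C E" and eq: "commutator E = Obj C"
  shows "adjoint_subcategory C \<subseteq> E"
proof -
  have "X \<otimes>\<^sub>o X' \<in> E" if X: "simple_object C X" "left_dual C X X'" for X X'
  proof -
    have "X \<in> commutator E"
      using eq X simple_objectD by blast
    then show ?thesis
      using constituents_simple_self X by (auto simp: commutator_def)
  qed
  then show ?thesis
    unfolding adjoint_subcategory_def generated_fusion_subcategory_def using E by blast
qed

lemma adjoint_le_meets_components_imp_eq:
  assumes U: "universal_grading C U Cg" and E: "fusion_subcategory C E"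
    and ad: "adjoint_subcategory C \<subseteq> E"
    and meets: "\<forall>g\<in>carrier U. \<exists>Y\<in>E \<inter> Cg g. \<not> zero_object C Y"
  shows "E = Obj C"
proof -
  note E' = fusion_subcategoryD[OF E]
  have gr: "grading C U Cg" and one: "Cg \<one>\<^bsub>U\<^esub> = adjoint_subcategory C"
    using U by (auto simp: universal_grading_def faithful_grading_def)
  have grp: "group U"
    using gr by (simp add: grading_def)
  have sub: "full_abelian_subcategory C (Cg g)" if "g \<in> carrier U" for g
    using gr that by (simp add: grading_def)
  have dec: "\<exists>Xs. set Xs \<subseteq> (\<Union>g\<in>carrier U. Cg g) \<and> direct_sum C X Xs" if "X \<in> Obj C" for X
    using gr that by (simp add: grading_def)
  have inv: "{X'. \<exists>X\<in>Cg g. left_dual C X X'} = Cg (inv\<^bsub>U\<^esub> g)" if "g \<in> carrier U" for g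
    using gr that by (simp add: grading_def)
  have ten: "X \<otimes>\<^sub>o Y \<in> Cg (g \<otimes>\<^bsub>U\<^esub> h)"
    if "g \<in> carrier U" "h \<in> carrier U" "X \<in> Cg g" "Y \<in> Cg h" for g h X Y
    using gr that by (simp add: grading_def)
  interpret U: group U by (rule grp)
  have comp: "X \<in> E" if g: "g \<in> carrier U" and X: "X \<in> Cg g" for g X
  proof -
    obtain Y where Y: "Y \<in> E" "Y \<in> Cg g" "\<not> zero_object C Y"
      using meets g by blast
    have obj: "X \<in> Obj C" "Y \<in> Obj C"
      using X Y sub[OF g] by (auto simp: full_abelian_subcategory_def)
    obtain Y' where dual: "left_dual C Y Y'"
      using rigid obj by blast
    then have Y': "Y' \<in> Obj C" "Y' \<in> Cg (inv\<^bsub>U\<^esub> g)"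
      using inv[OF g] Y by (auto simp: left_dual_def)
    have "X \<otimes>\<^sub>o Y' \<in> Cg (g \<otimes>\<^bsub>U\<^esub> inv\<^bsub>U\<^esub> g)"
      using g X Y'(2) by (intro ten) auto
    then have "X \<otimes>\<^sub>o Y' \<in> E"
      using g one ad by auto
    then have *: "constituents (X \<otimes>\<^sub>o Y' \<otimes>\<^sub>o Y) \<subseteq> E"
      using E'(1,3) Y(1) fusion_subcategory_iff_constituents[OF E] by blast
    have "unito C \<in> constituents (Y \<otimes>\<^sub>o Y')"
      using left_dual_coev_nonzero[OF dual Y(3)] constituentsI[OF unit_simple] by blast
    then have "constituents (unito C) \<subseteq> constituents (Y' \<otimes>\<^sub>o Y)"
      using constituents_commute[OF obj(2) Y'(1)] constituents_of_constituent teno_in obj Y' by blast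
    then have "constituents (X \<otimes>\<^sub>o unito C) \<subseteq> constituents (X \<otimes>\<^sub>o (Y' \<otimes>\<^sub>o Y))"
      using obj Y' unit_in teno_in by (intro constituents_tensor_mono) auto
    then have "constituents X \<subseteq> E"
      using * constituents_assoc[OF obj(1) Y'(1) obj(2)] constituents_unit_right[OF obj(1)] by blast
    then show ?thesis
      using fusion_subcategory_iff_constituents[OF E obj(1)] by blast
  qed
  have "X \<in> E" if "X \<in> Obj C" for X
    using dec[OF that] comp E'(4) by blast
  then show ?thesis
    using E'(1) by blast
qed

lemma adjoint_series_le_imp_eq:
  assumes U: "universal_grading C U Cg"
    and "fusion_subcategory C E" "adjoint_series C n \<subseteq> E"
    and "\<forall>g\<in>carrier U. \<exists>Y\<in>E \<inter> Cg g. \<not> zero_object C Y"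
  shows "E = Obj C"
  using assms(2-)
proof (induction n arbitrary: E)
  case 0
  then show ?case
    using fusion_subcategoryD(1)[OF 0(1)] by simp
next
  case (Suc n)
  have "adjoint_series C n \<subseteq> commutator E"
    using adjoint_le_imp_le_commutator[OF fusion_subcategory_adjoint_series] Suc.prems(2) by simp
  moreover have "\<forall>g\<in>carrier U. \<exists>Y\<in>commutator E \<inter> Cg g. \<not> zero_object C Y"
    using Suc.prems(3) subset_commutator[OF Suc.prems(1)] by blast
  ultimately have "commutator E = Obj C"
    using Suc.IH fusion_subcategory_commutator[OF Suc.prems(1)] by blast
  then show ?case
    using adjoint_le_meets_components_imp_eq[OF U Suc.prems(1) _ Suc.prems(3)]
      commutator_eq_Obj_imp_adjoint_le[OF Suc.prems(1)] by blast
qed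

end

theorem theorem2p1:
  fixes K :: "'k ring" and C :: "('o, 'm, 'k) linear_monoidal"
    and U :: "'u monoid" and Cg :: "'u \<Rightarrow> 'o set" and D :: "'o set"
  assumes "algebraically_closed K"
    and "\<forall>n::nat. n > 0 \<longrightarrow> [n] \<cdot>\<^bsub>K\<^esub> \<one>\<^bsub>K\<^esub> \<noteq> \<zero>\<^bsub>K\<^esub>"
    and "fusion_category K C"
    and "nilpotent_category C"
    and "commutative_grothendieck_ring C"
    and "universal_grading C U Cg"
    and "fusion_subcategory C D"
    and "\<forall>g \<in> carrier U. \<exists>Y \<in> D \<inter> Cg g. \<not> zero_object C Y"
  shows "D = Obj C"
proof -
  interpret commutative_fusion_category K C
    using assms(3,5) by (simp add: commutative_fusion_category_def commutative_fusion_category_axioms_def)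
  obtain n where n: "adjoint_series C n = vec_subcategory C"
    using assms(4) by (auto simp: nilpotent_category_def)
  have "X \<in> D" if "direct_sum C X (replicate k (unito C))" for X k
    by (rule fusion_subcategoryD(4)[OF assms(7) _ that])
      (use fusion_subcategoryD(2)[OF assms(7)] in auto)
  then have "adjoint_series C n \<subseteq> D"
    unfolding n vec_subcategory_def by blast
  then show ?thesis
    using adjoint_series_le_imp_eq assms(6-8) by blast
qed

end
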